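(* Let $w(x)=\sup_{\tau}\limsup_{T\to\infty}\mathbb E^x\{\int_0^{\tau\wedge T}f(X_s)\,ds+g(X_{\tau\wedge T})\}$ and assume $\mu(f)<0$. Assume (D1): there are $K:E\to(0,\infty)$ bounded on compact sets and $h:[0,\infty)\to[0,\infty)$ with $\int_0^\infty h(t)dt<\infty$ such that $\|P_t(x,\cdot)-\mu(\cdot)\|_{TV}<K(x)h(t)$ for all $x,t$; and (D2): $\mathbb E^x\{K(X_T)\}<\infty$ for all $x\in E$, $T\ge0$. Assume moreover one of: (a) $(X_t)$ is strongly Feller; or (b) for every compact $L\subset E$ there is $\alpha>0$ with $\sup_{x\in L,T\ge0}\mathbb E^x\{K(X_T)^{1+\alpha}\}<\infty$. Then $w$ is continuous.
   Context: $E$ is a locally compact separable metric space in which every closed ball is compact. $(X_t)$ is a right-continuous time-homogeneous (standard) Markov process on $E$ with laws $\mathbb P^x$, expectations $\mathbb E^x$, transition probabilities $P_t(x,\cdot)$, semigroup $P_t\phi(x)=\mathbb E^x\phi(X_t)$. Standing assumptions: (weak Feller) $P_t\mathcal C_0\subseteq\mathcal C_0$ ($\mathcal C_0$: continuous bounded functions vanishing at infinity); (ergodicity) there is a unique probability measure $\mu$ with $\|P_t(x,\cdot)-\mu\|_{TV}\to0$ for all $x$; $f,g$ continuous and bounded; $\mu(f)=\int f\,d\mu$. Strongly Feller: $P_t$, $t>0$, maps bounded measurable functions to continuous functions. Stopping times may be infinite. *)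

theory Defs
  imports "HOL-Probability.Probability"
begin

text \<open>A time-homogeneous right-continuous strong Markov process on the state space
  UNIV :: 'e set, realised on a filtered measurable space (M, F) with laws Px x
  (the law of the process started at x) and paths X t \<omega>, t \<ge> 0.\<close>

definition filtered_space :: "'w measure \<Rightarrow> (real \<Rightarrow> 'w measure) \<Rightarrow> bool" where
  "filtered_space M F \<longleftrightarrow>
     (\<forall>t\<ge>0. space (F t) = space M \<and> sets (F t) \<subseteq> sets M) \<and>
     (\<forall>s t. 0 \<le> s \<and> s \<le> t \<longrightarrow> sets (F s) \<subseteq> sets (F t))"

definition stopping_time_of :: "'w measure \<Rightarrow> (real \<Rightarrow> 'w measure) \<Rightarrow> ('w \<Rightarrow> ennreal) \<Rightarrow> bool" where
  "stopping_time_of M F \<tau> \<longleftrightarrow> (\<forall>t\<ge>0. {\<omega> \<in> space M. \<tau> \<omega> \<le> ennreal t} \<in> sets (F t))"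

definition prior_sets :: "'w measure \<Rightarrow> (real \<Rightarrow> 'w measure) \<Rightarrow> ('w \<Rightarrow> ennreal) \<Rightarrow> 'w set set" where
  "prior_sets M F \<tau> = {A \<in> sets M. \<forall>t\<ge>0. A \<inter> {\<omega> \<in> space M. \<tau> \<omega> \<le> ennreal t} \<in> sets (F t)}"

definition semigroup :: "('e \<Rightarrow> 'w measure) \<Rightarrow> (real \<Rightarrow> 'w \<Rightarrow> 'e) \<Rightarrow> real \<Rightarrow> ('e \<Rightarrow> real) \<Rightarrow> 'e \<Rightarrow> real" where
  "semigroup Px X t \<phi> x = (\<integral>\<omega>. \<phi> (X t \<omega>) \<partial>Px x)"

definition transition :: "('e::topological_space \<Rightarrow> 'w measure) \<Rightarrow> (real \<Rightarrow> 'w \<Rightarrow> 'e) \<Rightarrow> real \<Rightarrow> 'e \<Rightarrow> 'e measure" where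
  "transition Px X t x = distr (Px x) borel (X t)"

definition markov_process ::
  "'w measure \<Rightarrow> (real \<Rightarrow> 'w measure) \<Rightarrow> (real \<Rightarrow> 'w \<Rightarrow> 'e::topological_space) \<Rightarrow> ('e \<Rightarrow> 'w measure) \<Rightarrow> bool" where
  "markov_process M F X Px \<longleftrightarrow>
     filtered_space M F \<and>
     (\<forall>x. prob_space (Px x) \<and> sets (Px x) = sets M) \<and>
     (\<forall>t\<ge>0. X t \<in> measurable (F t) borel) \<and>
     (\<forall>\<omega>\<in>space M. \<forall>t\<ge>0. continuous (at_right t) (\<lambda>s. X s \<omega>)) \<and>
     (\<forall>x. emeasure (Px x) {\<omega> \<in> space M. X 0 \<omega> = x} = 1) \<and>
     (\<forall>A\<in>sets M. (\<lambda>x. emeasure (Px x) A) \<in> borel_measurable borel) \<and>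
     \<comment> \<open>strong Markov property, for every (possibly infinite) stopping time\<close>
     (\<forall>\<sigma> x s \<phi> A. stopping_time_of M F \<sigma> \<and> A \<in> prior_sets M F \<sigma> \<and> 0 \<le> s \<and>
         \<phi> \<in> borel_measurable borel \<and> bounded (range \<phi>) \<longrightarrow>
        (\<integral>\<omega>. indicator (A \<inter> {\<omega>. \<sigma> \<omega> < \<infinity>}) \<omega> * \<phi> (X (enn2real (\<sigma> \<omega>) + s) \<omega>) \<partial>Px x)
      = (\<integral>\<omega>. indicator (A \<inter> {\<omega>. \<sigma> \<omega> < \<infinity>}) \<omega> * semigroup Px X s \<phi> (X (enn2real (\<sigma> \<omega>)) \<omega>) \<partial>Px x))"

definition tv_dist :: "'a measure \<Rightarrow> 'a measure \<Rightarrow> real" where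
  "tv_dist P Q = (SUP A \<in> sets P. \<bar>measure P A - measure Q A\<bar>)"

definition C0 :: "('e::metric_space \<Rightarrow> real) set" where
  "C0 = {\<phi>. continuous_on UNIV \<phi> \<and> bounded (range \<phi>) \<and>
            (\<forall>e>0. \<exists>C. compact C \<and> (\<forall>x. x \<notin> C \<longrightarrow> \<bar>\<phi> x\<bar> < e))}"

definition weak_feller :: "('e::metric_space \<Rightarrow> 'w measure) \<Rightarrow> (real \<Rightarrow> 'w \<Rightarrow> 'e) \<Rightarrow> bool" where
  "weak_feller Px X \<longleftrightarrow> (\<forall>t\<ge>0. \<forall>\<phi>\<in>C0. semigroup Px X t \<phi> \<in> C0)"

definition strong_feller :: "('e::metric_space \<Rightarrow> 'w measure) \<Rightarrow> (real \<Rightarrow> 'w \<Rightarrow> 'e) \<Rightarrow> bool" where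
  "strong_feller Px X \<longleftrightarrow> (\<forall>t>0. \<forall>\<phi>. \<phi> \<in> borel_measurable borel \<and> bounded (range \<phi>) \<longrightarrow>
      continuous_on UNIV (semigroup Px X t \<phi>))"

text \<open>Ergodicity with invariant probability mu: total variation convergence from every x.
  (Uniqueness of such mu is automatic.)\<close>
definition ergodic_with :: "('e::metric_space \<Rightarrow> 'w measure) \<Rightarrow> (real \<Rightarrow> 'w \<Rightarrow> 'e) \<Rightarrow> 'e measure \<Rightarrow> bool" where
  "ergodic_with Px X \<mu> \<longleftrightarrow> prob_space \<mu> \<and> sets \<mu> = sets borel \<and>
     (\<forall>x. ((\<lambda>t. tv_dist (transition Px X t x) \<mu>) \<longlongrightarrow> 0) at_top)"

definition value_fun ::
  "'w measure \<Rightarrow> (real \<Rightarrow> 'w measure) \<Rightarrow> (real \<Rightarrow> 'w \<Rightarrow> 'e) \<Rightarrow> ('e \<Rightarrow> 'w measure)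
    \<Rightarrow> ('e \<Rightarrow> real) \<Rightarrow> ('e \<Rightarrow> real) \<Rightarrow> 'e \<Rightarrow> ereal" where
  "value_fun M F X Px f g x =
     (SUP \<tau> \<in> {\<tau>. stopping_time_of M F \<tau>}.
        Limsup at_top (\<lambda>T::real. ereal (\<integral>\<omega>.
            (LINT s:{0..enn2real (min (\<tau> \<omega>) (ennreal T))}|lborel. f (X s \<omega>))
            + g (X (enn2real (min (\<tau> \<omega>) (ennreal T))) \<omega>) \<partial>Px x)))"

end

theory Submission
  imports Defs
begin

text \<open>
  Since \<open>\<mu>(f) < 0\<close>, one may enlarge \<open>f\<close> to some \<open>u\<close> which still has negative mean \<open>m\<close> but is positive off a compact
  set. The potential \<open>q = \<integral>\<^sub>0\<^sup>\<infinity> (P\<^sub>s u - m) ds\<close> and its finite-time versions are then bounded below, so by the strong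
  Markov property a stopping time with acceptable reward has a bounded mean, locally uniformly in the starting point.
  The reward collected after a late time \<open>T\<close> is at most the expectation of \<open>q(X\<^sub>T)\<close> on a set of small probability,
  and \<open>q(X\<^sub>T)\<close> is uniformly integrable because its mean and the means of its truncations converge to those under \<open>\<mu>\<close>.
  So \<open>w\<close> is locally uniformly close to the value with horizon \<open>T\<close>. The latter is locally a uniform
  limit of Bermudan values, which are continuous by the Feller property: for \<open>g\<close> in \<open>C0\<close> one approximates \<open>g\<close> uniformly
  by convex combinations of its short time averages (Simons' inequality replaces strong continuity of the semigroup),
  and a compact containment estimate reduces bounded continuous \<open>g\<close> to this case.
\<close>

section \<open>Convex combinations and total variation\<close>

text \<open>The obstacle is that the rate of convergence to equilibrium carries the factor
  \<open>K x\<close>, which may be unbounded, so potentials are only locally bounded and stopping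
  may happen where \<open>K\<close> is huge. The estimates are therefore one-sided. A lower bound on
  potentials is global and suffices at stopping times, because what is forgone after stopping then
  costs at most a constant. An upper bound is needed only at the start, where \<open>K\<close> is
  locally bounded, and at one deterministic late time, where only the mean of the potential has to
  be controlled. That mean is compared with its exact value under the invariant law, so that no mass
  can escape to infinity. The constants depend on the starting point only through a bound of
  \<open>K\<close> on a closed ball, which makes the final approximation uniform near each point.
  The approximating value is the payoff of an actual stopping rule, so the lower estimate holds
  everywhere without error and only the upper one needs work.\<close>

inductive_set dyadic_hull :: "(nat \<Rightarrow> 'b \<Rightarrow> real) \<Rightarrow> nat \<Rightarrow> ('b \<Rightarrow> real) set"
  for a :: "nat \<Rightarrow> 'b \<Rightarrow> real" and n :: nat where
  \<comment> \<open>Midpoints are the only combinations that the dyadic series in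
    \<open>simons\<close> requires: its tail is folded up from the far end, one halving at a
    time.\<close>
  base: "n \<le> k \<Longrightarrow> a k \<in> dyadic_hull a n"
| midpoint: "f \<in> dyadic_hull a n \<Longrightarrow> g \<in> dyadic_hull a n \<Longrightarrow> (\<lambda>y. (f y + g y) / 2) \<in> dyadic_hull a n"

lemma dyadic_hull_mono: "m \<le> n \<Longrightarrow> dyadic_hull a n \<subseteq> dyadic_hull a m"
proof
  fix f assume mn: "m \<le> n" and "f \<in> dyadic_hull a n"
  from this(2) show "f \<in> dyadic_hull a m"
    by induction (use mn in \<open>auto intro: dyadic_hull.intros\<close>)
qed

lemma dyadic_hull_le:
  assumes "f \<in> dyadic_hull a n" "\<And>k. n \<le> k \<Longrightarrow> a k y \<le> c"
  shows "f y \<le> c"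
  using assms(1) by induction (use assms(2) in auto)

lemma dyadic_hull_ge:
  assumes "f \<in> dyadic_hull a n" "\<And>k. n \<le> k \<Longrightarrow> c \<le> a k y"
  shows "c \<le> f y"
  using assms(1) by induction (use assms(2) in auto)

lemma dyadic_hull_abs_le:
  assumes "f \<in> dyadic_hull a n" "\<And>k. \<bar>a k y\<bar> \<le> c"
  shows "\<bar>f y\<bar> \<le> c"
  using dyadic_hull_le[OF assms(1), of y c] dyadic_hull_ge[OF assms(1), of "-c" y] assms(2)
  by (simp add: abs_le_iff) (metis minus_le_iff)

lemma dyadic_series_tail:
  fixes v :: "nat \<Rightarrow> real"
  assumes "\<And>k. \<bar>v k\<bar> \<le> c"
  shows "\<bar>(\<Sum>k. v k / 2 ^ Suc k) - (\<Sum>k<N. v k / 2 ^ Suc k)\<bar> \<le> c / 2 ^ N"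
proof -
  have geo: "(\<lambda>k. c / 2 ^ Suc (k + n)) sums (c / 2 ^ n)" for n :: nat
    using sums_mult[OF power_half_series, of "c / 2 ^ n"] by (simp add: power_add power_divide field_simps)
  have le: "\<bar>v k / 2 ^ Suc k\<bar> \<le> c / 2 ^ Suc k" for k
    using assms[of k] by (simp add: divide_right_mono)
  have summ: "summable (\<lambda>k. v k / 2 ^ Suc k)"
    by (rule summable_comparison_test'[OF sums_summable[OF geo[of 0]], of 0]) (use le in simp)
  have "(\<Sum>k. v k / 2 ^ Suc k) - (\<Sum>k<N. v k / 2 ^ Suc k) = (\<Sum>k. v (k + N) / 2 ^ Suc (k + N))"
    using suminf_split_initial_segment[OF summ, of N] by simp
  also have "\<bar>\<dots>\<bar> \<le> c / 2 ^ N"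
  proof -
    have "norm (\<Sum>k. v (k + N) / 2 ^ Suc (k + N)) \<le> (\<Sum>k. c / 2 ^ Suc (k + N))"
      by (rule norm_suminf_le) (use le sums_summable[OF geo] in auto)
    then show ?thesis using sums_unique[OF geo[of N]] by simp
  qed
  finally show ?thesis .
qed

text \<open>Simons' inequality for a sequence tending to \<open>0\<close> pointwise. The terms \<open>gs n\<close> are chosen so that giving all of the
  remaining weight \<open>2\<^sup>-\<^sup>n\<close> to \<open>gs n\<close> nearly minimises the supremum; at a maximiser of the resulting series the
  tail averages then cannot tend to \<open>0\<close>.\<close>

lemma simons:
  fixes a :: "nat \<Rightarrow> 'b \<Rightarrow> real"
  assumes bdd: "\<And>k y. \<bar>a k y\<bar> \<le> c"
    and attain: "\<And>gs. (\<And>n. gs n \<in> dyadic_hull a n) \<Longrightarrow>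
        \<exists>y0. \<forall>y. (\<Sum>k. gs k y / 2 ^ Suc k) \<le> (\<Sum>k. gs k y0 / 2 ^ Suc k)"
    and lim: "\<And>y. (\<lambda>k. a k y) \<longlonglongrightarrow> 0"
    and e: "0 < e"
  shows "\<exists>f\<in>dyadic_hull a 0. \<forall>y. f y \<le> e"
proof (rule ccontr)
  assume "\<not> ?thesis"
  then have big: "\<exists>y. e < f y" if "f \<in> dyadic_hull a 0" for f
    using that by (meson not_le)
  have c0: "0 \<le> c" using bdd[of 0 undefined] by linarith
  have hull_abs: "\<bar>f y\<bar> \<le> c" if "f \<in> dyadic_hull a n" for f n y
    by (rule dyadic_hull_abs_le[OF that]) (rule bdd)
  define Phi where "Phi n s f = (SUP y. s y + f y / 2 ^ n)" for n :: nat and s f :: "'b \<Rightarrow> real"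
  have bdd_above: "bdd_above (range (\<lambda>y. s y + f y / 2 ^ n))"
    if "\<And>y. \<bar>s y\<bar> \<le> b" "f \<in> dyadic_hull a m" for s f b m and n :: nat
  proof (rule bdd_aboveI2)
    fix y have "f y / 2 ^ n \<le> c / 2 ^ n" using hull_abs[OF that(2), of y] by (intro divide_right_mono) auto
    also have "\<dots> \<le> c / 1" using c0 by (intro divide_left_mono) auto
    finally show "s y + f y / 2 ^ n \<le> b + c" using that(1)[of y] by (simp add: abs_le_iff)
  qed
  have near: "\<exists>f\<in>dyadic_hull a n. \<forall>g\<in>dyadic_hull a n. Phi n s f \<le> Phi n s g + d"
    if s: "\<And>y. \<bar>s y\<bar> \<le> b" and d: "0 < d" for n s b d
  proof -
    have ne: "Phi n s ` dyadic_hull a n \<noteq> {}" using dyadic_hull.base[of n n a] by auto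
    have bb: "bdd_below (Phi n s ` dyadic_hull a n)"
    proof (rule bdd_belowI2)
      fix f assume f: "f \<in> dyadic_hull a n"
      have "- c / 1 \<le> - c / 2 ^ n" using divide_left_mono[of 1 "2 ^ n" c] c0 by simp
      also have "- c / 2 ^ n \<le> f undefined / 2 ^ n" using hull_abs[OF f, of undefined] by (intro divide_right_mono) auto
      finally have "- b - c \<le> s undefined + f undefined / 2 ^ n" using s[of undefined] by (simp add: abs_le_iff)
      also have "\<dots> \<le> Phi n s f" unfolding Phi_def by (rule cSUP_upper) (use bdd_above[OF s f] in auto)
      finally show "- b - c \<le> Phi n s f" .
    qed
    have "\<exists>v\<in>Phi n s ` dyadic_hull a n. v < Inf (Phi n s ` dyadic_hull a n) + d"
      using cInf_less_iff[OF ne bb, of "Inf (Phi n s ` dyadic_hull a n) + d"] d by simp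
    then obtain f where f: "f \<in> dyadic_hull a n" "Phi n s f < Inf (Phi n s ` dyadic_hull a n) + d" by auto
    show ?thesis using f cINF_lower[OF bb] by (intro bexI[of _ f]) (fastforce intro: less_imp_le)+
  qed
  \<comment> \<open>The error of step n is later multiplied by 2^n, so 4^n in the denominator leaves
    a geometric series: the total loss is at most e/2 and the tail average, which starts at e or
    more, stays above e/2.\<close>
  define ep where "ep n = e / (4 * 4 ^ n)" for n :: nat
  have ep: "0 < ep n" for n using e by (simp add: ep_def)
  define sel where "sel n s = (SOME f. f \<in> dyadic_hull a n \<and> (\<forall>g\<in>dyadic_hull a n. Phi n s f \<le> Phi n s g + ep n))" for n s
  define s where "s = rec_nat (\<lambda>y. 0) (\<lambda>n s y. s y + sel n s y / 2 ^ Suc n)"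
  define gs where "gs n = sel n (s n)" for n
  have s0: "s 0 y = 0" and sS: "s (Suc n) y = s n y + gs n y / 2 ^ Suc n" for n y
    by (auto simp: s_def gs_def)
  have sel: "sel n t \<in> dyadic_hull a n \<and> (\<forall>g\<in>dyadic_hull a n. Phi n t (sel n t) \<le> Phi n t g + ep n)"
    if "\<And>y. \<bar>t y\<bar> \<le> b" for n t b
  proof -
    have "\<exists>f. f \<in> dyadic_hull a n \<and> (\<forall>g\<in>dyadic_hull a n. Phi n t f \<le> Phi n t g + ep n)"
      using near[of t b "ep n" n] that ep by blast
    from someI_ex[OF this] show ?thesis unfolding sel_def .
  qed
  have sb: "\<bar>s n y\<bar> \<le> n * c \<and> gs n \<in> dyadic_hull a n" for n y
  proof -
    have "\<forall>y. \<bar>s n y\<bar> \<le> n * c"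
    proof (induction n)
      case (Suc n)
      show ?case
      proof
        fix y
        have g: "gs n \<in> dyadic_hull a n" unfolding gs_def using sel[of "s n" "n * c" n] Suc by blast
        have "\<bar>gs n y / 2 ^ Suc n\<bar> \<le> c / 2 ^ Suc n" using hull_abs[OF g, of y] by (simp add: divide_right_mono)
        also have "\<dots> \<le> c / 1" using c0 by (intro divide_left_mono) (auto simp del: power_Suc)
        finally have "\<bar>s n y + gs n y / 2 ^ Suc n\<bar> \<le> n * c + c"
          using Suc[rule_format, of y] abs_triangle_ineq[of "s n y" "gs n y / 2 ^ Suc n"] by linarith
        then show "\<bar>s (Suc n) y\<bar> \<le> Suc n * c" unfolding sS by (simp add: algebra_simps)
      qed
    qed (simp add: s0)
    with sel[of "s n" "n * c" n] show ?thesis unfolding gs_def by blast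
  qed
  have gs: "gs n \<in> dyadic_hull a n" for n using sb by blast
  have gsb: "\<bar>gs n y\<bar> \<le> c" for n y using hull_abs[OF gs] .
  have opt: "Phi n (s n) (gs n) \<le> Phi n (s n) g + ep n" if "g \<in> dyadic_hull a n" for n g
    using sel[of "s n" "n * c" n] sb that unfolding gs_def by blast
  define G where "G y = (\<Sum>k. gs k y / 2 ^ Suc k)" for y
  have geo: "summable (\<lambda>k. c / 2 ^ Suc k)"
    using summable_mult[OF summable_mult[OF complete_algebra_summable_geometric[of "1/2::real"], of "1/2"], of c] by (simp add: power_divide)
  have summ: "summable (\<lambda>k. gs k y / 2 ^ Suc k)" for y
    by (rule summable_comparison_test'[OF geo, of 0]) (use gsb in \<open>simp add: divide_right_mono\<close>)
  have s_sum: "s n y = (\<Sum>k<n. gs k y / 2 ^ Suc k)" for n y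
    by (induction n) (auto simp: s0 sS)
  have Gs: "G y - s n y = (\<Sum>k. gs (k + n) y / 2 ^ Suc (k + n))" for y n
    unfolding G_def s_sum using suminf_split_initial_segment[OF summ[of y], of n] by simp
  have geon: "(\<lambda>k. c' / 2 ^ Suc (k + n)) sums (c' / 2 ^ n)" for c' :: real and n :: nat
    using sums_mult[OF power_half_series, of "c' / 2 ^ n"] by (simp add: power_add power_divide field_simps)
  have tail_le: "G y - s n y \<le> c' / 2 ^ n" if "\<And>k. n \<le> k \<Longrightarrow> gs k y \<le> c'" for y n c'
    unfolding Gs
    by (rule sums_le[OF _ summable_sums geon])
       (use that summable_ignore_initial_segment[OF summ[of y], of n] in \<open>auto intro!: divide_right_mono simp: add.commute\<close>)
  have approx: "\<bar>s N y + gs N y / 2 ^ N - G y\<bar> \<le> 2 * c / 2 ^ N" for N y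
  proof -
    have "\<bar>G y - s N y\<bar> \<le> c / 2 ^ N" unfolding G_def s_sum by (rule dyadic_series_tail[OF gsb])
    moreover have "gs N y / 2 ^ N \<le> c / 2 ^ N" "(- c) / 2 ^ N \<le> gs N y / 2 ^ N"
      using gsb[of N y] by (auto intro!: divide_right_mono simp: abs_le_iff simp del: divide_minus_left) 
    ultimately show ?thesis by (simp add: abs_le_iff field_simps)
  qed
  have repr: "\<exists>g\<in>dyadic_hull a n. \<forall>y. s N y + gs N y / 2 ^ N = s n y + g y / 2 ^ n" if "n \<le> N" for n N
    using that
  proof (induction rule: inc_induct)
    case base then show ?case using gs by blast
  next
    case (step n)
    then obtain g where g: "g \<in> dyadic_hull a (Suc n)"
      "\<And>y. s N y + gs N y / 2 ^ N = s (Suc n) y + g y / 2 ^ Suc n" by blast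
    have "(\<lambda>y. (gs n y + g y) / 2) \<in> dyadic_hull a n"
      using gs g(1) dyadic_hull_mono[of n "Suc n" a] by (intro dyadic_hull.midpoint) auto
    then show ?case by (rule bexI[rotated]) (use g(2) in \<open>auto simp: sS field_simps\<close>)
  qed
  obtain y0 where y0: "\<And>y. G y \<le> G y0" using attain[OF gs] unfolding G_def by blast
  have lim0: "(\<lambda>N. b + 2 * c / 2 ^ N) \<longlonglongrightarrow> b" for b :: real
    using tendsto_add[OF tendsto_const[of b] tendsto_mult[OF tendsto_const[of "2 * c"] LIMSEQ_power_zero[of "1/2::real"]]]
    by (simp add: power_divide)
  \<comment> \<open>Frozen sums belong to the hull at 0, so by the negated conclusion each of them
    exceeds e somewhere. In the limit the maximum of the series is at least e.\<close>
  have G_ge: "e \<le> G y0"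
  proof (rule LIMSEQ_le_const[OF lim0], intro exI allI impI)
    fix N :: nat assume "0 \<le> N"
    obtain g where g: "g \<in> dyadic_hull a 0" "\<And>y. s N y + gs N y / 2 ^ N = g y"
      using repr[of 0 N] by (auto simp: s0)
    obtain y where "e < g y" using big[OF g(1)] by blast
    with g(2)[of y] approx[of N y] y0[of y] show "e \<le> G y0 + 2 * c / 2 ^ N" by (simp add: abs_le_iff)
  qed
  \<comment> \<open>Near optimality of \<open>gs n\<close> is tested against the element that
    represents a frozen sum. The supremum for that element is close to the maximum
    \<open>G y0\<close>, up to an error that vanishes with N.\<close>
  have up: "s n y0 + gs n y0 / 2 ^ n \<le> G y0 + ep n" for n
  proof (rule LIMSEQ_le_const[OF lim0], intro exI allI impI)
    fix N assume nN: "n \<le> N"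
    obtain g where g: "g \<in> dyadic_hull a n" "\<And>y. s N y + gs N y / 2 ^ N = s n y + g y / 2 ^ n"
      using repr[OF nN] by blast
    have bs: "\<And>y. \<bar>s n y\<bar> \<le> n * c" using sb by blast
    have "s n y0 + gs n y0 / 2 ^ n \<le> Phi n (s n) (gs n)"
      unfolding Phi_def by (rule cSUP_upper) (use bdd_above[OF bs gs] in auto)
    also have "\<dots> \<le> Phi n (s n) g + ep n" by (rule opt[OF g(1)])
    also have "Phi n (s n) g \<le> G y0 + 2 * c / 2 ^ N"
      unfolding Phi_def
    proof (rule cSUP_least)
      fix y show "s n y + g y / 2 ^ n \<le> G y0 + 2 * c / 2 ^ N"
        using g(2)[of y] approx[of N y] y0[of y] by (simp add: abs_le_iff)
    qed auto
    finally show "s n y0 + gs n y0 / 2 ^ n \<le> G y0 + ep n + 2 * c / 2 ^ N" by simp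
  qed
  \<comment> \<open>This is the weighted average of the values \<open>gs k y0\<close> over k from n
    on, with weights 1/2, 1/4 and so on. It stays above e/2 by the recursion below, while
    convergence of \<open>a k y0\<close> to 0 forces it below e/4.\<close>
  define d where "d n = 2 ^ n * (G y0 - s n y0)" for n
  have d_ge: "d n \<ge> e / 2 + e / 2 / 2 ^ n" for n
  proof (induction n)
    case 0 then show ?case using G_ge by (simp add: d_def s0)
  next
    case (Suc n)
    have "2 ^ n * (gs n y0 / 2 ^ n) \<le> 2 ^ n * (G y0 - s n y0 + ep n)"
      using up[of n] by (intro mult_left_mono) auto
    then have "gs n y0 \<le> d n + 2 ^ n * ep n" by (simp add: d_def algebra_simps)
    moreover have "d (Suc n) = 2 * d n - gs n y0" by (simp add: d_def sS algebra_simps)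
    moreover have "(4::real) ^ n = 2 ^ n * 2 ^ n" by (simp flip: power_mult_distrib)
    then have "2 ^ n * ep n = e / 4 / 2 ^ n" by (simp add: ep_def)
    ultimately show ?case using Suc by simp
  qed
  have "\<forall>\<^sub>F k in sequentially. a k y0 < e / 4" by (rule order_tendstoD(2)[OF lim]) (use e in simp)
  then obtain K where K: "\<And>k. K \<le> k \<Longrightarrow> a k y0 \<le> e / 4"
    unfolding eventually_sequentially by (metis less_imp_le)
  have "gs k y0 \<le> e / 4" if "K \<le> k" for k
    by (rule dyadic_hull_le[OF gs]) (use K that in auto)
  from tail_le[OF this] have "d K \<le> 2 ^ K * (e / 4 / 2 ^ K)" unfolding d_def by (intro mult_left_mono) auto
  then have "d K \<le> e / 4" by simp
  moreover have "0 \<le> e / 2 / 2 ^ K" using e by simp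
  ultimately show False using d_ge[of K] e by linarith
qed

section \<open>Interchange of integrals and expectations in total variation\<close>

lemma fubini_bounded:
  fixes Phi :: "real \<times> 'a \<Rightarrow> real"
  assumes Q: "prob_space Q" and meas: "Phi \<in> borel_measurable (lborel \<Otimes>\<^sub>M Q)"
    and bdd: "\<And>s w. w \<in> space Q \<Longrightarrow> \<bar>Phi (s, w)\<bar> \<le> c"
  shows "(\<integral>w. (LINT s:{a..b}|lborel. Phi (s, w)) \<partial>Q) = (LINT s:{a..b}|lborel. (\<integral>w. Phi (s, w) \<partial>Q))"
    and "(\<lambda>w. (LINT s:{a..b}|lborel. Phi (s, w))) \<in> borel_measurable Q"
    and "(\<lambda>s. (\<integral>w. Phi (s, w) \<partial>Q)) \<in> borel_measurable lborel"
proof -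
  interpret Q: prob_space Q by fact
  interpret pair_sigma_finite lborel Q ..
  have ind: "(\<lambda>(s, w). indicator {a..b} s *\<^sub>R Phi (s, w)) \<in> borel_measurable (lborel \<Otimes>\<^sub>M Q)"
    using meas by (simp add: split_beta')
  have int: "integrable (lborel \<Otimes>\<^sub>M Q) (\<lambda>(s, w). indicator {a..b} s *\<^sub>R Phi (s, w))"
  proof (rule integrableI_bounded_set[where A = "{a..b} \<times> space Q" and B = c])
    show "{a..b} \<times> space Q \<in> sets (lborel \<Otimes>\<^sub>M Q)" by auto
    show "emeasure (lborel \<Otimes>\<^sub>M Q) ({a..b} \<times> space Q) < \<infinity>"
      by (subst Q.emeasure_pair_measure_Times) (auto simp: Q.emeasure_space_1 emeasure_lborel_Icc_eq)
    show "AE x in lborel \<Otimes>\<^sub>M Q. x \<in> {a..b} \<times> space Q \<longrightarrow>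
        norm (case x of (s, w) \<Rightarrow> indicator {a..b} s *\<^sub>R Phi (s, w)) \<le> c"
      using bdd by (auto split: split_indicator)
    show "AE x in lborel \<Otimes>\<^sub>M Q. x \<notin> {a..b} \<times> space Q \<longrightarrow>
        (case x of (s, w) \<Rightarrow> indicator {a..b} s *\<^sub>R Phi (s, w)) = 0"
      by (rule AE_I2) (auto simp: space_pair_measure indicator_def)
  qed (rule ind)
  show "(\<integral>w. (LINT s:{a..b}|lborel. Phi (s, w)) \<partial>Q) = (LINT s:{a..b}|lborel. (\<integral>w. Phi (s, w) \<partial>Q))"
    using Fubini_integral[OF int] by (simp add: set_lebesgue_integral_def)
  show "(\<lambda>w. (LINT s:{a..b}|lborel. Phi (s, w))) \<in> borel_measurable Q"
    unfolding set_lebesgue_integral_def using meas by measurable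
  show "(\<lambda>s. (\<integral>w. Phi (s, w) \<partial>Q)) \<in> borel_measurable lborel"
    using meas by measurable
qed

lemma tv_dist_bound:
  assumes P: "prob_space P" and Q: "prob_space Q" and s: "sets P = sets Q" and A: "A \<in> sets P"
  shows "\<bar>measure P A - measure Q A\<bar> \<le> tv_dist P Q"
proof -
  interpret P: prob_space P by fact
  interpret Q: prob_space Q by fact
  have "bdd_above ((\<lambda>A. \<bar>measure P A - measure Q A\<bar>) ` sets P)"
  proof (rule bdd_aboveI2)
    fix A show "\<bar>measure P A - measure Q A\<bar> \<le> 1"
      using P.prob_le_1[of A] Q.prob_le_1[of A] measure_nonneg[of P A] measure_nonneg[of Q A] by linarith
  qed
  then show ?thesis unfolding tv_dist_def by (rule cSUP_upper[OF A])
qed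

text \<open>Layer cake: each integral equals the integral over t in [0, c] of the measure of the
  level set where t is at most \<open>\<phi>\<close>, and for every t the two level-set measures
  differ by at most the distance.\<close>

lemma tv_dist_integral_nonneg:
  fixes \<phi> :: "'a \<Rightarrow> real"
  assumes P: "prob_space P" and Q: "prob_space Q" and s: "sets P = sets Q"
    and m: "\<phi> \<in> borel_measurable P" and b: "\<And>y. 0 \<le> \<phi> y" "\<And>y. \<phi> y \<le> c"
  shows "\<bar>(\<integral>y. \<phi> y \<partial>P) - (\<integral>y. \<phi> y \<partial>Q)\<bar> \<le> c * tv_dist P Q"
proof -
  have c: "0 \<le> c" using b order_trans by blast
  have layer: "(\<integral>y. \<phi> y \<partial>R) = (LINT t:{0..c}|lborel. measure R {y \<in> space R. t \<le> \<phi> y})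
      \<and> (\<lambda>t. measure R {y \<in> space R. t \<le> \<phi> y}) \<in> borel_measurable lborel"
    if R: "prob_space R" and m: "\<phi> \<in> borel_measurable R" for R
  proof -
    interpret prob_space R by fact
    let ?Phi = "\<lambda>p. of_bool (fst p \<le> \<phi> (snd p)) :: real"
    have 1: "?Phi \<in> borel_measurable (lborel \<Otimes>\<^sub>M R)" using m by measurable
    have 2: "(LINT t:{0..c}|lborel. ?Phi (t, y)) = \<phi> y" for y
    proof -
      have "(LINT t:{0..c}|lborel. ?Phi (t, y)) = (LINT t|lborel. indicator {0..\<phi> y} t)"
        unfolding set_lebesgue_integral_def by (rule Bochner_Integration.integral_cong)
          (use b[of y] in \<open>auto simp: indicator_def\<close>)
      then show ?thesis using b(1)[of y] by simp
    qed
    have 3: "(\<integral>y. ?Phi (t, y) \<partial>R) = measure R {y \<in> space R. t \<le> \<phi> y}" for t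
    proof -
      have "(\<integral>y. ?Phi (t, y) \<partial>R) = (\<integral>y. indicator {y \<in> space R. t \<le> \<phi> y} y \<partial>R)"
        by (rule Bochner_Integration.integral_cong) (auto simp: indicator_def)
      then show ?thesis using m by simp
    qed
    show ?thesis
      using fubini_bounded(1)[OF R 1, of 1 0 c] fubini_bounded(3)[OF R 1, of 1]
      unfolding 2 3 by auto
  qed
  interpret P: prob_space P by fact
  interpret Q: prob_space Q by fact
  have sp: "space P = space Q" using s by (rule sets_eq_imp_space_eq)
  have m': "\<phi> \<in> borel_measurable Q" using m by (simp add: measurable_cong_sets[OF s refl])
  note lP = layer[OF P m] and lQ = layer[OF Q m']
  have i: "set_integrable lborel {0..c} (\<lambda>t. measure R {y \<in> space R. t \<le> \<phi> y})" if "prob_space R" "\<phi> \<in> borel_measurable R" for R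
  proof -
    interpret prob_space R by fact
    show ?thesis unfolding set_integrable_def
      by (rule integrableI_bounded_set_indicator[where B = 1])
         (use layer[OF that] in \<open>auto simp: emeasure_lborel_Icc_eq\<close>)
  qed
  have "(\<integral>y. \<phi> y \<partial>P) - (\<integral>y. \<phi> y \<partial>Q) =
    (LINT t:{0..c}|lborel. measure P {y \<in> space P. t \<le> \<phi> y} - measure Q {y \<in> space Q. t \<le> \<phi> y})"
    using lP lQ set_integral_diff(2)[OF i[OF P m] i[OF Q m']] by simp
  also have "\<bar>\<dots>\<bar> \<le> (LINT t:{0..c}|lborel. \<bar>measure P {y \<in> space P. t \<le> \<phi> y} - measure Q {y \<in> space Q. t \<le> \<phi> y}\<bar>)"
    using set_integral_norm_bound[OF set_integral_diff(1)[OF i[OF P m] i[OF Q m']]] by simp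
  also have "\<dots> \<le> (LINT t:{0..c}|lborel. tv_dist P Q)"
  proof (rule set_integral_mono)
    show "set_integrable lborel {0..c} (\<lambda>t. \<bar>measure P {y \<in> space P. t \<le> \<phi> y} - measure Q {y \<in> space Q. t \<le> \<phi> y}\<bar>)"
      using set_integrable_norm[OF set_integral_diff(1)[OF i[OF P m] i[OF Q m']]] by simp
    show "set_integrable lborel {0..c} (\<lambda>t. tv_dist P Q)"
      unfolding set_integrable_def by (auto simp: emeasure_lborel_Icc_eq)
    fix t show "\<bar>measure P {y \<in> space P. t \<le> \<phi> y} - measure Q {y \<in> space Q. t \<le> \<phi> y}\<bar> \<le> tv_dist P Q"
      using tv_dist_bound[OF P Q s, of "{y \<in> space P. t \<le> \<phi> y}"] borel_measurable_le[OF measurable_const m, of t]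
      by (simp add: sp)
  qed
  also have "\<dots> = c * tv_dist P Q" using c by (simp add: set_lebesgue_integral_def)
  finally show ?thesis .
qed

text \<open>Adding c moves the range into [0, 2c]. Both measures have mass one, so the shift
  cancels, and the factor 2 is the length of the new range.\<close>

lemma tv_dist_integral:
  fixes \<phi> :: "'a \<Rightarrow> real"
  assumes P: "prob_space P" and Q: "prob_space Q" and s: "sets P = sets Q"
    and m: "\<phi> \<in> borel_measurable P" and b: "\<And>y. \<bar>\<phi> y\<bar> \<le> c"
  shows "\<bar>(\<integral>y. \<phi> y \<partial>P) - (\<integral>y. \<phi> y \<partial>Q)\<bar> \<le> 2 * c * tv_dist P Q"
proof -
  interpret P: prob_space P by fact
  interpret Q: prob_space Q by fact
  have m': "\<phi> \<in> borel_measurable Q" using m by (simp add: measurable_cong_sets[OF s refl])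
  have "\<bar>(\<integral>y. \<phi> y + c \<partial>P) - (\<integral>y. \<phi> y + c \<partial>Q)\<bar> \<le> 2 * c * tv_dist P Q"
    by (rule tv_dist_integral_nonneg[OF P Q s]) (use m b in \<open>auto simp: abs_le_iff\<close>, (smt (verit) b)+)
  moreover have "integrable P \<phi>" "integrable Q \<phi>"
    using m m' b by (auto intro!: P.integrable_const_bound[of _ c] Q.integrable_const_bound[of _ c])
  ultimately show ?thesis by (simp add: P.prob_space Q.prob_space)
qed

section \<open>Path integrals and potentials\<close>

text \<open>The bound is kept as an explicit number because it enters the total variation and
  potential estimates.\<close>

definition bounded_by :: "('e::topological_space \<Rightarrow> real) \<Rightarrow> real \<Rightarrow> bool" where
  "bounded_by \<phi> c \<longleftrightarrow> \<phi> \<in> borel_measurable borel \<and> (\<forall>y. \<bar>\<phi> y\<bar> \<le> c)"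

lemma bounded_byD:
  assumes "bounded_by \<phi> c"
  shows "\<phi> \<in> borel_measurable borel" "\<bar>\<phi> y\<bar> \<le> c" "\<phi> y \<le> c" "- c \<le> \<phi> y" "0 \<le> c"
  using assms abs_ge_zero order_trans unfolding bounded_by_def by (auto simp: abs_le_iff minus_le_iff)

lemma bounded_byI: "\<phi> \<in> borel_measurable borel \<Longrightarrow> (\<And>y. \<bar>\<phi> y\<bar> \<le> c) \<Longrightarrow> bounded_by \<phi> c"
  by (simp add: bounded_by_def)

lemma set_integral_bounded:
  fixes u :: "real \<Rightarrow> real"
  assumes "u \<in> borel_measurable borel" "\<And>s. a \<le> s \<Longrightarrow> s \<le> b \<Longrightarrow> \<bar>u s\<bar> \<le> c"
  shows "set_integrable lborel {a..b} u"
  unfolding set_integrable_def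
  by (rule integrableI_bounded_set[where A = "{a..b}" and B = c])
     (use assms in \<open>auto simp: emeasure_lborel_Icc_eq indicator_def\<close>)

lemma set_integral_abs_le:
  fixes u :: "real \<Rightarrow> real"
  assumes i: "set_integrable lborel {a..b} u" and b: "\<And>s. a \<le> s \<Longrightarrow> s \<le> b \<Longrightarrow> \<bar>u s\<bar> \<le> c" and ab: "a \<le> b"
  shows "\<bar>LINT s:{a..b}|lborel. u s\<bar> \<le> c * (b - a)"
proof -
  have "\<bar>LINT s:{a..b}|lborel. u s\<bar> \<le> (LINT s:{a..b}|lborel. \<bar>u s\<bar>)"
    using set_integral_norm_bound[OF i] by simp
  also have "\<dots> \<le> (LINT s:{a..b}|lborel. c)"
    by (rule set_integral_mono)
       (use set_integrable_norm[OF i] b in \<open>auto intro!: set_integral_bounded[where c = "\<bar>c\<bar>"]\<close>)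
  also have "\<dots> = c * (b - a)" using ab by (simp add: set_lebesgue_integral_def)
  finally show ?thesis .
qed

locale strong_markov =
  fixes M :: "'w measure" and F :: "real \<Rightarrow> 'w measure"
    and X :: "real \<Rightarrow> 'w \<Rightarrow> 'e::{metric_space, second_countable_topology}"
    and Px :: "'e \<Rightarrow> 'w measure"
  assumes markov: "markov_process M F X Px"
begin

abbreviation E :: "'e \<Rightarrow> ('w \<Rightarrow> real) \<Rightarrow> real" where
  "E x u \<equiv> \<integral>w. u w \<partial>Px x"

abbreviation P :: "real \<Rightarrow> ('e \<Rightarrow> real) \<Rightarrow> 'e \<Rightarrow> real" where
  "P \<equiv> semigroup Px X"

definition cum :: "('e \<Rightarrow> real) \<Rightarrow> real \<Rightarrow> 'w \<Rightarrow> real" where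
  "cum \<phi> t w = (LINT s:{0..t}|lborel. \<phi> (X s w))"

definition pot :: "('e \<Rightarrow> real) \<Rightarrow> real \<Rightarrow> 'e \<Rightarrow> real" where
  "pot \<phi> S y = (LINT s:{0..S}|lborel. P s \<phi> y)"

text \<open>Extended stopping times enter the value function only after truncation at a horizon, so
  real values in [0, T] are enough. The deterministic bound T also makes all accumulated rewards
  integrable.\<close>

definition stop :: "real \<Rightarrow> ('w \<Rightarrow> real) \<Rightarrow> bool" where
  "stop T \<rho> \<longleftrightarrow> (\<forall>w\<in>space M. 0 \<le> \<rho> w \<and> \<rho> w \<le> T) \<and> (\<forall>t\<ge>0. {w \<in> space M. \<rho> w \<le> t} \<in> sets (F t))"

text \<open>Membership in the stopped sigma-algebra of \<open>\<rho>\<close>.\<close>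

definition prior :: "('w \<Rightarrow> real) \<Rightarrow> 'w set \<Rightarrow> bool" where
  "prior \<rho> B \<longleftrightarrow> B \<in> sets M \<and> (\<forall>t\<ge>0. B \<inter> {w \<in> space M. \<rho> w \<le> t} \<in> sets (F t))"

lemmas markov_parts = markov[unfolded markov_process_def]
lemmas filtered = markov_parts[THEN conjunct1]
  and laws = markov_parts[THEN conjunct2, THEN conjunct1]
  and adapted = markov_parts[THEN conjunct2, THEN conjunct2, THEN conjunct1]
  and right_continuous = markov_parts[THEN conjunct2, THEN conjunct2, THEN conjunct2, THEN conjunct1]
  and starts = markov_parts[THEN conjunct2, THEN conjunct2, THEN conjunct2, THEN conjunct2, THEN conjunct1]
  and kernel = markov_parts[THEN conjunct2, THEN conjunct2, THEN conjunct2, THEN conjunct2, THEN conjunct2, THEN conjunct1]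
  and strong = markov_parts[THEN conjunct2, THEN conjunct2, THEN conjunct2, THEN conjunct2, THEN conjunct2, THEN conjunct2]

lemma Px: "prob_space (Px x)" "sets (Px x) = sets M" "space (Px x) = space M"
  using laws sets_eq_imp_space_eq[of "Px x" M] by auto

lemma Px_measurable [simp]: "measurable (Px x) N = measurable M N"
  by (rule measurable_cong_sets) (auto simp: Px)

lemma pair_Px_measurable [simp]: "measurable (N \<Otimes>\<^sub>M Px x) L = measurable (N \<Otimes>\<^sub>M M) L"
  by (rule measurable_cong_sets[OF sets_pair_measure_cong[OF refl Px(2)] refl])

lemma F:
  shows "0 \<le> t \<Longrightarrow> space (F t) = space M"
    and "0 \<le> t \<Longrightarrow> A \<in> sets (F t) \<Longrightarrow> A \<in> sets M"
    and "0 \<le> s \<Longrightarrow> s \<le> t \<Longrightarrow> A \<in> sets (F s) \<Longrightarrow> A \<in> sets (F t)"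
proof -
  note f = filtered[unfolded filtered_space_def]
  show "0 \<le> t \<Longrightarrow> space (F t) = space M" "0 \<le> t \<Longrightarrow> A \<in> sets (F t) \<Longrightarrow> A \<in> sets M"
    using f[THEN conjunct1, rule_format, of t] by auto
  show "0 \<le> s \<Longrightarrow> s \<le> t \<Longrightarrow> A \<in> sets (F s) \<Longrightarrow> A \<in> sets (F t)"
    using f[THEN conjunct2, rule_format, of s t] by auto
qed

lemma X_F: "0 \<le> t \<Longrightarrow> X t \<in> measurable (F t) borel"
  using adapted by blast

lemma F_imp_M:
  assumes "0 \<le> t" "u \<in> measurable (F t) N"
  shows "u \<in> measurable M N"
proof (rule measurableI)
  show "u w \<in> space N" if "w \<in> space M" for w
    using measurable_space[OF assms(2)] F(1)[OF assms(1)] that by simp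
  show "u -` A \<inter> space M \<in> sets M" if "A \<in> sets N" for A
    using F(2)[OF assms(1) measurable_sets[OF assms(2) that]] F(1)[OF assms(1)] by simp
qed

lemma X_M: "0 \<le> t \<Longrightarrow> X t \<in> measurable M borel"
  by (rule F_imp_M[OF _ X_F])

lemma X_right: "w \<in> space M \<Longrightarrow> 0 \<le> t \<Longrightarrow> ((\<lambda>s. X s w) \<longlongrightarrow> X t w) (at_right t)"
  using right_continuous by (simp add: continuous_within)

text \<open>Right continuity turns measurability at fixed times into joint measurability: the time
  is approximated from the right by a variable with countably many values. The parameter space is
  left general so that products with the time axis and random times are both covered.\<close>

lemma X_comp_measurable:
  assumes u: "u \<in> borel_measurable N" and v: "v \<in> measurable N M" and pos: "\<And>z. z \<in> space N \<Longrightarrow> 0 \<le> u z"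
  shows "(\<lambda>z. X (u z) (v z)) \<in> borel_measurable N"
proof (rule borel_measurable_LIMSEQ_metric)
  fix n :: nat
  show "(\<lambda>z. X ((real (nat \<lfloor>real (Suc n) * u z\<rfloor>) + 1) / real (Suc n)) (v z)) \<in> borel_measurable N"
  proof (rule measurable_compose_countable[of "\<lambda>k z. X ((real k + 1) / real (Suc n)) (v z)" N borel "\<lambda>z. nat \<lfloor>real (Suc n) * u z\<rfloor>"])
    show "(\<lambda>z. X ((real k + 1) / real (Suc n)) (v z)) \<in> borel_measurable N" for k
      by (rule measurable_compose[OF v X_M]) simp
    show "(\<lambda>z. nat \<lfloor>real (Suc n) * u z\<rfloor>) \<in> measurable N (count_space UNIV)" using u by measurable
  qed
next
  fix z assume z: "z \<in> space N"
  \<comment> \<open>The summand 1 makes \<open>r n\<close> strictly larger than \<open>u z\<close>,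
    as a limit along \<open>at_right\<close> demands.\<close>
  define r where "r n = (real (nat \<lfloor>real (Suc n) * u z\<rfloor>) + 1) / real (Suc n)" for n
  have r: "u z < r n \<and> r n \<le> u z + 1 / real (Suc n)" for n
  proof -
    define N where "N = real (Suc n)"
    have N: "0 < N" by (simp add: N_def)
    have "real (nat \<lfloor>N * u z\<rfloor>) = of_int \<lfloor>N * u z\<rfloor>" using pos[OF z] N by simp
    moreover have "N * u z < of_int \<lfloor>N * u z\<rfloor> + 1" "of_int \<lfloor>N * u z\<rfloor> \<le> N * u z" by linarith+
    ultimately show ?thesis unfolding r_def N_def[symmetric] using N by (simp add: field_simps)
  qed
  have "r \<longlonglongrightarrow> u z"
  proof (rule real_tendsto_sandwich[of "\<lambda>n. u z" _ _ "\<lambda>n. u z + 1 / real (Suc n)"])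
    show "(\<lambda>n. u z + 1 / real (Suc n)) \<longlonglongrightarrow> u z"
      using tendsto_add[OF tendsto_const[of "u z"] LIMSEQ_inverse_real_of_nat] by (simp add: inverse_eq_divide)
  qed (use r in \<open>auto intro!: always_eventually less_imp_le\<close>)
  then have "filterlim r (at_right (u z)) sequentially"
    by (rule tendsto_imp_filterlim_at_right) (use r in auto)
  from filterlim_compose[OF X_right[OF measurable_space[OF v z] pos[OF z]] this]
  show "(\<lambda>n. X ((real (nat \<lfloor>real (Suc n) * u z\<rfloor>) + 1) / real (Suc n)) (v z)) \<longlonglongrightarrow> X (u z) (v z)"
    unfolding r_def .
qed

text \<open>Adding the bound c makes the integrand nonnegative, so that measurability of nonnegative
  integrals against a kernel applies; the constant is subtracted again afterwards.\<close>

lemma kernel_measurable: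
  assumes m: "(\<lambda>(z, w). Phi z w) \<in> borel_measurable (N \<Otimes>\<^sub>M M)" and y: "y \<in> measurable N borel"
    and b: "\<And>z w. w \<in> space M \<Longrightarrow> \<bar>Phi z w\<bar> \<le> (c::real)"
  shows "(\<lambda>z. \<integral>w. Phi z w \<partial>Px (y z)) \<in> borel_measurable N"
proof -
  have K: "Px \<in> measurable borel (subprob_algebra M)"
  proof (rule measurable_subprob_algebra)
    show "subprob_space (Px x)" for x using Px(1) by (rule prob_space_imp_subprob_space)
    show "(\<lambda>x. emeasure (Px x) A) \<in> borel_measurable borel" if "A \<in> sets M" for A
      using kernel that by blast
  qed (rule Px)
  have K': "(\<lambda>z. Px (y z)) \<in> measurable N (subprob_algebra M)" using measurable_compose[OF y K] .
  have eq: "(\<integral>w. Phi z w \<partial>Px (y z)) = enn2real (\<integral>\<^sup>+w. ennreal (Phi z w + c) \<partial>Px (y z)) - c"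
    if z: "z \<in> space N" for z
  proof -
    interpret prob_space "Px (y z)" by (rule Px)
    have mz: "Phi z \<in> borel_measurable M"
      using measurable_compose[OF measurable_Pair1'[OF z] m] by simp
    have i: "integrable (Px (y z)) (Phi z)"
      by (rule integrable_const_bound[of _ c]) (use mz b in \<open>auto simp: Px\<close>)
    have "(\<integral>w. Phi z w + c \<partial>Px (y z)) = enn2real (\<integral>\<^sup>+w. ennreal (Phi z w + c) \<partial>Px (y z))"
    proof (rule integral_eq_nn_integral)
      show "AE w in Px (y z). 0 \<le> Phi z w + c"
      proof (rule AE_I2)
        fix w assume "w \<in> space (Px (y z))"
        then show "0 \<le> Phi z w + c" using b[of w z] by (simp add: Px abs_le_iff)
      qed
    qed (use mz in auto)
    then show ?thesis using i by (simp add: prob_space)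
  qed
  have "(\<lambda>z. enn2real (\<integral>\<^sup>+w. ennreal (Phi z w + c) \<partial>Px (y z)) - c) \<in> borel_measurable N"
    using nn_integral_measurable_subprob_algebra2[of "\<lambda>z w. ennreal (Phi z w + c)" N M "\<lambda>z. Px (y z)"] m K'
    by (auto simp: split_beta')
  then show ?thesis by (subst measurable_cong[OF eq]) auto
qed

lemma P_measurable:
  assumes \<phi>: "bounded_by \<phi> c" and u: "u \<in> borel_measurable N" and y: "y \<in> measurable N borel"
    and pos: "\<And>z. z \<in> space N \<Longrightarrow> 0 \<le> u z"
  shows "(\<lambda>z. P (u z) \<phi> (y z)) \<in> borel_measurable N"
  unfolding semigroup_def
proof (rule kernel_measurable[OF _ y, of _ c])
  have "(\<lambda>p. X (u (fst p)) (snd p)) \<in> borel_measurable (N \<Otimes>\<^sub>M M)"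
    by (rule X_comp_measurable) (use u pos in \<open>auto simp: space_pair_measure\<close>)
  from measurable_compose[OF this bounded_byD(1)[OF \<phi>]]
  show "(\<lambda>(z, w). \<phi> (X (u z) w)) \<in> borel_measurable (N \<Otimes>\<^sub>M M)" by (simp add: split_beta')
qed (rule bounded_byD(2)[OF \<phi>])

lemma bounded_integrable:
  assumes "u \<in> borel_measurable M" "\<And>w. w \<in> space M \<Longrightarrow> \<bar>u w\<bar> \<le> (c::real)"
  shows "integrable (Px x) u"
proof -
  interpret prob_space "Px x" by (rule Px)
  show ?thesis by (rule integrable_const_bound[of _ c]) (use assms in \<open>auto simp: Px\<close>)
qed

lemma integral_bounded:
  assumes "u \<in> borel_measurable M" "\<And>w. w \<in> space M \<Longrightarrow> \<bar>u w\<bar> \<le> (c::real)"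
  shows "\<bar>\<integral>w. u w \<partial>Px x\<bar> \<le> c"
proof -
  interpret prob_space "Px x" by (rule Px)
  have "\<bar>\<integral>w. u w \<partial>Px x\<bar> \<le> E x (\<lambda>w. \<bar>u w\<bar>)" by (rule integral_abs_bound)
  also have "\<dots> \<le> E x (\<lambda>w. c)"
    by (rule integral_mono) (use bounded_integrable[OF assms] assms in \<open>auto simp: Px\<close>)
  finally show ?thesis by (simp add: prob_space)
qed

lemma P_bounded_by:
  assumes \<phi>: "bounded_by \<phi> c" and t: "0 \<le> t" shows "bounded_by (P t \<phi>) c"
proof (rule bounded_byI)
  show "P t \<phi> \<in> borel_measurable borel" by (rule P_measurable[OF \<phi>]) (use t in auto)
  show "\<bar>P t \<phi> y\<bar> \<le> c" for y unfolding semigroup_def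
    by (rule integral_bounded) (use measurable_compose[OF X_M[OF t] bounded_byD(1)[OF \<phi>]] bounded_byD(2)[OF \<phi>] in auto)
qed

lemma X_integrable:
  assumes \<phi>: "bounded_by \<phi> c" and t: "0 \<le> t" shows "integrable (Px x) (\<lambda>w. \<phi> (X t w))"
  by (rule bounded_integrable) (use measurable_compose[OF X_M[OF t] bounded_byD(1)[OF \<phi>]] bounded_byD(2)[OF \<phi>] in auto)

lemma P_const: "P t (\<lambda>y. c) x = c"
proof -
  interpret prob_space "Px x" by (rule Px)
  show ?thesis by (simp add: semigroup_def prob_space)
qed

lemma P_add:
  assumes "bounded_by \<phi> c" "bounded_by \<psi> d" "0 \<le> t"
  shows "P t (\<lambda>y. \<phi> y + \<psi> y) x = P t \<phi> x + P t \<psi> x"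
  using X_integrable[OF assms(1,3)] X_integrable[OF assms(2,3)] by (simp add: semigroup_def)

lemma P_diff:
  assumes "bounded_by \<phi> c" "bounded_by \<psi> d" "0 \<le> t"
  shows "P t (\<lambda>y. \<phi> y - \<psi> y) x = P t \<phi> x - P t \<psi> x"
  using X_integrable[OF assms(1,3)] X_integrable[OF assms(2,3)] by (simp add: semigroup_def)

lemma P_cmult: "P t (\<lambda>y. a * \<phi> y) x = a * P t \<phi> x"
  by (simp add: semigroup_def)

lemma P_mono:
  assumes "bounded_by \<phi> c" "bounded_by \<psi> d" "0 \<le> t" "\<And>y. \<phi> y \<le> \<psi> y"
  shows "P t \<phi> x \<le> P t \<psi> x"
  unfolding semigroup_def
  by (rule integral_mono[OF X_integrable[OF assms(1,3)] X_integrable[OF assms(2,3)]]) (rule assms(4))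

lemma P_0: assumes \<phi>: "bounded_by \<phi> c" shows "P 0 \<phi> x = \<phi> x"
proof -
  interpret prob_space "Px x" by (rule Px)
  have e: "emeasure (Px x) {\<omega> \<in> space M. X 0 \<omega> = x} = 1"
    using starts by blast
  have s: "{\<omega> \<in> space M. X 0 \<omega> = x} \<in> sets M"
    using measurable_sets[OF X_M[of 0], of "{x}"] by (simp add: vimage_def Int_def conj_commute)
  have "AE w in Px x. X 0 w = x"
    using AE_in_set_eq_1[of "{\<omega> \<in> space M. X 0 \<omega> = x}"] e s
    by (simp add: Px emeasure_eq_measure)
  then have "E x (\<lambda>w. \<phi> (X 0 w)) = E x (\<lambda>w. \<phi> x)"
    by (intro integral_cong_AE) (use measurable_compose[OF X_M[of 0] bounded_byD(1)[OF \<phi>]] in auto)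
  then show ?thesis by (simp add: semigroup_def prob_space)
qed

text \<open>Nothing is known about the process at negative times. The clipped time
  \<open>max 0 s\<close> agrees with s on every range of integration that occurs and makes the
  integrand measurable on the whole line. The same clipping is used below for the semigroup.\<close>

lemma path_measurable:
  assumes "bounded_by \<phi> c" "w \<in> space M" "0 \<le> r"
  shows "(\<lambda>s. \<phi> (X (r + max 0 s) w)) \<in> borel_measurable borel"
  by (rule measurable_compose[OF X_comp_measurable bounded_byD(1)[OF assms(1)]])
     (use assms(2,3) in auto)

lemma path_integrable:
  assumes "bounded_by \<phi> c" "w \<in> space M" "0 \<le> a"
  shows "set_integrable lborel {a..b} (\<lambda>s. \<phi> (X s w))"
proof -
  have "set_integrable lborel {a..b} (\<lambda>s. \<phi> (X (0 + max 0 s) w))"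
    by (rule set_integral_bounded[OF path_measurable[OF assms(1,2)]]) (use bounded_byD(2)[OF assms(1)] in auto)
  also have "?this \<longleftrightarrow> ?thesis"
    using assms(3) by (intro set_integrable_cong) auto
  finally show ?thesis .
qed

lemma cum_diff:
  assumes "bounded_by \<phi> c" "w \<in> space M" "0 \<le> a" "a \<le> b"
  shows "cum \<phi> b w - cum \<phi> a w = (LINT s:{a..b}|lborel. \<phi> (X s w))"
proof -
  have e: "{0..b} = {0..a} \<union> {a<..b}" using assms by auto
  have i: "set_integrable lborel {a<..b} (\<lambda>s. \<phi> (X s w))"
    by (rule set_integrable_subset[OF path_integrable[OF assms(1,2,3), of b]]) auto
  have "cum \<phi> b w = cum \<phi> a w + (LINT s:{a<..b}|lborel. \<phi> (X s w))"
    unfolding cum_def e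
    by (rule set_integral_Un)
       (use i path_integrable[OF assms(1,2), of 0 a] assms in auto)
  also have "(LINT s:{a<..b}|lborel. \<phi> (X s w)) = (LINT s:{a..b}|lborel. \<phi> (X s w))"
    unfolding set_lebesgue_integral_def
  proof (rule integral_cong_AE)
    show "AE x in lborel. indicat_real {a<..b} x *\<^sub>R \<phi> (X x w) = indicat_real {a..b} x *\<^sub>R \<phi> (X x w)"
      using AE_lborel_singleton[of a] by eventually_elim (auto simp: indicator_def)
    show "(\<lambda>s. indicat_real {a..b} s *\<^sub>R \<phi> (X s w)) \<in> borel_measurable lborel"
      using path_integrable[OF assms(1,2,3), of b] unfolding set_integrable_def by auto
    show "(\<lambda>s. indicat_real {a<..b} s *\<^sub>R \<phi> (X s w)) \<in> borel_measurable lborel"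
      using i unfolding set_integrable_def by auto
  qed
  finally show ?thesis by simp
qed

lemma cum_diff_bound:
  assumes "bounded_by \<phi> c" "w \<in> space M" "0 \<le> a" "a \<le> b"
  shows "\<bar>cum \<phi> b w - cum \<phi> a w\<bar> \<le> c * (b - a)"
  unfolding cum_diff[OF assms]
  by (rule set_integral_abs_le[OF path_integrable[OF assms(1,2,3)] bounded_byD(2)[OF assms(1)] assms(4)])

lemma cum_0: "cum \<phi> 0 w = 0"
proof -
  have "(\<integral>s. indicator {0..0::real} s *\<^sub>R \<phi> (X s w) \<partial>lborel) = (\<integral>s. 0 \<partial>(lborel :: real measure))"
  proof (rule integral_cong_AE)
    show "(\<lambda>s. indicat_real {0..0} s *\<^sub>R \<phi> (X s w)) \<in> borel_measurable lborel"
    proof -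
      have "(\<lambda>s. indicat_real {0..0} s *\<^sub>R \<phi> (X s w)) = (\<lambda>s. indicat_real {0} s *\<^sub>R \<phi> (X 0 w))"
        by (auto simp: indicator_def)
      then show ?thesis by simp
    qed
  qed (use AE_lborel_singleton[of 0] in \<open>auto elim: eventually_mono\<close>)
  then show ?thesis by (simp add: cum_def set_lebesgue_integral_def)
qed

lemma cum_bound: "bounded_by \<phi> c \<Longrightarrow> w \<in> space M \<Longrightarrow> 0 \<le> t \<Longrightarrow> \<bar>cum \<phi> t w\<bar> \<le> c * t"
  using cum_diff_bound[of \<phi> c w 0 t] by (simp add: cum_0)

lemma cum_mono_le:
  assumes "bounded_by \<phi> c" "bounded_by \<psi> d" "\<And>y. \<phi> y \<le> \<psi> y" "w \<in> space M" "0 \<le> a" "a \<le> b"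
  shows "cum \<phi> b w - cum \<phi> a w \<le> cum \<psi> b w - cum \<psi> a w"
  unfolding cum_diff[OF assms(1,4,5,6)] cum_diff[OF assms(2,4,5,6)]
  by (rule set_integral_mono[OF path_integrable[OF assms(1,4,5)] path_integrable[OF assms(2,4,5)]]) (rule assms(3))

lemma cum_shift:
  assumes "bounded_by \<phi> c" "w \<in> space M" "0 \<le> r" "0 \<le> S"
  shows "cum \<phi> (r + S) w - cum \<phi> r w = (LINT s:{0..S}|lborel. \<phi> (X (r + s) w))"
proof -
  have "cum \<phi> (r + S) w - cum \<phi> r w = (LINT s:{r..r+S}|lborel. \<phi> (X s w))"
    by (rule cum_diff) (use assms in auto)
  also have "\<dots> = (LINT s|lborel. indicator {r..r+S} (r + s) *\<^sub>R \<phi> (X (r + s) w))"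
    unfolding set_lebesgue_integral_def
    using lborel_integral_real_affine[of 1 "\<lambda>s. indicator {r..r+S} s *\<^sub>R \<phi> (X s w)" r] by simp
  also have "\<dots> = (LINT s:{0..S}|lborel. \<phi> (X (r + s) w))"
    unfolding set_lebesgue_integral_def by (rule Bochner_Integration.integral_cong) (auto simp: indicator_def)
  finally show ?thesis .
qed

lemma cum_measurable:
  assumes \<phi>: "bounded_by \<phi> c" and r: "\<rho> \<in> borel_measurable M"
  shows "(\<lambda>w. cum \<phi> (\<rho> w) w) \<in> borel_measurable M"
proof -
  have "(\<lambda>p. \<phi> (X (max 0 (snd p)) (fst p))) \<in> borel_measurable (M \<Otimes>\<^sub>M lborel)"
    by (rule measurable_compose[OF X_comp_measurable bounded_byD(1)[OF \<phi>]]) auto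
  then have "(\<lambda>w. LINT s|lborel. of_bool (0 \<le> s \<and> s \<le> \<rho> w) * \<phi> (X (max 0 s) w)) \<in> borel_measurable M"
    using r by (intro lborel.borel_measurable_lebesgue_integral) (simp add: split_beta')
  also have "(\<lambda>w. LINT s|lborel. of_bool (0 \<le> s \<and> s \<le> \<rho> w) * \<phi> (X (max 0 s) w)) = (\<lambda>w. cum \<phi> (\<rho> w) w)"
    unfolding cum_def set_lebesgue_integral_def
    by (intro ext Bochner_Integration.integral_cong) (auto simp: indicator_def max_def)
  finally show ?thesis .
qed

lemma X_fubini:
  assumes "bounded_by \<phi> c" "0 \<le> S"
  shows "E x (\<lambda>w. cum \<phi> S w) = pot \<phi> S x"
proof -
  have m: "(\<lambda>p. \<phi> (X (max 0 (fst p)) (snd p))) \<in> borel_measurable (lborel \<Otimes>\<^sub>M Px x)"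
    unfolding pair_Px_measurable by (rule measurable_compose[OF X_comp_measurable bounded_byD(1)[OF assms(1)]]) auto
  have "E x (\<lambda>w. (LINT s:{0..S}|lborel. \<phi> (X (max 0 s) w))) = (LINT s:{0..S}|lborel. \<integral>w. \<phi> (X (max 0 s) w) \<partial>Px x)"
    using fubini_bounded(1)[OF Px(1) m, of c] bounded_byD(2)[OF assms(1)] by simp
  also have "(LINT s:{0..S}|lborel. \<integral>w. \<phi> (X (max 0 s) w) \<partial>Px x) = pot \<phi> S x"
    unfolding pot_def semigroup_def by (rule set_lebesgue_integral_cong) auto
  also have "E x (\<lambda>w. (LINT s:{0..S}|lborel. \<phi> (X (max 0 s) w))) = E x (\<lambda>w. cum \<phi> S w)"
    unfolding cum_def by (intro Bochner_Integration.integral_cong refl set_lebesgue_integral_cong) auto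
  finally show ?thesis by simp
qed

lemma pot_measurable:
  assumes \<phi>: "bounded_by \<phi> c" and r: "\<rho> \<in> borel_measurable N" and y: "y \<in> measurable N borel"
  shows "(\<lambda>z. pot \<phi> (\<rho> z) (y z)) \<in> borel_measurable N"
proof -
  have "(\<lambda>p. P (max 0 (snd p)) \<phi> (y (fst p))) \<in> borel_measurable (N \<Otimes>\<^sub>M lborel)"
    by (rule P_measurable[OF \<phi>]) (use y in auto)
  then have "(\<lambda>z. LINT s|lborel. of_bool (0 \<le> s \<and> s \<le> \<rho> z) * P (max 0 s) \<phi> (y z)) \<in> borel_measurable N"
    using r by (intro lborel.borel_measurable_lebesgue_integral) (simp add: split_beta')
  also have "(\<lambda>z. LINT s|lborel. of_bool (0 \<le> s \<and> s \<le> \<rho> z) * P (max 0 s) \<phi> (y z)) = (\<lambda>z. pot \<phi> (\<rho> z) (y z))"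
    unfolding pot_def set_lebesgue_integral_def
    by (intro ext Bochner_Integration.integral_cong) (auto simp: indicator_def max_def)
  finally show ?thesis .
qed

lemma pot_bounded_by:
  assumes \<phi>: "bounded_by \<phi> c" and S: "0 \<le> S"
  shows "bounded_by (pot \<phi> S) (c * S)"
proof (rule bounded_byI)
  show "pot \<phi> S \<in> borel_measurable borel" by (rule pot_measurable[OF \<phi>]) auto
  show "\<bar>pot \<phi> S y\<bar> \<le> c * S" for y
    unfolding X_fubini[OF assms, symmetric]
    by (rule integral_bounded) (use cum_measurable[OF \<phi>] cum_bound[OF \<phi>] S in auto)
qed

end

section \<open>Stopping and the strong Markov property\<close>

context strong_markov begin

lemma stopD:
  assumes "stop T \<rho>"
  shows "w \<in> space M \<Longrightarrow> 0 \<le> \<rho> w" "w \<in> space M \<Longrightarrow> \<rho> w \<le> T"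
    "0 \<le> t \<Longrightarrow> {w \<in> space M. \<rho> w \<le> t} \<in> sets (F t)" "\<rho> \<in> borel_measurable M"
proof -
  show 1: "w \<in> space M \<Longrightarrow> 0 \<le> \<rho> w" for w using assms by (simp add: stop_def)
  show "w \<in> space M \<Longrightarrow> \<rho> w \<le> T" using assms by (simp add: stop_def)
  show 2: "0 \<le> t \<Longrightarrow> {w \<in> space M. \<rho> w \<le> t} \<in> sets (F t)" for t using assms by (simp add: stop_def)
  show "\<rho> \<in> borel_measurable M"
  proof (rule borel_measurableI_le)
    fix t show "{w \<in> space M. \<rho> w \<le> t} \<in> sets M"
    proof (cases "0 \<le> t")
      case True with 2 F(2) show ?thesis by blast
    next
      case False
      then have "{w \<in> space M. \<rho> w \<le> t} = {}" using 1 by force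
      then show ?thesis by (simp only: sets.empty_sets)
    qed
  qed
qed

lemma F_Diff: "0 \<le> t \<Longrightarrow> A \<in> sets (F t) \<Longrightarrow> B \<in> sets (F t) \<Longrightarrow> A - B \<in> sets (F t)"
  by (rule sets.Diff)

lemma space_F: "0 \<le> t \<Longrightarrow> space M \<in> sets (F t)"
  using sets.top[of "F t"] F(1)[of t] by simp

lemma stop_const: "0 \<le> a \<Longrightarrow> a \<le> T \<Longrightarrow> stop T (\<lambda>_. a)"
  unfolding stop_def using space_F by auto

lemma prior_const: assumes a: "0 \<le> a" and A: "A \<in> sets (F a)" shows "prior (\<lambda>_. a) A"
  unfolding prior_def
proof (intro conjI allI impI)
  show "A \<in> sets M" using F(2)[OF a A] .
  fix t :: real assume t: "0 \<le> t"
  have "A \<inter> {w \<in> space M. a \<le> t} = (if a \<le> t then A else {})"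
    using sets.sets_into_space[OF A] F(1)[OF a] by auto
  then show "A \<inter> {w \<in> space M. a \<le> t} \<in> sets (F t)" using F(3)[OF a _ A] by auto
qed

lemma prior_space: assumes "stop T \<rho>" shows "prior \<rho> (space M)"
  unfolding prior_def using stopD(3)[OF assms]
  by (auto simp: Int_absorb1 subset_eq)

lemma prior_le: assumes \<rho>: "stop T \<rho>" and B: "prior \<rho> B" shows "prior \<rho> (B \<inter> {w \<in> space M. \<rho> w \<le> c})"
  unfolding prior_def
proof (intro conjI allI impI)
  show "B \<inter> {w \<in> space M. \<rho> w \<le> c} \<in> sets M"
    using B stopD(4)[OF \<rho>] unfolding prior_def by auto
  fix t :: real assume t: "0 \<le> t"
  show "B \<inter> {w \<in> space M. \<rho> w \<le> c} \<inter> {w \<in> space M. \<rho> w \<le> t} \<in> sets (F t)"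
  proof (cases "0 \<le> c")
    case True
    have "B \<inter> {w \<in> space M. \<rho> w \<le> min c t} \<in> sets (F (min c t))"
      using B[unfolded prior_def, THEN conjunct2, rule_format, of "min c t"] True t by simp
    from F(3)[OF _ _ this, of t] True t
    have "B \<inter> {w \<in> space M. \<rho> w \<le> min c t} \<in> sets (F t)" by auto
    also have "B \<inter> {w \<in> space M. \<rho> w \<le> min c t} = B \<inter> {w \<in> space M. \<rho> w \<le> c} \<inter> {w \<in> space M. \<rho> w \<le> t}"
      by auto
    finally show ?thesis .
  next
    case False
    then have "B \<inter> {w \<in> space M. \<rho> w \<le> c} = {}" using stopD(1)[OF \<rho>] by force
    then show ?thesis by simp
  qed
qed

lemma gt_F: assumes \<rho>: "stop T \<rho>" and a: "0 \<le> a" shows "{w \<in> space M. a < \<rho> w} \<in> sets (F a)"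
proof -
  have "{w \<in> space M. a < \<rho> w} = space M - {w \<in> space M. \<rho> w \<le> a}" by auto
  then show ?thesis using F_Diff[OF a space_F[OF a] stopD(3)[OF \<rho> a]] by simp
qed

lemma prior_gt: assumes \<rho>: "stop T \<rho>" and a: "0 \<le> a" shows "prior \<rho> {w \<in> space M. a < \<rho> w}"
  unfolding prior_def
proof (intro conjI allI impI)
  show "{w \<in> space M. a < \<rho> w} \<in> sets M" using gt_F[OF assms] F(2)[OF a] by blast
  fix t :: real assume t: "0 \<le> t"
  show "{w \<in> space M. a < \<rho> w} \<inter> {w \<in> space M. \<rho> w \<le> t} \<in> sets (F t)"
  proof (cases "a \<le> t")
    case True
    then show ?thesis using F(3)[OF a True gt_F[OF assms]] stopD(3)[OF \<rho> t] by auto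
  next
    case False
    then have "{w \<in> space M. a < \<rho> w} \<inter> {w \<in> space M. \<rho> w \<le> t} = {}" by auto
    then show ?thesis by simp
  qed
qed

lemma stop_min: assumes \<rho>: "stop T \<rho>" and a: "0 \<le> a" shows "stop a (\<lambda>w. min (\<rho> w) a)"
proof -
  have "{w \<in> space M. min (\<rho> w) a \<le> t} = (if a \<le> t then space M else {w \<in> space M. \<rho> w \<le> t})" for t
    by auto
  then show ?thesis unfolding stop_def using stopD[OF \<rho>] a space_F by auto
qed

lemma X_stop_measurable:
  assumes "stop T \<rho>" "0 \<le> s" shows "(\<lambda>w. X (\<rho> w + s) w) \<in> borel_measurable M"
  by (rule X_comp_measurable) (use stopD[OF assms(1)] assms(2) in auto)

lemma X_stop_measurable0: "stop T \<rho> \<Longrightarrow> (\<lambda>w. X (\<rho> w) w) \<in> borel_measurable M"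
  using X_stop_measurable[of T \<rho> 0] by simp

lemma comp_stop_measurable:
  "stop T \<rho> \<Longrightarrow> bounded_by \<phi> c \<Longrightarrow> (\<lambda>w. \<phi> (X (\<rho> w) w)) \<in> borel_measurable M"
  using measurable_compose[OF X_stop_measurable0 bounded_byD(1)] .

lemma comp_stop_integrable:
  "stop T \<rho> \<Longrightarrow> bounded_by \<phi> c \<Longrightarrow> integrable (Px x) (\<lambda>w. \<phi> (X (\<rho> w) w))"
  by (rule bounded_integrable[OF comp_stop_measurable bounded_byD(2)])

lemma cum_stop_integrable:
  assumes "stop T \<rho>" "bounded_by \<phi> c" shows "integrable (Px x) (\<lambda>w. cum \<phi> (\<rho> w) w)"
proof (rule bounded_integrable[OF cum_measurable[OF assms(2) stopD(4)[OF assms(1)]]])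
  fix w assume w: "w \<in> space M"
  have "\<bar>cum \<phi> (\<rho> w) w\<bar> \<le> c * \<rho> w" by (rule cum_bound[OF assms(2) w stopD(1)[OF assms(1) w]])
  also have "\<dots> \<le> c * T" using stopD(2)[OF assms(1) w] bounded_byD(5)[OF assms(2)] by (rule mult_left_mono)
  finally show "\<bar>cum \<phi> (\<rho> w) w\<bar> \<le> c * T" .
qed

lemma indicator_integrable:
  assumes "integrable (Px x) (u :: 'w \<Rightarrow> real)" "B \<in> sets M"
  shows "integrable (Px x) (\<lambda>w. indicator B w * u w)"
  using integrable_mult_indicator[of B "Px x" u] assms by (simp add: Px)

lemma markov_stop:
  assumes \<rho>: "stop T \<rho>" and B: "prior \<rho> B" and s: "0 \<le> s" and \<phi>: "bounded_by \<phi> c"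
  shows "E x (\<lambda>w. indicator B w * \<phi> (X (\<rho> w + s) w)) = E x (\<lambda>w. indicator B w * P s \<phi> (X (\<rho> w) w))"
proof -
  let ?s = "\<lambda>w. ennreal (\<rho> w)"
  have le: "{w \<in> space M. ?s w \<le> ennreal t} = {w \<in> space M. \<rho> w \<le> t}" if "0 \<le> t" for t
    using that by auto
  have "stopping_time_of M F ?s"
    unfolding stopping_time_of_def using le stopD(3)[OF \<rho>] by auto
  moreover have "B \<in> prior_sets M F ?s"
    unfolding prior_sets_def using le B by (auto simp: prior_def)
  moreover have "bounded (range \<phi>)"
    using bounded_byD(2)[OF \<phi>] by (auto simp: bounded_iff)
  ultimately have "E x (\<lambda>w. indicator (B \<inter> {w. ?s w < \<infinity>}) w * \<phi> (X (enn2real (?s w) + s) w))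
      = E x (\<lambda>w. indicator (B \<inter> {w. ?s w < \<infinity>}) w * P s \<phi> (X (enn2real (?s w)) w))"
    using strong[rule_format, of ?s B s \<phi> x] s bounded_byD(1)[OF \<phi>] by blast
  moreover have "B \<inter> {w. ?s w < \<infinity>} = B" by auto
  moreover have "E x (\<lambda>w. indicator B w * \<phi> (X (enn2real (?s w) + s) w)) = E x (\<lambda>w. indicator B w * \<phi> (X (\<rho> w + s) w))"
     "E x (\<lambda>w. indicator B w * P s \<phi> (X (enn2real (?s w)) w)) = E x (\<lambda>w. indicator B w * P s \<phi> (X (\<rho> w) w))"
    by (rule Bochner_Integration.integral_cong; use stopD(1)[OF \<rho>] in \<open>simp add: Px\<close>)+
  ultimately show ?thesis by simp
qed

text \<open>The strong Markov property at each fixed delay s, integrated over s by Fubini. The event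
  may vary with s because a deterministic horizon after a random time leaves a random remaining
  duration.\<close>

lemma markov_integral:
  assumes \<rho>: "stop T \<rho>" and \<phi>: "bounded_by \<phi> c"
    and G: "\<And>s. 0 \<le> s \<Longrightarrow> s \<le> S \<Longrightarrow> prior \<rho> (G s)"
    and meas: "(\<lambda>p. indicator (G (fst p)) (snd p) :: real) \<in> borel_measurable (lborel \<Otimes>\<^sub>M M)"
  shows "E x (\<lambda>w. (LINT s:{0..S}|lborel. indicator (G s) w * \<phi> (X (\<rho> w + s) w)))
       = E x (\<lambda>w. (LINT s:{0..S}|lborel. indicator (G s) w * P s \<phi> (X (\<rho> w) w)))"
proof -
  let ?L = "\<lambda>p. indicator (G (fst p)) (snd p) * \<phi> (X (\<rho> (snd p) + max 0 (fst p)) (snd p))"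
  let ?R = "\<lambda>p. indicator (G (fst p)) (snd p) * P (max 0 (fst p)) \<phi> (X (\<rho> (snd p)) (snd p))"
  have c: "0 \<le> c" using bounded_byD(5)[OF \<phi>] .
  have r: "(\<lambda>p. \<rho> (snd p)) \<in> borel_measurable (lborel \<Otimes>\<^sub>M M)"
    "(\<lambda>p. \<rho> (snd p) + max 0 (fst p)) \<in> borel_measurable (lborel \<Otimes>\<^sub>M M)"
    using stopD(4)[OF \<rho>] by measurable
  have mL: "?L \<in> borel_measurable (lborel \<Otimes>\<^sub>M Px x)"
    unfolding pair_Px_measurable
    by (intro borel_measurable_times meas measurable_compose[OF X_comp_measurable bounded_byD(1)[OF \<phi>]])
       (use r stopD(1)[OF \<rho>] in \<open>auto simp: space_pair_measure\<close>)
  have mR: "?R \<in> borel_measurable (lborel \<Otimes>\<^sub>M Px x)"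
    unfolding pair_Px_measurable
    by (intro borel_measurable_times meas P_measurable[OF \<phi>] X_comp_measurable)
       (use r stopD(1)[OF \<rho>] in \<open>auto simp: space_pair_measure\<close>)
  have bL: "\<bar>?L (s, w)\<bar> \<le> c" for s w
    using bounded_byD(2)[OF \<phi>] c by (auto simp: indicator_def)
  have bR: "\<bar>?R (s, w)\<bar> \<le> c" for s w
    using bounded_byD(2)[OF P_bounded_by[OF \<phi>, of "max 0 s"]] c by (auto simp: indicator_def)
  have "E x (\<lambda>w. (LINT s:{0..S}|lborel. indicator (G s) w * \<phi> (X (\<rho> w + s) w))) =
     E x (\<lambda>w. (LINT s:{0..S}|lborel. ?L (s, w)))"
    by (intro Bochner_Integration.integral_cong set_lebesgue_integral_cong) auto
  also have "\<dots> = (LINT s:{0..S}|lborel. E x (\<lambda>w. ?L (s, w)))"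
    by (rule fubini_bounded(1)[OF Px(1) mL bL])
  also have "\<dots> = (LINT s:{0..S}|lborel. E x (\<lambda>w. ?R (s, w)))"
    by (rule set_lebesgue_integral_cong) (use markov_stop[OF \<rho> G _ \<phi>] in auto)
  also have "\<dots> = E x (\<lambda>w. (LINT s:{0..S}|lborel. ?R (s, w)))"
    by (rule fubini_bounded(1)[OF Px(1) mR bR, symmetric])
  also have "\<dots> = E x (\<lambda>w. (LINT s:{0..S}|lborel. indicator (G s) w * P s \<phi> (X (\<rho> w) w)))"
    by (intro Bochner_Integration.integral_cong set_lebesgue_integral_cong) auto
  finally show ?thesis .
qed

lemma markov_cum_fixed:
  assumes \<rho>: "stop T \<rho>" and B: "prior \<rho> B" and \<phi>: "bounded_by \<phi> c" and S: "0 \<le> S"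
  shows "E x (\<lambda>w. indicator B w * (cum \<phi> (\<rho> w + S) w - cum \<phi> (\<rho> w) w))
       = E x (\<lambda>w. indicator B w * pot \<phi> S (X (\<rho> w) w))"
proof -
  have "B \<in> sets M" using B by (simp add: prior_def)
  then have "(\<lambda>p. indicator B (snd p) :: real) \<in> borel_measurable (lborel \<Otimes>\<^sub>M M)" by simp
  from markov_integral[OF \<rho> \<phi> _ this, of S x] B
  have "E x (\<lambda>w. (LINT s:{0..S}|lborel. indicator B w * \<phi> (X (\<rho> w + s) w)))
       = E x (\<lambda>w. (LINT s:{0..S}|lborel. indicator B w * P s \<phi> (X (\<rho> w) w)))" by simp
  moreover have "E x (\<lambda>w. (LINT s:{0..S}|lborel. indicator B w * \<phi> (X (\<rho> w + s) w)))
      = E x (\<lambda>w. indicator B w * (cum \<phi> (\<rho> w + S) w - cum \<phi> (\<rho> w) w))"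
    by (rule Bochner_Integration.integral_cong)
       (use cum_shift[OF \<phi> _ stopD(1)[OF \<rho>] S] in \<open>simp_all add: Px\<close>)
  moreover have "E x (\<lambda>w. (LINT s:{0..S}|lborel. indicator B w * P s \<phi> (X (\<rho> w) w)))
      = E x (\<lambda>w. indicator B w * pot \<phi> S (X (\<rho> w) w))"
    by (simp add: pot_def)
  ultimately show ?thesis by simp
qed

text \<open>The remaining duration T - \<open>\<rho>\<close> is random, but for each delay s the
  condition s <= T - \<open>\<rho>\<close> is an event known at time \<open>\<rho>\<close>. It is
  moved into the event, after which the delay runs over a fixed interval.\<close>

lemma markov_cum_until:
  assumes \<rho>: "stop T \<rho>" and B: "prior \<rho> B" and \<phi>: "bounded_by \<phi> c"
  shows "E x (\<lambda>w. indicator B w * (cum \<phi> T w - cum \<phi> (\<rho> w) w))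
       = E x (\<lambda>w. indicator B w * pot \<phi> (T - \<rho> w) (X (\<rho> w) w))"
proof -
  let ?G = "\<lambda>s. B \<inter> {w \<in> space M. \<rho> w \<le> T - s}"
  have Bm: "B \<in> sets M" using B by (simp add: prior_def)
  have "(\<lambda>p. indicator B (snd p) * of_bool (\<rho> (snd p) \<le> T - fst p) :: real) \<in> borel_measurable (lborel \<Otimes>\<^sub>M M)"
    using Bm stopD(4)[OF \<rho>] by measurable
  also have "?this \<longleftrightarrow> (\<lambda>p. indicator (?G (fst p)) (snd p) :: real) \<in> borel_measurable (lborel \<Otimes>\<^sub>M M)"
    by (rule measurable_cong) (auto simp: indicator_def space_pair_measure)
  finally have "E x (\<lambda>w. (LINT s:{0..T}|lborel. indicator (?G s) w * \<phi> (X (\<rho> w + s) w)))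
       = E x (\<lambda>w. (LINT s:{0..T}|lborel. indicator (?G s) w * P s \<phi> (X (\<rho> w) w)))"
    by (intro markov_integral[OF \<rho> \<phi> prior_le[OF \<rho> B]])
  moreover have *: "(LINT s:{0..T}|lborel. indicator (?G s) w * u s) = indicator B w * (LINT s:{0..T - \<rho> w}|lborel. u s)"
    if w: "w \<in> space M" for w and u :: "real \<Rightarrow> real"
  proof -
    have "(LINT s:{0..T}|lborel. indicator (?G s) w * u s) = (LINT s|lborel. indicator B w * (indicator {0..T - \<rho> w} s * u s))"
      unfolding set_lebesgue_integral_def
      by (rule Bochner_Integration.integral_cong) (use stopD(1)[OF \<rho> w] w in \<open>auto simp: indicator_def\<close>)
    then show ?thesis by (simp add: set_lebesgue_integral_def)
  qed
  moreover have "E x (\<lambda>w. (LINT s:{0..T}|lborel. indicator (?G s) w * \<phi> (X (\<rho> w + s) w)))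
      = E x (\<lambda>w. indicator B w * (cum \<phi> T w - cum \<phi> (\<rho> w) w))"
  proof (rule Bochner_Integration.integral_cong)
    fix w assume "w \<in> space (Px x)"
    then have w: "w \<in> space M" by (simp add: Px)
    show "(LINT s:{0..T}|lborel. indicator (?G s) w * \<phi> (X (\<rho> w + s) w)) = indicator B w * (cum \<phi> T w - cum \<phi> (\<rho> w) w)"
      unfolding *[OF w] using cum_shift[OF \<phi> w stopD(1)[OF \<rho> w], of "T - \<rho> w"] stopD(2)[OF \<rho> w] by simp
  qed simp
  moreover have "E x (\<lambda>w. (LINT s:{0..T}|lborel. indicator (?G s) w * P s \<phi> (X (\<rho> w) w)))
      = E x (\<lambda>w. indicator B w * pot \<phi> (T - \<rho> w) (X (\<rho> w) w))"
    by (rule Bochner_Integration.integral_cong) (use * in \<open>simp_all add: Px pot_def\<close>)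
  ultimately show ?thesis by simp
qed

lemma integral_indicator_space: "E x (\<lambda>w. indicator (space M) w * u w) = E x (\<lambda>w. (u w :: real))"
  by (rule Bochner_Integration.integral_cong) (auto simp: Px)

lemma P_semigroup:
  assumes \<phi>: "bounded_by \<phi> c" and s: "0 \<le> s" and t: "0 \<le> t"
  shows "P t (P s \<phi>) x = P (t + s) \<phi> x"
proof -
  have "E x (\<lambda>w. indicator (space M) w * \<phi> (X (t + s) w)) = E x (\<lambda>w. indicator (space M) w * P s \<phi> (X t w))"
    by (rule markov_stop[OF stop_const[OF t order_refl] prior_space[OF stop_const[OF t order_refl]] s \<phi>])
  then show ?thesis unfolding integral_indicator_space by (simp add: semigroup_def[of _ _ t] semigroup_def[of _ _ "t + s"])
qed

lemma pot_diff:
  assumes \<phi>: "bounded_by \<phi> c" and S: "0 \<le> S" and t: "0 \<le> t"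
  shows "pot \<phi> (t + S) x - pot \<phi> t x = P t (pot \<phi> S) x"
proof -
  have "E x (\<lambda>w. indicator (space M) w * (cum \<phi> (t + S) w - cum \<phi> t w)) = E x (\<lambda>w. indicator (space M) w * pot \<phi> S (X t w))"
    by (rule markov_cum_fixed[OF stop_const[OF t order_refl] prior_space[OF stop_const[OF t order_refl]] \<phi> S])
  then have "E x (\<lambda>w. cum \<phi> (t + S) w - cum \<phi> t w) = P t (pot \<phi> S) x"
    unfolding integral_indicator_space semigroup_def .
  moreover have "integrable (Px x) (cum \<phi> u)" if "0 \<le> u" for u
    using cum_stop_integrable[OF stop_const[OF that order_refl] \<phi>] .
  ultimately show ?thesis using S t by (simp add: X_fubini[OF \<phi>, symmetric])
qed

end

section \<open>Feller processes\<close>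

text \<open>The approximating function may depend on both the point and the error and has to be
  close only near that point. This is the form in which the later estimates, uniform only locally,
  become available.\<close>

lemma isCont_approx:
  fixes u :: "'a::t2_space \<Rightarrow> real"
  assumes "\<And>e. 0 < e \<Longrightarrow> \<exists>v. isCont v x \<and> (\<forall>\<^sub>F y in nhds x. \<bar>u y - v y\<bar> \<le> e)"
  shows "isCont u x"
proof -
  have "\<forall>\<^sub>F y in nhds x. dist (u y) (u x) < e" if e: "0 < e" for e
  proof -
    obtain v where v: "isCont v x" and close: "\<forall>\<^sub>F y in nhds x. \<bar>u y - v y\<bar> \<le> e / 4"
      using assms[of "e / 4"] e by auto
    have "\<forall>\<^sub>F y in nhds x. dist (v y) (v x) < e / 4"
      using tendstoD[of v "v x" "nhds x" "e / 4"] v e tendsto_at_iff_tendsto_nhds[of v x]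
      by (simp add: isCont_def)
    with close show ?thesis
    proof eventually_elim
      case (elim y)
      have "\<bar>u x - v x\<bar> \<le> e / 4" using eventually_nhds_x_imp_x[OF close] .
      with elim show ?case using e unfolding dist_real_def by linarith
    qed
  qed
  then have "(u \<longlongrightarrow> u x) (nhds x)" by (rule tendstoI)
  then show ?thesis by (simp add: isCont_def tendsto_at_iff_tendsto_nhds)
qed

locale feller_process = strong_markov M F X Px
  for M :: "'w measure" and F :: "real \<Rightarrow> 'w measure"
    and X :: "real \<Rightarrow> 'w \<Rightarrow> 'e::{metric_space, second_countable_topology}"
    and Px :: "'e \<Rightarrow> 'w measure" +
  assumes proper: "compact (cball (x :: 'e) r)"
    and feller: "weak_feller Px X"
begin

section \<open>Calculus of functions vanishing at infinity\<close>

definition origin :: 'e where "origin = (SOME y. True)"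

lemma C0_bounded: assumes "\<phi> \<in> C0" obtains c where "bounded_by \<phi> c"
proof -
  have "bounded (range \<phi>)" "continuous_on UNIV \<phi>" using assms by (auto simp: C0_def)
  then show ?thesis using that
    by (auto simp: bounded_iff bounded_by_def intro: borel_measurable_continuous_onI)
qed

lemma C0_cont: "\<phi> \<in> C0 \<Longrightarrow> continuous_on UNIV \<phi>"
  by (simp add: C0_def)

text \<open>Vanishing off compact sets becomes vanishing at large distance from a fixed but
  arbitrary centre. The converse passage in \<open>C0I\<close> is where compactness of closed balls
  is used.\<close>

lemma C0_vanish:
  assumes "\<phi> \<in> C0" "0 < e" obtains r where "\<And>y::'e. r < dist origin y \<Longrightarrow> \<bar>\<phi> y\<bar> < e"
proof -
  obtain C where C: "compact C" "\<And>y. y \<notin> C \<Longrightarrow> \<bar>\<phi> y\<bar> < e"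
    using assms by (auto simp: C0_def)
  obtain r where "\<And>y. y \<in> C \<Longrightarrow> dist origin y \<le> r"
    using compact_imp_bounded[OF C(1)] bounded_any_center[of C origin] by auto
  then show ?thesis using that C(2) by (meson not_le)
qed

lemma C0I:
  assumes "continuous_on UNIV \<phi>" "\<And>y::'e. \<bar>\<phi> y\<bar> \<le> c"
    and "\<And>e. 0 < e \<Longrightarrow> \<exists>r. \<forall>y. r < dist origin y \<longrightarrow> \<bar>\<phi> y\<bar> < e"
  shows "\<phi> \<in> C0"
proof -
  have "\<exists>C. compact C \<and> (\<forall>x. x \<notin> C \<longrightarrow> \<bar>\<phi> x\<bar> < e)" if e: "0 < e" for e
  proof -
    obtain r where "\<forall>y. r < dist origin y \<longrightarrow> \<bar>\<phi> y\<bar> < e" using assms(3)[OF e] by blast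
    then show ?thesis using proper[of origin r] by (intro exI[of _ "cball origin r"]) (auto simp: not_le)
  qed
  moreover have "bounded (range \<phi>)" using assms(2) by (auto simp: bounded_iff)
  ultimately show ?thesis using assms(1) by (auto simp: C0_def)
qed

lemma C0_mult:
  assumes "\<phi> \<in> C0" "continuous_on UNIV g" "\<And>y::'e. \<bar>g y\<bar> \<le> c"
  shows "(\<lambda>y. g y * \<phi> y) \<in> C0"
proof -
  obtain d where d: "bounded_by \<phi> d" using C0_bounded[OF assms(1)] .
  have c: "0 \<le> c" using assms(3)[of undefined] by linarith
  have le: "\<bar>g y * \<phi> y\<bar> \<le> c * \<bar>\<phi> y\<bar>" for y
    unfolding abs_mult by (intro mult_right_mono assms(3)) simp
  show ?thesis
  proof (rule C0I)
    show "continuous_on UNIV (\<lambda>y. g y * \<phi> y)" using assms(2) C0_cont[OF assms(1)] by (rule continuous_on_mult)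
    show "\<bar>g y * \<phi> y\<bar> \<le> c * d" for y
      using le[of y] mult_left_mono[OF bounded_byD(2)[OF d, of y] c] by linarith
    fix e :: real assume e: "0 < e"
    obtain r where r: "\<And>y. r < dist origin y \<Longrightarrow> \<bar>\<phi> y\<bar> < e / (c + 1)"
      using C0_vanish[OF assms(1), of "e / (c + 1)"] e c by auto
    show "\<exists>r. \<forall>y. r < dist origin y \<longrightarrow> \<bar>g y * \<phi> y\<bar> < e"
    proof (intro exI allI impI)
      fix y assume "r < dist origin y"
      from r[OF this] have "\<bar>\<phi> y\<bar> * (c + 1) < e" using c by (simp add: field_simps)
      with le[of y] show "\<bar>g y * \<phi> y\<bar> < e" by (simp add: algebra_simps)
    qed
  qed
qed

lemma C0_cmult: "\<phi> \<in> C0 \<Longrightarrow> (\<lambda>y::'e. a * \<phi> y) \<in> C0"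
  by (rule C0_mult[of _ "\<lambda>_. a" "\<bar>a\<bar>"]) auto

lemma C0_add:
  assumes "\<phi> \<in> C0" "\<psi> \<in> C0" shows "(\<lambda>y::'e. \<phi> y + \<psi> y) \<in> C0"
proof -
  obtain c d where b: "bounded_by \<phi> c" "bounded_by \<psi> d" using C0_bounded assms by metis
  show ?thesis
  proof (rule C0I)
    show "continuous_on UNIV (\<lambda>y. \<phi> y + \<psi> y)" using assms[THEN C0_cont] by (rule continuous_on_add)
    show "\<bar>\<phi> y + \<psi> y\<bar> \<le> c + d" for y
      using bounded_byD(2)[OF b(1), of y] bounded_byD(2)[OF b(2), of y] by linarith
    fix e :: real assume e: "0 < e"
    obtain r where r: "\<And>y. r < dist origin y \<Longrightarrow> \<bar>\<phi> y\<bar> < e / 2" using C0_vanish[OF assms(1), of "e / 2"] e by auto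
    obtain r' where r': "\<And>y. r' < dist origin y \<Longrightarrow> \<bar>\<psi> y\<bar> < e / 2" using C0_vanish[OF assms(2), of "e / 2"] e by auto
    show "\<exists>r. \<forall>y. r < dist origin y \<longrightarrow> \<bar>\<phi> y + \<psi> y\<bar> < e"
      by (intro exI[of _ "max r r'"] allI impI) (smt (verit) r r' max_less_iff_conj field_sum_of_halves)
  qed
qed

lemma C0_diff: "\<phi> \<in> C0 \<Longrightarrow> \<psi> \<in> C0 \<Longrightarrow> (\<lambda>y::'e. \<phi> y - \<psi> y) \<in> C0"
  using C0_add[OF _ C0_cmult[of \<psi> "-1"], of \<phi>] by simp

lemma C0_zero: "(\<lambda>y::'e. 0) \<in> C0"
  by (rule C0I[where c = 0]) auto

lemma C0_sum: "(\<And>k. \<psi> k \<in> C0) \<Longrightarrow> (\<lambda>y::'e. \<Sum>k<(n::nat). \<psi> k y) \<in> C0"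
  by (induction n) (auto intro: C0_zero C0_add)

lemma C0_uniform_limit:
  assumes "\<And>e. 0 < e \<Longrightarrow> \<exists>\<psi>\<in>C0. \<forall>y::'e. \<bar>u y - \<psi> y\<bar> \<le> e"
  shows "u \<in> C0"
proof -
  obtain \<psi> where \<psi>: "\<psi> \<in> C0" "\<And>y. \<bar>u y - \<psi> y\<bar> \<le> 1" using assms[of 1] by auto
  obtain c where c: "bounded_by \<psi> c" using C0_bounded[OF \<psi>(1)] .
  show ?thesis
  proof (rule C0I)
    have "isCont u x" for x
    proof (rule isCont_approx)
      fix e :: real assume "0 < e"
      then obtain v where "v \<in> C0" "\<forall>y. \<bar>u y - v y\<bar> \<le> e" using assms by blast
      then show "\<exists>v. isCont v x \<and> (\<forall>\<^sub>F y in nhds x. \<bar>u y - v y\<bar> \<le> e)"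
        using C0_cont[of v] by (auto simp: continuous_on_eq_continuous_at)
    qed
    then show "continuous_on UNIV u" by (simp add: continuous_on_eq_continuous_at)
    show "\<bar>u y\<bar> \<le> c + 1" for y using \<psi>(2)[of y] bounded_byD(2)[OF c, of y] by linarith
    fix e :: real assume e: "0 < e"
    then obtain v where v: "v \<in> C0" "\<And>y. \<bar>u y - v y\<bar> \<le> e / 2" using assms[of "e / 2"] by auto
    obtain r where r: "\<And>y. r < dist origin y \<Longrightarrow> \<bar>v y\<bar> < e / 2" using C0_vanish[OF v(1), of "e / 2"] e by auto
    show "\<exists>r. \<forall>y. r < dist origin y \<longrightarrow> \<bar>u y\<bar> < e"
      by (intro exI[of _ r] allI impI) (smt (verit) r v(2) field_sum_of_halves)
  qed
qed

text \<open>Outside a large ball the function is smaller in modulus than at some point where it is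
  not zero, so a maximum over that compact ball is global. This supplies the maximiser that
  \<open>simons\<close> asks for.\<close>

lemma C0_attains:
  assumes "u \<in> C0" shows "\<exists>y0. \<forall>y::'e. \<bar>u y\<bar> \<le> \<bar>u y0\<bar>"
proof (cases "\<forall>y. u y = 0")
  case False
  then obtain z where z: "u z \<noteq> 0" by blast
  obtain r where r: "\<And>y. r < dist origin y \<Longrightarrow> \<bar>u y\<bar> < \<bar>u z\<bar>" using C0_vanish[OF assms, of "\<bar>u z\<bar>"] z by auto
  have zr: "z \<in> cball origin r" using r[of z] by (auto simp: not_less[symmetric])
  have "continuous_on (cball origin r) (\<lambda>y. \<bar>u y\<bar>)"
    using continuous_on_subset[OF C0_cont[OF assms]] by (intro continuous_on_rabs) auto
  then obtain y0 where "\<forall>y\<in>cball origin r. \<bar>u y\<bar> \<le> \<bar>u y0\<bar>"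
    using continuous_attains_sup[OF proper, of origin r "\<lambda>y. \<bar>u y\<bar>"] zr by blast
  then have "\<bar>u y\<bar> \<le> \<bar>u y0\<bar>" for y
    using r[of y] zr by (cases "r < dist origin y") (auto simp: not_less dest: bspec[of _ _ z])
  then show ?thesis by blast
qed auto

section \<open>Cutoff functions and the Feller property on bounded continuous functions\<close>

definition cutoff :: "nat \<Rightarrow> 'e \<Rightarrow> real" where
  "cutoff n y = max 0 (min 1 (real n + 1 - dist origin y))"

lemma cutoff_range: "0 \<le> cutoff n y" "cutoff n y \<le> 1"
  by (auto simp: cutoff_def)

lemma cutoff_C0: "cutoff n \<in> C0"
proof (rule C0I)
  show "continuous_on UNIV (cutoff n)" unfolding cutoff_def by (intro continuous_intros)
  show "\<bar>cutoff n y\<bar> \<le> 1" for y using cutoff_range[of n y] by simp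
  show "\<exists>r. \<forall>y. r < dist origin y \<longrightarrow> \<bar>cutoff n y\<bar> < e" if "0 < e" for e
    by (rule exI[of _ "real n + 1"]) (use that in \<open>auto simp: cutoff_def\<close>)
qed

lemma cutoff_bounded_by: "bounded_by (cutoff n) 1"
  by (rule bounded_byI) (use cutoff_C0[THEN C0_cont, THEN borel_measurable_continuous_onI] cutoff_range in auto)

lemma cutoff_tendsto: "(\<lambda>n. cutoff n y) \<longlonglongrightarrow> 1"
proof (rule tendsto_eventually)
  obtain N where "dist origin y \<le> real N" using real_arch_simple by blast
  then show "\<forall>\<^sub>F n in sequentially. cutoff n y = 1"
    by (auto simp: cutoff_def eventually_sequentially intro!: exI[of _ N])
qed

lemma P_cutoff_tendsto: assumes t: "0 \<le> t" shows "(\<lambda>n. P t (cutoff n) x) \<longlonglongrightarrow> 1"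
proof -
  interpret prob_space "Px x" by (rule Px)
  have "(\<lambda>n. \<integral>w. cutoff n (X t w) \<partial>Px x) \<longlonglongrightarrow> E x (\<lambda>w. 1)"
    by (rule integral_dominated_convergence[where w = "\<lambda>_. 1"])
       (use measurable_compose[OF X_M[OF t] bounded_byD(1)[OF cutoff_bounded_by]] cutoff_tendsto cutoff_range in auto)
  then show ?thesis by (simp add: semigroup_def prob_space)
qed

lemma P_abs_le:
  assumes "bounded_by u c" "bounded_by v d" "\<And>y. \<bar>u y\<bar> \<le> v y" "0 \<le> t"
  shows "\<bar>P t u x\<bar> \<le> P t v x"
proof -
  have m: "bounded_by (\<lambda>y. -1 * u y) c" using assms(1) by (auto simp: bounded_by_def)
  have "P t u x \<le> P t v x"
    by (rule P_mono[OF assms(1,2,4)]) (use assms(3) in \<open>auto simp: abs_le_iff\<close>)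
  moreover have "P t (\<lambda>y. -1 * u y) x \<le> P t v x"
    by (rule P_mono[OF m assms(2,4)]) (use assms(3) in \<open>auto simp: abs_le_iff\<close>)
  ultimately show ?thesis unfolding P_cmult by simp
qed

lemma bounded_by_mult:
  "bounded_by u c \<Longrightarrow> bounded_by v d \<Longrightarrow> bounded_by (\<lambda>y. u y * v y) (c * d)"
  by (auto simp: bounded_by_def abs_mult intro!: mult_mono intro: order_trans[OF abs_ge_zero])

lemma bounded_by_one_minus: "bounded_by v 1 \<Longrightarrow> (\<And>y. 0 \<le> v y) \<Longrightarrow> bounded_by (\<lambda>y. 1 - v y) 1"
  by (auto simp: bounded_by_def abs_le_iff)

text \<open>The error of replacing \<open>\<phi>\<close> by its product with a cutoff is at most c
  times 1 minus \<open>P t (cutoff n)\<close>. That bound is itself continuous, so being small at x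
  it is small near x.\<close>

lemma P_cont:
  assumes \<phi>: "bounded_by \<phi> c" "continuous_on UNIV \<phi>" and t: "0 \<le> t"
  shows "continuous_on UNIV (P t \<phi>)"
proof -
  have c: "0 \<le> c" using bounded_byD(5)[OF \<phi>(1)] .
  have "isCont (P t \<phi>) x" for x
  proof (rule isCont_approx)
    fix e :: real assume e: "0 < e"
    have "(\<lambda>n. c * (1 - P t (cutoff n) x)) \<longlonglongrightarrow> c * (1 - 1)"
      by (intro tendsto_intros P_cutoff_tendsto t)
    then have "\<forall>\<^sub>F n in sequentially. c * (1 - P t (cutoff n) x) < e"
      using e by (intro order_tendstoD(2)) auto
    then obtain n where n: "c * (1 - P t (cutoff n) x) < e"
      using eventually_happens'[OF sequentially_bot] by blast
    let ?v = "P t (\<lambda>y. \<phi> y * cutoff n y)"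
    have "P t (cutoff n) \<in> C0" "?v \<in> C0"
      using feller t C0_mult[OF cutoff_C0 \<phi>(2) bounded_byD(2)[OF \<phi>(1)]] cutoff_C0
      unfolding weak_feller_def by blast+
    then have cC: "isCont (P t (cutoff n)) x" and vC: "isCont ?v x"
      by (auto dest!: C0_cont simp: continuous_on_eq_continuous_at)
    have "isCont (\<lambda>y. c * (1 - P t (cutoff n) y)) x" by (intro continuous_intros cC)
    then have "((\<lambda>y. c * (1 - P t (cutoff n) y)) \<longlongrightarrow> c * (1 - P t (cutoff n) x)) (nhds x)"
      using tendsto_at_iff_tendsto_nhds[of "\<lambda>y. c * (1 - P t (cutoff n) y)" x] by (simp add: isCont_def)
    from order_tendstoD(2)[OF this n]
    have ev: "\<forall>\<^sub>F y in nhds x. \<bar>P t \<phi> y - ?v y\<bar> \<le> e"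
    proof eventually_elim
      case (elim y)
      note b1 = bounded_by_one_minus[OF cutoff_bounded_by cutoff_range(1), of n]
      have "P t \<phi> y - ?v y = P t (\<lambda>y. \<phi> y - \<phi> y * cutoff n y) y"
        by (rule P_diff[symmetric]) (use \<phi>(1) bounded_by_mult[OF \<phi>(1) cutoff_bounded_by] t in auto)
      also have "(\<lambda>y. \<phi> y - \<phi> y * cutoff n y) = (\<lambda>y. \<phi> y * (1 - cutoff n y))" by (simp add: algebra_simps)
      also have "\<bar>P t \<dots> y\<bar> \<le> P t (\<lambda>y. c * (1 - cutoff n y)) y"
      proof (rule P_abs_le[OF bounded_by_mult[OF \<phi>(1) b1] bounded_by_mult[of "\<lambda>_. c" c, OF _ b1] _ t])
        show "bounded_by (\<lambda>_. c) c" using c by (simp add: bounded_by_def)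
        show "\<bar>\<phi> y * (1 - cutoff n y)\<bar> \<le> c * (1 - cutoff n y)" for y
          using cutoff_range[of n y] bounded_byD(2)[OF \<phi>(1), of y] by (simp add: abs_mult mult_right_mono)
      qed
      also have "\<dots> = c * (1 - P t (cutoff n) y)"
        unfolding P_cmult using P_diff[OF _ cutoff_bounded_by t, of "\<lambda>_. 1" 1] by (simp add: bounded_by_def P_const)
      finally show ?case using elim by simp
    qed
    show "\<exists>v. isCont v x \<and> (\<forall>\<^sub>F y in nhds x. \<bar>P t \<phi> y - v y\<bar> \<le> e)"
      using vC ev by blast
  qed
  then show ?thesis by (simp add: continuous_on_eq_continuous_at)
qed

text \<open>Dominated convergence in time. Function and point both vary with n, and the limit is an
  arbitrary function of time, so that one statement serves continuity, decay along sequences going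
  to infinity, and exhaustion by cutoffs.\<close>

lemma pot_tendsto:
  assumes b: "\<And>n. bounded_by (\<phi> n) c" and S: "0 \<le> S"
    and lim: "\<And>s. 0 \<le> s \<Longrightarrow> s \<le> S \<Longrightarrow> (\<lambda>n. P s (\<phi> n) (y n)) \<longlonglongrightarrow> l s"
  shows "(\<lambda>n. pot (\<phi> n) S (y n)) \<longlonglongrightarrow> (LINT s:{0..S}|lborel. l s)"
proof -
  have m: "(\<lambda>s. indicator {0..S} s * P s (\<phi> n) (y n)) \<in> borel_measurable lborel" for n
  proof -
    have "(\<lambda>s. indicator {0..S} s * P (max 0 s) (\<phi> n) (y n)) \<in> borel_measurable lborel"
      by (intro borel_measurable_times P_measurable[OF b]) auto
    also have "(\<lambda>s. indicator {0..S} s * P (max 0 s) (\<phi> n) (y n)) = (\<lambda>s. indicator {0..S} s * P s (\<phi> n) (y n))"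
      by (auto simp: indicator_def)
    finally show ?thesis .
  qed
  have lim': "(\<lambda>n. indicator {0..S} s * P s (\<phi> n) (y n)) \<longlonglongrightarrow> indicator {0..S} s * l s" for s
    using lim[of s] by (auto simp: indicator_def)
  have "(\<lambda>n. \<integral>s. indicator {0..S} s * P s (\<phi> n) (y n) \<partial>lborel) \<longlonglongrightarrow> (\<integral>s. indicator {0..S} s * l s \<partial>lborel)"
  proof (rule integral_dominated_convergence[where w = "\<lambda>s. indicator {0..S} s * c"])
    show "(\<lambda>s. indicator {0..S} s * l s) \<in> borel_measurable lborel"
      using borel_measurable_LIMSEQ_real[OF lim' m] .
    show "integrable lborel (\<lambda>s. indicator {0..S} s * c)"
      using S by (auto simp: emeasure_lborel_Icc_eq intro!: integrable_mult_left integrable_real_indicator)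
    show "AE s in lborel. norm (indicator {0..S} s * P s (\<phi> n) (y n)) \<le> indicator {0..S} s * c" for n
      using bounded_byD(2)[OF P_bounded_by[OF b]] by (auto simp: indicator_def)
  qed (use m lim' in auto)
  then show ?thesis by (simp add: pot_def set_lebesgue_integral_def)
qed

lemma pot_cont:
  assumes \<phi>: "bounded_by \<phi> c" "continuous_on UNIV \<phi>" and S: "0 \<le> S"
  shows "continuous_on UNIV (pot \<phi> S)"
proof -
  have "(\<lambda>n. pot \<phi> S (y n)) \<longlonglongrightarrow> pot \<phi> S x" if y: "y \<longlonglongrightarrow> x" for y x
    unfolding pot_def[of _ _ x]
  proof (rule pot_tendsto[OF \<phi>(1) S])
    fix s :: real assume "0 \<le> s"
    from P_cont[OF \<phi> this] show "(\<lambda>n. P s \<phi> (y n)) \<longlonglongrightarrow> P s \<phi> x"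
      using y by (intro isCont_tendsto_compose[OF _ y]) (simp add: continuous_on_eq_continuous_at)
  qed
  then show ?thesis unfolding continuous_on_sequentially by (auto simp: comp_def)
qed

lemma pot_C0:
  assumes \<phi>: "\<phi> \<in> C0" and S: "0 \<le> S" shows "pot \<phi> S \<in> C0"
proof -
  obtain c where c: "bounded_by \<phi> c" using C0_bounded[OF \<phi>] .
  show ?thesis
  proof (rule C0I)
    show "continuous_on UNIV (pot \<phi> S)" by (rule pot_cont[OF c C0_cont[OF \<phi>] S])
    show "\<bar>pot \<phi> S y\<bar> \<le> c * S" for y using bounded_byD(2)[OF pot_bounded_by[OF c S]] .
    fix e :: real assume e: "0 < e"
    show "\<exists>r. \<forall>y. r < dist origin y \<longrightarrow> \<bar>pot \<phi> S y\<bar> < e"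
    proof (rule ccontr)
      assume "\<not> ?thesis"
      then have "\<forall>n::nat. \<exists>y. real n < dist origin y \<and> e \<le> \<bar>pot \<phi> S y\<bar>" by (meson not_le)
      then obtain y where y: "\<And>n. real n < dist origin (y n)" "\<And>n. e \<le> \<bar>pot \<phi> S (y n)\<bar>" by metis
      have "(\<lambda>n. pot \<phi> S (y n)) \<longlonglongrightarrow> (LINT s:{0..S}|lborel. 0)"
      proof (rule pot_tendsto[OF c S])
        fix s :: real assume s: "0 \<le> s"
        have P0: "P s \<phi> \<in> C0" using feller \<phi> s by (simp add: weak_feller_def)
        show "(\<lambda>n. P s \<phi> (y n)) \<longlonglongrightarrow> 0"
        proof (rule LIMSEQ_I)
          fix d :: real assume "0 < d"
          then obtain r where r: "\<And>z. r < dist origin z \<Longrightarrow> \<bar>P s \<phi> z\<bar> < d" using C0_vanish[OF P0] by blast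
          obtain N where N: "r \<le> real N" using real_arch_simple by blast
          have "\<bar>P s \<phi> (y n)\<bar> < d" if "N \<le> n" for n
            using r[of "y n"] y(1)[of n] N that by (meson of_nat_mono order_le_less_trans order_trans)
          then show "\<exists>N. \<forall>n\<ge>N. norm (P s \<phi> (y n) - 0) < d" by auto
        qed
      qed
      then have "(\<lambda>n. \<bar>pot \<phi> S (y n)\<bar>) \<longlonglongrightarrow> 0"
        by (intro tendsto_rabs_zero) (simp add: set_lebesgue_integral_def)
      from LIMSEQ_le_const[OF this, of e] y(2) e show False by auto
    qed
  qed
qed

end

section \<open>Time regularity at stopping times\<close>

context strong_markov begin

lemma pot_average_tendsto:
  assumes \<phi>: "bounded_by \<phi> c" "continuous_on UNIV \<phi>"
  shows "(\<lambda>n. real (Suc n) * pot \<phi> (1 / real (Suc n)) x) \<longlonglongrightarrow> \<phi> x"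
proof -
  have c: "0 \<le> c" using bounded_byD(5)[OF \<phi>(1)] .
  have lim: "(\<lambda>n. real (Suc n) * cum \<phi> (1 / real (Suc n)) w) \<longlonglongrightarrow> \<phi> (X 0 w)" if w: "w \<in> space M" for w
  proof (rule LIMSEQ_I)
    fix e :: real assume e: "0 < e"
    have "((\<lambda>s. \<phi> (X s w)) \<longlongrightarrow> \<phi> (X 0 w)) (at_right 0)"
      by (rule isCont_tendsto_compose[OF _ X_right[OF w]])
         (use \<phi>(2) in \<open>auto simp: continuous_on_eq_continuous_at\<close>)
    from tendstoD[OF this, of "e / 2"] e obtain b where b: "0 < b"
      "\<And>s. 0 < s \<Longrightarrow> s < b \<Longrightarrow> dist (\<phi> (X s w)) (\<phi> (X 0 w)) < e / 2"
      by (auto simp: eventually_at_right_field)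
    obtain N where N: "1 / real (Suc N) < b" using nat_approx_posE[OF b(1)] .
    show "\<exists>N. \<forall>n\<ge>N. norm (real (Suc n) * cum \<phi> (1 / real (Suc n)) w - \<phi> (X 0 w)) < e"
    proof (intro exI allI impI)
      fix n assume n: "N \<le> n"
      let ?t = "1 / real (Suc n)"
      have t: "?t < b" using N n by (intro le_less_trans[OF _ N] divide_left_mono) auto
      have near: "\<bar>\<phi> (X s w) - \<phi> (X 0 w)\<bar> \<le> e / 2" if "0 \<le> s" "s \<le> ?t" for s
      proof (cases "s = 0")
        case False
        with b(2)[of s] that t show ?thesis by (simp add: dist_real_def)
      qed (use e in simp)
      have i: "set_integrable lborel {0..?t} (\<lambda>s. \<phi> (X s w))" by (rule path_integrable[OF \<phi>(1) w]) simp
      have i2: "set_integrable lborel {0..?t} (\<lambda>s. \<phi> (X 0 w))"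
        by (rule set_integral_bounded[of _ _ _ "\<bar>\<phi> (X 0 w)\<bar>"]) auto
      have "\<bar>LINT s:{0..?t}|lborel. \<phi> (X s w) - \<phi> (X 0 w)\<bar> \<le> e / 2 * (?t - 0)"
        by (rule set_integral_abs_le[OF set_integral_diff(1)[OF i i2] near]) auto
      also have "(LINT s:{0..?t}|lborel. \<phi> (X s w) - \<phi> (X 0 w)) = cum \<phi> ?t w - ?t * \<phi> (X 0 w)"
        unfolding set_integral_diff(2)[OF i i2] cum_def by (simp add: set_lebesgue_integral_def)
      finally have "real (Suc n) * \<bar>cum \<phi> ?t w - ?t * \<phi> (X 0 w)\<bar> \<le> real (Suc n) * (e / 2 * ?t)"
        by (intro mult_left_mono) auto
      also have "real (Suc n) * \<bar>cum \<phi> ?t w - ?t * \<phi> (X 0 w)\<bar> = \<bar>real (Suc n) * (cum \<phi> ?t w - ?t * \<phi> (X 0 w))\<bar>"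
        by (simp add: abs_mult)
      also have "real (Suc n) * (cum \<phi> ?t w - ?t * \<phi> (X 0 w)) = real (Suc n) * cum \<phi> ?t w - \<phi> (X 0 w)"
        by (simp add: field_simps)
      also have "real (Suc n) * (e / 2 * ?t) = e / 2" by (simp del: of_nat_Suc)
      finally show "norm (real (Suc n) * cum \<phi> ?t w - \<phi> (X 0 w)) < e" using e by (simp only: real_norm_def)
    qed
  qed
  have "(\<lambda>n. \<integral>w. real (Suc n) * cum \<phi> (1 / real (Suc n)) w \<partial>Px x) \<longlonglongrightarrow> E x (\<lambda>w. \<phi> (X 0 w))"
  proof (rule integral_dominated_convergence[where w = "\<lambda>_. c"])
    interpret prob_space "Px x" by (rule Px)
    show "integrable (Px x) (\<lambda>_. c)" by simp
    show "AE w in Px x. norm (real (Suc n) * cum \<phi> (1 / real (Suc n)) w) \<le> c" for n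
    proof (rule AE_I2)
      fix w assume "w \<in> space (Px x)"
      then have "\<bar>cum \<phi> (1 / real (Suc n)) w\<bar> \<le> c * (1 / real (Suc n))"
        by (intro cum_bound[OF \<phi>(1)]) (auto simp: Px)
      then have "real (Suc n) * \<bar>cum \<phi> (1 / real (Suc n)) w\<bar> \<le> real (Suc n) * (c * (1 / real (Suc n)))"
        by (intro mult_left_mono) auto
      also have "\<dots> = c" by simp
      finally show "norm (real (Suc n) * cum \<phi> (1 / real (Suc n)) w) \<le> c" by (simp add: abs_mult)
    qed
    show "AE w in Px x. (\<lambda>n. real (Suc n) * cum \<phi> (1 / real (Suc n)) w) \<longlonglongrightarrow> \<phi> (X 0 w)"
      by (rule AE_I2) (use lim in \<open>simp add: Px\<close>)
    show "(\<lambda>w. real (Suc n) * cum \<phi> (1 / real (Suc n)) w) \<in> borel_measurable (Px x)" for n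
      using cum_measurable[OF \<phi>(1), of "\<lambda>_. 1 / real (Suc n)"] by simp
    show "(\<lambda>w. \<phi> (X 0 w)) \<in> borel_measurable (Px x)"
      using measurable_compose[OF X_M[of 0] bounded_byD(1)[OF \<phi>(1)]] by simp
  qed
  moreover have "E x (\<lambda>w. \<phi> (X 0 w)) = \<phi> x" using P_0[OF \<phi>(1), of x] by (simp add: semigroup_def)
  ultimately show ?thesis by (simp add: X_fubini[OF \<phi>(1)])
qed

text \<open>The modulus is linear in the time difference because time averages can be compared pathwise.\<close>

definition time_lipschitz :: "('e \<Rightarrow> real) \<Rightarrow> real \<Rightarrow> bool" where
  "time_lipschitz \<psi> C \<longleftrightarrow> 0 \<le> C \<and> (\<forall>T \<rho> \<sigma> x \<eta>. stop T \<rho> \<longrightarrow> stop T \<sigma> \<longrightarrow>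
     (\<forall>w\<in>space M. \<rho> w \<le> \<sigma> w \<and> \<sigma> w \<le> \<rho> w + \<eta>) \<longrightarrow>
     \<bar>E x (\<lambda>w. \<psi> (X (\<rho> w) w)) - E x (\<lambda>w. \<psi> (X (\<sigma> w) w))\<bar> \<le> C * \<eta>)"

text \<open>By the strong Markov property the potential at \<open>X (\<rho> w) w\<close> has the
  mean of the integral over the window from \<open>\<rho>\<close> to \<open>\<rho>\<close> + d. The
  windows of \<open>\<rho>\<close> and \<open>\<sigma>\<close> differ by one piece of length at most
  \<open>\<eta>\<close> at each end, whence the factor 2.\<close>

lemma time_lipschitz_average:
  assumes \<phi>: "bounded_by \<phi> c" and d: "0 < d"
  shows "time_lipschitz (\<lambda>y. pot \<phi> d y / d) (2 * c / d)"
  unfolding time_lipschitz_def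
proof (intro conjI allI impI)
  show "0 \<le> 2 * c / d" using bounded_byD(5)[OF \<phi>] d by simp
  fix T \<rho> \<sigma> x \<eta>
  assume \<rho>: "stop T \<rho>" and \<sigma>: "stop T \<sigma>" and close: "\<forall>w\<in>space M. \<rho> w \<le> \<sigma> w \<and> \<sigma> w \<le> \<rho> w + \<eta>"
  let ?D = "\<lambda>\<rho> w. cum \<phi> (\<rho> w + d) w - cum \<phi> (\<rho> w) w"
  have E: "E x (\<lambda>w. pot \<phi> d (X (\<rho> w) w)) = E x (\<lambda>w. ?D \<rho> w)" if "stop T \<rho>" for \<rho>
    using markov_cum_fixed[OF that prior_space[OF that] \<phi>, of d x] d
    unfolding integral_indicator_space by simp
  have m: "?D \<rho> \<in> borel_measurable M" "w \<in> space M \<Longrightarrow> \<bar>?D \<rho> w\<bar> \<le> c * d" if "stop T \<rho>" for \<rho> w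
    using cum_measurable[OF \<phi>, of "\<lambda>w. \<rho> w + d"] cum_measurable[OF \<phi>, of \<rho>] stopD[OF that]
      cum_diff_bound[OF \<phi>, of w "\<rho> w" "\<rho> w + d"] d by auto
  have i: "integrable (Px x) (?D \<rho>)" if "stop T \<rho>" for \<rho>
    by (rule bounded_integrable[OF m[OF that]])
  have "\<bar>E x (\<lambda>w. ?D \<rho> w) - E x (\<lambda>w. ?D \<sigma> w)\<bar> = \<bar>\<integral>w. ?D \<rho> w - ?D \<sigma> w \<partial>Px x\<bar>"
    using i[OF \<rho>] i[OF \<sigma>] by simp
  also have "\<dots> \<le> 2 * c * \<eta>"
  proof (rule integral_bounded)
    show "(\<lambda>w. ?D \<rho> w - ?D \<sigma> w) \<in> borel_measurable M" using m(1)[OF \<rho>] m(1)[OF \<sigma>] by simp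
    fix w assume w: "w \<in> space M"
    have "\<bar>cum \<phi> (\<sigma> w) w - cum \<phi> (\<rho> w) w\<bar> \<le> c * (\<sigma> w - \<rho> w)"
      by (rule cum_diff_bound[OF \<phi> w]) (use stopD(1)[OF \<rho> w] close w in auto)
    moreover have "\<bar>cum \<phi> (\<sigma> w + d) w - cum \<phi> (\<rho> w + d) w\<bar> \<le> c * ((\<sigma> w + d) - (\<rho> w + d))"
      by (rule cum_diff_bound[OF \<phi> w]) (use stopD(1)[OF \<rho> w] close w d in auto)
    moreover have "c * (\<sigma> w - \<rho> w) \<le> c * \<eta>"
      using close w bounded_byD(5)[OF \<phi>] by (intro mult_left_mono) auto
    ultimately show "\<bar>?D \<rho> w - ?D \<sigma> w\<bar> \<le> 2 * c * \<eta>" by simp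
  qed
  finally have "\<bar>E x (\<lambda>w. pot \<phi> d (X (\<rho> w) w)) - E x (\<lambda>w. pot \<phi> d (X (\<sigma> w) w))\<bar> \<le> 2 * c * \<eta>"
    using E[OF \<rho>] E[OF \<sigma>] by simp
  from divide_right_mono[OF this, of d] d
  show "\<bar>E x (\<lambda>w. pot \<phi> d (X (\<rho> w) w) / d) - E x (\<lambda>w. pot \<phi> d (X (\<sigma> w) w) / d)\<bar> \<le> 2 * c / d * \<eta>"
    by (simp add: abs_divide flip: diff_divide_distrib)
qed

lemma time_lipschitz_midpoint:
  assumes u: "bounded_by u b" "time_lipschitz u C" and v: "bounded_by v b'" "time_lipschitz v D"
  shows "time_lipschitz (\<lambda>y. (u y + v y) / 2) (C + D)"
  unfolding time_lipschitz_def
proof (intro conjI allI impI)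
  show "0 \<le> C + D" using u(2) v(2) by (simp add: time_lipschitz_def)
  fix T \<rho> \<sigma> x \<eta>
  assume a: "stop T \<rho>" "stop T \<sigma>" "\<forall>w\<in>space M. \<rho> w \<le> \<sigma> w \<and> \<sigma> w \<le> \<rho> w + \<eta>"
  have "\<bar>E x (\<lambda>w. u (X (\<rho> w) w)) - E x (\<lambda>w. u (X (\<sigma> w) w))\<bar> \<le> C * \<eta>"
    "\<bar>E x (\<lambda>w. v (X (\<rho> w) w)) - E x (\<lambda>w. v (X (\<sigma> w) w))\<bar> \<le> D * \<eta>"
    using u(2) v(2) a unfolding time_lipschitz_def by blast+
  moreover have aux: "\<bar>(p + q) / 2 - (p' + q') / 2\<bar> \<le> d + d'" if "\<bar>p - p'\<bar> \<le> d" "\<bar>q - q'\<bar> \<le> d'" for p q p' q' d d' :: real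
    using that abs_triangle_ineq[of "p - p'" "q - q'"] abs_ge_zero[of "p - p' + (q - q')"]
    by (simp add: abs_le_iff field_simps)
  ultimately show "\<bar>E x (\<lambda>w. (u (X (\<rho> w) w) + v (X (\<rho> w) w)) / 2) - E x (\<lambda>w. (u (X (\<sigma> w) w) + v (X (\<sigma> w) w)) / 2)\<bar>
      \<le> (C + D) * \<eta>"
    using comp_stop_integrable[OF a(1) u(1)] comp_stop_integrable[OF a(1) v(1)]
      comp_stop_integrable[OF a(2) u(1)] comp_stop_integrable[OF a(2) v(1)]
    unfolding distrib_right by simp
qed

end

context feller_process begin

text \<open>The short time averages converge to \<open>\<phi>\<close> only pointwise. Simons'
  inequality makes a finite convex combination of them uniformly close, and finite combinations keep
  a Lipschitz modulus in time.\<close>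

lemma C0_time_lipschitz_approx:
  assumes \<phi>: "\<phi> \<in> C0" and e: "0 < e"
  shows "\<exists>\<psi> C c. bounded_by \<psi> c \<and> time_lipschitz \<psi> C \<and> (\<forall>y. \<bar>\<phi> y - \<psi> y\<bar> \<le> e)"
proof -
  obtain c where c: "bounded_by \<phi> c" using C0_bounded[OF \<phi>] .
  define av where "av n y = pot \<phi> (1 / real (Suc n)) y / (1 / real (Suc n))" for n y
  \<comment> \<open>Simons' inequality bounds from above only. Doubling the space with a sign makes
    it bound the absolute value.\<close>
  define sg where "sg b = (if b then 1 else -1 :: real)" for b
  define a where "a n = (\<lambda>(y, b). sg b * (\<phi> y - av n y))" for n
  have av: "av n \<in> C0" "bounded_by (av n) c" "\<exists>C. time_lipschitz (av n) C" for n
  proof -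
    show "av n \<in> C0" unfolding av_def
      using C0_cmult[OF pot_C0[OF \<phi>, of "1 / real (Suc n)"], of "real (Suc n)"] by (simp add: mult.commute)
    show "\<exists>C. time_lipschitz (av n) C" unfolding av_def using time_lipschitz_average[OF c, of "1 / real (Suc n)"] by auto
    have "bounded_by (pot \<phi> (1 / real (Suc n))) (c * (1 / real (Suc n)))" by (rule pot_bounded_by[OF c]) simp
    then show "bounded_by (av n) c" unfolding av_def bounded_by_def by (auto simp: abs_mult field_simps simp del: of_nat_Suc)
  qed
  \<comment> \<open>Convex combinations act on the averages, since \<open>\<phi>\<close> is common
    to all terms; continuity, decay, the bound c and a Lipschitz constant all survive
    midpoints.\<close>
  have hull: "\<exists>\<psi> C. \<psi> \<in> C0 \<and> bounded_by \<psi> c \<and> time_lipschitz \<psi> C \<and> f = (\<lambda>(y, b). sg b * (\<phi> y - \<psi> y))"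
    if "f \<in> dyadic_hull a n" for f n
    using that
  proof induction
    case (base k)
    then show ?case using av unfolding a_def by blast
  next
    case (midpoint f g)
    then obtain u C v D where u: "u \<in> C0" "bounded_by u c" "time_lipschitz u C" "f = (\<lambda>(y, b). sg b * (\<phi> y - u y))"
      and v: "v \<in> C0" "bounded_by v c" "time_lipschitz v D" "g = (\<lambda>(y, b). sg b * (\<phi> y - v y))" by blast
    have "(\<lambda>y. (u y + v y) / 2) \<in> C0"
      using C0_cmult[OF C0_add[OF u(1) v(1)], of "1/2"] by simp
    moreover have "bounded_by (\<lambda>y. (u y + v y) / 2) c"
    proof (rule bounded_byI)
      show "\<bar>(u y + v y) / 2\<bar> \<le> c" for y
        using bounded_byD(2)[OF u(2), of y] bounded_byD(2)[OF v(2), of y] by (simp add: abs_le_iff)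
    qed (use u(2) v(2) in \<open>auto simp: bounded_by_def\<close>)
    moreover have "(\<lambda>y. (f y + g y) / 2) = (\<lambda>(y, b). sg b * (\<phi> y - (u y + v y) / 2))"
      unfolding u(4) v(4) by (auto simp: fun_eq_iff field_simps)
    ultimately show ?case using time_lipschitz_midpoint[OF u(2,3) v(2,3)] by blast
  qed
  have "\<exists>f\<in>dyadic_hull a 0. \<forall>y. f y \<le> e"
  proof (rule simons[OF _ _ _ e])
    fix k p
    show "\<bar>a k p\<bar> \<le> 2 * c"
      using bounded_byD(2)[OF c, of "fst p"] bounded_byD(2)[OF av(2), of k "fst p"]
      by (auto simp: a_def sg_def split_beta')
  next
    fix p
    show "(\<lambda>k. a k p) \<longlonglongrightarrow> 0"
    proof -
      have "(\<lambda>k. sg (snd p) * (\<phi> (fst p) - av k (fst p))) \<longlonglongrightarrow> sg (snd p) * (\<phi> (fst p) - \<phi> (fst p))"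
        unfolding av_def using pot_average_tendsto[OF c C0_cont[OF \<phi>], of "fst p"]
        by (intro tendsto_intros) (simp add: mult.commute)
      then show ?thesis by (simp add: a_def split_beta')
    qed
  next
    fix gs assume gs: "\<And>n. gs n \<in> dyadic_hull a n"
    have "\<forall>n. \<exists>\<psi>. \<psi> \<in> C0 \<and> bounded_by \<psi> c \<and> gs n = (\<lambda>(y, b). sg b * (\<phi> y - \<psi> y))" using hull[OF gs] by blast
    then obtain \<psi> where \<psi>: "\<And>n. \<psi> n \<in> C0" "\<And>n. bounded_by (\<psi> n) c" "\<And>n. gs n = (\<lambda>(y, b). sg b * (\<phi> y - \<psi> n y))"
      by metis
    \<comment> \<open>The dyadic series converges uniformly, hence stays in \<open>C0\<close>, and
      therefore its modulus attains a maximum.\<close>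
    define U where "U y = (\<Sum>k. (\<phi> y - \<psi> k y) / 2 ^ Suc k)" for y
    have b: "\<bar>\<phi> y - \<psi> k y\<bar> \<le> 2 * c" for k y
      using bounded_byD(2)[OF c, of y] bounded_byD(2)[OF \<psi>(2), of k y] by linarith
    have "U \<in> C0"
    proof (rule C0_uniform_limit)
      fix d :: real assume d: "0 < d"
      have "(\<lambda>N. 2 * c * (1 / 2) ^ N) \<longlonglongrightarrow> 2 * c * 0" by (intro tendsto_intros LIMSEQ_power_zero) simp
      from order_tendstoD(2)[OF this, of d] d obtain N where N: "2 * c / 2 ^ N < d"
        using eventually_happens'[OF sequentially_bot] by (fastforce simp: power_divide)
      show "\<exists>v\<in>C0. \<forall>y. \<bar>U y - v y\<bar> \<le> d"
      proof (intro bexI[of _ "\<lambda>y. \<Sum>k<N. (\<phi> y - \<psi> k y) / 2 ^ Suc k"] allI)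
        fix y show "\<bar>U y - (\<Sum>k<N. (\<phi> y - \<psi> k y) / 2 ^ Suc k)\<bar> \<le> d"
          unfolding U_def using dyadic_series_tail[of "\<lambda>k. \<phi> y - \<psi> k y", OF b, of N] N by linarith
        show "(\<lambda>y. \<Sum>k<N. (\<phi> y - \<psi> k y) / 2 ^ Suc k) \<in> C0"
          using C0_cmult[OF C0_diff[OF \<phi> \<psi>(1)], of "1 / 2 ^ Suc k" for k] by (intro C0_sum) simp
      qed
    qed
    then obtain y0 where y0: "\<And>y. \<bar>U y\<bar> \<le> \<bar>U y0\<bar>" using C0_attains by blast
    have G: "(\<Sum>k. gs k p / 2 ^ Suc k) = sg (snd p) * U (fst p)" for p
    proof -
      have "summable (\<lambda>k. (\<phi> (fst p) - \<psi> k (fst p)) / 2 ^ Suc k)"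
      proof (rule summable_comparison_test'[of "\<lambda>k. c * (1/2) ^ k" 0])
        show "summable (\<lambda>k. c * (1/2::real) ^ k)" by (intro summable_mult summable_geometric) simp
        show "norm ((\<phi> (fst p) - \<psi> k (fst p)) / 2 ^ Suc k) \<le> c * (1/2) ^ k" for k
          using divide_right_mono[OF b[of "fst p" k], of "2 ^ Suc k"] by (simp add: abs_mult power_divide field_simps)
      qed
      from suminf_mult[OF this, of "sg (snd p)"] show ?thesis
        by (simp add: \<psi>(3) U_def split_beta' del: power_Suc)
    qed
    show "\<exists>p0. \<forall>p. (\<Sum>k. gs k p / 2 ^ Suc k) \<le> (\<Sum>k. gs k p0 / 2 ^ Suc k)"
    \<comment> \<open>The sign coordinate is chosen so that the signed series at \<open>y0\<close>
      equals its modulus, which dominates both signed values at any other point.\<close>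
    proof (intro exI[of _ "(y0, 0 \<le> U y0)"] allI)
      fix p :: "'e \<times> bool"
      show "(\<Sum>k. gs k p / 2 ^ Suc k) \<le> (\<Sum>k. gs k (y0, 0 \<le> U y0) / 2 ^ Suc k)"
        unfolding G using y0[of "fst p"] by (auto simp: sg_def)
    qed
  qed
  then obtain f where f: "f \<in> dyadic_hull a 0" "\<And>p. f p \<le> e" by blast
  obtain \<psi> C where \<psi>: "bounded_by \<psi> c" "time_lipschitz \<psi> C" "f = (\<lambda>(y, b). sg b * (\<phi> y - \<psi> y))"
    using hull[OF f(1)] by blast
  have "\<bar>\<phi> y - \<psi> y\<bar> \<le> e" for y
    using f(2)[of "(y, True)"] f(2)[of "(y, False)"] unfolding \<psi>(3) by (auto simp: sg_def)
  with \<psi> show ?thesis by blast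
qed

text \<open>A path that is far out at some time \<open>\<rho> \<le> T\<close> would rarely visit a given compact set during a further time
  \<open>S\<close> much larger than \<open>T\<close>, because potentials of \<open>C0\<close> functions are \<open>C0\<close>. This contradicts the tightness of the
  occupation measure of \<open>[T, S]\<close>, so no strong continuity of the semigroup is needed.\<close>

lemma uniform_tightness:
  assumes e: "0 < e" and T: "0 < T"
  shows "\<exists>U\<in>C0. (\<forall>y. 0 \<le> U y \<and> U y \<le> 1) \<and>
     (\<forall>\<^sub>F x in nhds x0. \<forall>\<rho>. stop T \<rho> \<longrightarrow> 1 - e \<le> E x (\<lambda>w. U (X (\<rho> w) w)))"
proof -
  \<comment> \<open>This horizon makes (S - 2T)/S equal to 1 - e.\<close>
  define S where "S = 2 * T / e"
  have S: "0 < S" using e T by (simp add: S_def)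
  have "(\<lambda>n. pot (cutoff n) S x0) \<longlonglongrightarrow> (LINT s:{0..S}|lborel. 1)"
    by (rule pot_tendsto[OF cutoff_bounded_by]) (use S P_cutoff_tendsto in auto)
  then have "(\<lambda>n. pot (cutoff n) S x0) \<longlonglongrightarrow> S" using S by (simp add: set_lebesgue_integral_def)
  \<comment> \<open>One T is the margin for the mean cutoff occupation of [0, S]; a second T is lost
    when the initial interval [0, T] is discarded.\<close>
  from order_tendstoD(1)[OF this, of "S - T"] T obtain n where n: "S - T < pot (cutoff n) S x0"
    using eventually_happens'[OF sequentially_bot] by fastforce
  let ?c = "cutoff n"
  note cb = cutoff_bounded_by[of n]
  define U where "U y = 1 / S * pot ?c S y" for y
  have C0: "U \<in> C0" unfolding U_def by (rule C0_cmult[OF pot_C0[OF cutoff_C0]]) (use S in simp)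
  have cum_mono: "cum ?c a w \<le> cum ?c b w" if "0 \<le> a" "a \<le> b" "w \<in> space M" for a b w
    using cum_mono_le[of "\<lambda>_. 0" 0 ?c 1 w a b] cb cutoff_range that by (simp add: bounded_by_def cum_def)
  have pot_range: "0 \<le> pot ?c S y \<and> pot ?c S y \<le> S" for y
  proof
    show "pot ?c S y \<le> S" using bounded_byD(3)[OF pot_bounded_by[OF cb], of S y] S by simp
    show "0 \<le> pot ?c S y" using S cum_mono[of 0 S]
      by (subst X_fubini[OF cb, symmetric]) (auto intro!: Bochner_Integration.integral_nonneg_AE AE_I2 simp: Px cum_0)
  qed
  have range: "0 \<le> U y \<and> U y \<le> 1" for y
    unfolding U_def using pot_range[of y] S by (auto simp: field_simps)
  have "isCont (pot ?c S) x0"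
    using C0_cont[OF pot_C0[OF cutoff_C0, of S n]] S by (simp add: continuous_on_eq_continuous_at)
  then have "(pot ?c S \<longlongrightarrow> pot ?c S x0) (nhds x0)"
    using tendsto_at_iff_tendsto_nhds[of "pot ?c S" x0] by (simp add: isCont_def)
  from order_tendstoD(1)[OF this n]
  have "\<forall>\<^sub>F x in nhds x0. \<forall>\<rho>. stop T \<rho> \<longrightarrow> 1 - e \<le> E x (\<lambda>w. U (X (\<rho> w) w))"
  proof (eventually_elim, intro allI impI)
    fix x \<rho> assume x: "S - T < pot ?c S x" and \<rho>: "stop T \<rho>"
    let ?D = "\<lambda>w. cum ?c (\<rho> w + S) w - cum ?c (\<rho> w) w"
    have int: "integrable (Px x) (cum ?c t)" if "0 \<le> t" for t
      using cum_stop_integrable[OF stop_const[OF that order_refl] cb] .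
    have "S - 2 * T \<le> pot ?c S x - pot ?c T x"
      using x bounded_byD(3)[OF pot_bounded_by[OF cb], of T x] T by simp
    also have "\<dots> = E x (\<lambda>w. cum ?c S w - cum ?c T w)"
      using int[of S] int[of T] S T by (simp add: X_fubini[OF cb])
    \<comment> \<open>As \<open>\<rho>\<close> lies in [0, T], the window from \<open>\<rho>\<close>
      to \<open>\<rho>\<close> + S contains [T, S], and the cutoff is nonnegative.\<close>
    also have "\<dots> \<le> E x (\<lambda>w. ?D w)"
    proof (rule integral_mono)
      show "integrable (Px x) (\<lambda>w. cum ?c S w - cum ?c T w)" using int[of S] int[of T] S T by simp
      show "integrable (Px x) ?D"
      proof (rule bounded_integrable)
        show "?D \<in> borel_measurable M"
          using cum_measurable[OF cb, of "\<lambda>w. \<rho> w + S"] cum_measurable[OF cb, of \<rho>] stopD(4)[OF \<rho>] by simp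
        show "\<bar>?D w\<bar> \<le> 1 * S" if "w \<in> space M" for w
          using cum_diff_bound[OF cb that stopD(1)[OF \<rho> that], of "\<rho> w + S"] S by simp
      qed
      fix w assume "w \<in> space (Px x)"
      then have w: "w \<in> space M" by (simp add: Px)
      show "cum ?c S w - cum ?c T w \<le> ?D w"
        using cum_mono[of S "\<rho> w + S" w] cum_mono[of "\<rho> w" T w] stopD(1,2)[OF \<rho> w] w S by simp
    qed
    also have "\<dots> = E x (\<lambda>w. pot ?c S (X (\<rho> w) w))"
      using markov_cum_fixed[OF \<rho> prior_space[OF \<rho>] cb, of S x] S unfolding integral_indicator_space by simp
    finally have "(S - 2 * T) / S \<le> E x (\<lambda>w. pot ?c S (X (\<rho> w) w)) / S" using S by (intro divide_right_mono) auto
    moreover have "(S - 2 * T) / S = 1 - e" using S e T by (simp add: S_def field_simps)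
    ultimately show "1 - e \<le> E x (\<lambda>w. U (X (\<rho> w) w))" by (simp add: U_def)
  qed
  with C0 range show ?thesis by blast
qed

text \<open>Split g into gU and g(1 - U). The first part is in \<open>C0\<close> and uniformly close
  to a time-Lipschitz function; the second has small mean at every stopping time up to T, because
  the mean of U there is almost 1.\<close>

lemma stopped_modulus:
  assumes g: "bounded_by g c" "continuous_on UNIV g" and e: "0 < e" and T: "0 < T"
  shows "\<exists>\<eta>0>0. \<forall>\<^sub>F x in nhds x0. \<forall>\<rho> \<sigma>. stop T \<rho> \<longrightarrow> stop T \<sigma> \<longrightarrow>
     (\<forall>w\<in>space M. \<rho> w \<le> \<sigma> w \<and> \<sigma> w \<le> \<rho> w + \<eta>0) \<longrightarrow>
     \<bar>E x (\<lambda>w. g (X (\<rho> w) w)) - E x (\<lambda>w. g (X (\<sigma> w) w))\<bar> \<le> e"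
proof -
  have c: "0 \<le> c" using bounded_byD(5)[OF g(1)] .
  \<comment> \<open>Each of the two stopping times costs c times d for the lost mass plus e/6 for
    the approximation, which is at most e/3, and the Lipschitz part costs e/6. The summand 1 in the
    denominator guards against c = 0.\<close>
  define d where "d = e / (6 * (c + 1))"
  have d: "0 < d" "c * d \<le> e / 6" using e c by (auto simp: d_def field_simps)
  obtain U where U: "U \<in> C0" "\<And>y. 0 \<le> U y" "\<And>y. U y \<le> 1"
    and tight: "\<forall>\<^sub>F x in nhds x0. \<forall>\<rho>. stop T \<rho> \<longrightarrow> 1 - d \<le> E x (\<lambda>w. U (X (\<rho> w) w))"
    using uniform_tightness[OF d(1) T, of x0] by blast
  obtain \<psi> C b where \<psi>: "bounded_by \<psi> b" "time_lipschitz \<psi> C" "\<And>y. \<bar>g y * U y - \<psi> y\<bar> \<le> e / 6"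
    using C0_time_lipschitz_approx[OF C0_mult[OF U(1) g(2) bounded_byD(2)[OF g(1)]], of "e / 6"] e by auto
  have C: "0 \<le> C" using \<psi>(2) by (simp add: time_lipschitz_def)
  define \<eta>0 where "\<eta>0 = e / (6 * (C + 1))"
  have \<eta>0: "0 < \<eta>0" "C * \<eta>0 \<le> e / 6" using e C by (auto simp: \<eta>0_def field_simps)
  have Ub: "bounded_by U 1"
    using U C0_cont[OF U(1)] by (auto simp: bounded_by_def intro: borel_measurable_continuous_onI)
  have "\<forall>\<^sub>F x in nhds x0. \<forall>\<rho> \<sigma>. stop T \<rho> \<longrightarrow> stop T \<sigma> \<longrightarrow>
     (\<forall>w\<in>space M. \<rho> w \<le> \<sigma> w \<and> \<sigma> w \<le> \<rho> w + \<eta>0) \<longrightarrow>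
     \<bar>E x (\<lambda>w. g (X (\<rho> w) w)) - E x (\<lambda>w. g (X (\<sigma> w) w))\<bar> \<le> e"
    using tight
  proof (eventually_elim, intro allI impI)
    fix x \<rho> \<sigma> assume t: "\<forall>\<rho>. stop T \<rho> \<longrightarrow> 1 - d \<le> E x (\<lambda>w. U (X (\<rho> w) w))"
      and \<rho>: "stop T \<rho>" and \<sigma>: "stop T \<sigma>" and close: "\<forall>w\<in>space M. \<rho> w \<le> \<sigma> w \<and> \<sigma> w \<le> \<rho> w + \<eta>0"
    have near: "\<bar>E x (\<lambda>w. g (X (\<rho> w) w)) - E x (\<lambda>w. \<psi> (X (\<rho> w) w))\<bar> \<le> e / 3" if \<rho>: "stop T \<rho>" for \<rho>
    proof -
      interpret prob_space "Px x" by (rule Px)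
      note ig = comp_stop_integrable[OF \<rho> g(1), of x] and i\<psi> = comp_stop_integrable[OF \<rho> \<psi>(1), of x]
        and iU = comp_stop_integrable[OF \<rho> Ub, of x]
      have pt: "\<bar>g y - \<psi> y\<bar> \<le> c * (1 - U y) + e / 6" for y
      proof -
        have "\<bar>g y * (1 - U y)\<bar> \<le> c * (1 - U y)"
          using U(3)[of y] bounded_byD(2)[OF g(1), of y] by (simp add: abs_mult mult_right_mono)
        moreover have "g y - \<psi> y = g y * (1 - U y) + (g y * U y - \<psi> y)" by (simp add: algebra_simps)
        ultimately show ?thesis using \<psi>(3)[of y] by linarith
      qed
      have "\<bar>E x (\<lambda>w. g (X (\<rho> w) w)) - E x (\<lambda>w. \<psi> (X (\<rho> w) w))\<bar> = \<bar>\<integral>w. g (X (\<rho> w) w) - \<psi> (X (\<rho> w) w) \<partial>Px x\<bar>"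
        using ig i\<psi> by simp
      also have "\<dots> \<le> E x (\<lambda>w. \<bar>g (X (\<rho> w) w) - \<psi> (X (\<rho> w) w)\<bar>)" by (rule integral_abs_bound)
      also have "\<dots> \<le> E x (\<lambda>w. c * (1 - U (X (\<rho> w) w)) + e / 6)"
        by (rule integral_mono) (use ig i\<psi> iU pt in auto)
      also have "\<dots> = c * (1 - E x (\<lambda>w. U (X (\<rho> w) w))) + e / 6"
        using iU by (simp add: prob_space)
      also have "\<dots> \<le> c * d + e / 6" using t \<rho> c by (intro add_right_mono mult_left_mono) (auto simp: algebra_simps)
      finally show ?thesis using d(2) by linarith
    qed
    have "\<bar>E x (\<lambda>w. \<psi> (X (\<rho> w) w)) - E x (\<lambda>w. \<psi> (X (\<sigma> w) w))\<bar> \<le> C * \<eta>0"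
      using \<psi>(2) \<rho> \<sigma> close unfolding time_lipschitz_def by blast
    with near[OF \<rho>] near[OF \<sigma>] \<eta>0(2)
    show "\<bar>E x (\<lambda>w. g (X (\<rho> w) w)) - E x (\<lambda>w. g (X (\<sigma> w) w))\<bar> \<le> e" by linarith
  qed
  with \<eta>0(1) show ?thesis by blast
qed

end

section \<open>Finite horizon\<close>

context strong_markov begin

definition payoff :: "('e \<Rightarrow> real) \<Rightarrow> ('e \<Rightarrow> real) \<Rightarrow> ('w \<Rightarrow> real) \<Rightarrow> 'e \<Rightarrow> real" where
  "payoff f g \<rho> x = E x (\<lambda>w. cum f (\<rho> w) w + g (X (\<rho> w) w))"

text \<open>Backward recursion for stopping at multiples of \<open>\<eta>\<close> with k steps to
  go: either stop at once or run one step and continue optimally.\<close>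

primrec bermudan :: "('e \<Rightarrow> real) \<Rightarrow> ('e \<Rightarrow> real) \<Rightarrow> real \<Rightarrow> nat \<Rightarrow> 'e \<Rightarrow> real" where
  "bermudan f g \<eta> 0 = g"
| "bermudan f g \<eta> (Suc k) = (\<lambda>y. max (g y) (pot f \<eta> y + P \<eta> (bermudan f g \<eta> k) y))"

lemma bermudan_bounded_by:
  fixes \<eta> :: real
  assumes f: "bounded_by f c" and g: "bounded_by g d" and \<eta>: "0 \<le> \<eta>"
  shows "bounded_by (bermudan f g \<eta> k) (d + k * (c * \<eta>))"
proof (induction k)
  case (Suc k)
  note p = pot_bounded_by[OF f \<eta>] and q = P_bounded_by[OF Suc \<eta>]
  show ?case
  proof (rule bounded_byI)
    show "bermudan f g \<eta> (Suc k) \<in> borel_measurable borel"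
      using bounded_byD(1)[OF g] bounded_byD(1)[OF p] bounded_byD(1)[OF q] by simp
    have c: "0 \<le> c * \<eta>" using bounded_byD(5)[OF p] .
    then have k: "0 \<le> k * (c * \<eta>)" by simp
    show "\<bar>bermudan f g \<eta> (Suc k) y\<bar> \<le> d + Suc k * (c * \<eta>)" for y
      using bounded_byD(2)[OF g, of y] bounded_byD(2)[OF p, of y] bounded_byD(2)[OF q, of y] c k
      by (simp add: algebra_simps abs_le_iff max_def)
  qed
qed (use g in simp)

lemma bermudan_ge: "g y \<le> bermudan f g \<eta> k y"
  by (cases k) auto

text \<open>A time on the grid is at most t exactly when its index is at most the integer part of
  t/\<open>\<eta>\<close>, and the corresponding grid time lies before t.\<close>

lemma grid_stop:
  fixes \<kappa> :: "'w \<Rightarrow> nat" and \<eta> :: real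
  assumes \<eta>: "0 < \<eta>" and le: "\<And>w. w \<in> space M \<Longrightarrow> \<kappa> w \<le> N"
    and F\<kappa>: "\<And>k. {w \<in> space M. \<kappa> w \<le> k} \<in> sets (F (k * \<eta>))"
  shows "stop (N * \<eta>) (\<lambda>w. \<kappa> w * \<eta>)"
  unfolding stop_def
proof (intro conjI ballI allI impI)
  fix w assume "w \<in> space M"
  then show "\<kappa> w * \<eta> \<le> N * \<eta>" "0 \<le> \<kappa> w * \<eta>" using le \<eta> by (auto intro!: mult_right_mono)
next
  fix t :: real assume t: "0 \<le> t"
  define k where "k = nat \<lfloor>t / \<eta>\<rfloor>"
  have k: "real k = of_int \<lfloor>t / \<eta>\<rfloor>" using t \<eta> by (simp add: k_def)
  have "real k \<le> t / \<eta>" unfolding k by simp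
  then have kt: "k * \<eta> \<le> t" using \<eta> by (simp add: field_simps)
  have iff: "\<kappa> w * \<eta> \<le> t \<longleftrightarrow> \<kappa> w \<le> k" for w
  proof -
    have "\<kappa> w * \<eta> \<le> t \<longleftrightarrow> real (\<kappa> w) \<le> t / \<eta>" using \<eta> by (simp add: field_simps)
    also have "\<dots> \<longleftrightarrow> int (\<kappa> w) \<le> \<lfloor>t / \<eta>\<rfloor>" by (simp add: le_floor_iff)
    also have "\<dots> \<longleftrightarrow> \<kappa> w \<le> k" using t \<eta> by (simp add: k_def le_nat_iff nat_le_iff) 
    finally show ?thesis .
  qed
  show "{w \<in> space M. \<kappa> w * \<eta> \<le> t} \<in> sets (F t)"
    unfolding iff using F(3)[OF _ kt F\<kappa>] \<eta> by simp
qed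

text \<open>\<open>Z k\<close> is the reward collected up to step k under the rule
  \<open>\<kappa>\<close>, plus g if the rule has stopped strictly earlier, or else the recursive
  value for the steps left. A rule stopping exactly at k still carries that value in
  \<open>Z k\<close>; the switch to g happens on passing to \<open>Z (Suc k)\<close> and is the
  second term of \<open>D k\<close>. The first term comes from the Markov property on the event,
  known at time k times \<open>\<eta>\<close>, that the rule continues.\<close>

lemma bermudan_step:
  fixes \<kappa> :: "'w \<Rightarrow> nat" and \<eta> :: real
  assumes f: "bounded_by f c" and g: "bounded_by g d" and \<eta>: "0 < \<eta>"
    and le: "\<And>w. w \<in> space M \<Longrightarrow> \<kappa> w \<le> N"
    and F\<kappa>: "\<And>k. {w \<in> space M. \<kappa> w \<le> k} \<in> sets (F (k * \<eta>))"
    and Z_def: "\<And>k w. Z k w = cum f (min (\<kappa> w * \<eta>) (k * \<eta>)) w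
       + (indicator {w \<in> space M. \<kappa> w < k} w * g (X (\<kappa> w * \<eta>) w)
       + indicator {w \<in> space M. k \<le> \<kappa> w} w * bermudan f g \<eta> (N - k) (X (k * \<eta>) w))"
    and D_def: "\<And>k w. D k w = indicator {w \<in> space M. k < \<kappa> w} w *
         (pot f \<eta> (X (k * \<eta>) w) + P \<eta> (bermudan f g \<eta> (N - Suc k)) (X (k * \<eta>) w) - bermudan f g \<eta> (N - k) (X (k * \<eta>) w))
       + indicator {w \<in> space M. \<kappa> w = k} w * (g (X (k * \<eta>) w) - bermudan f g \<eta> (N - k) (X (k * \<eta>) w))"
  shows "E x (\<lambda>w. Z (Suc k) w) - E x (\<lambda>w. Z k w) = E x (\<lambda>w. D k w)"
    and "integrable (Px x) (D k)"
proof -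
  let ?b = "\<lambda>k. bermudan f g \<eta> k"
  let ?t = "\<lambda>k. real k * \<eta>"
  have t: "0 \<le> ?t k" for k using \<eta> by simp
  note b = bermudan_bounded_by[OF f g less_imp_le[OF \<eta>]]
  note \<rho> = grid_stop[OF \<eta> le F\<kappa>]
  have gt: "{w \<in> space M. k < \<kappa> w} \<in> sets (F (?t k))" for k
  proof -
    have "{w \<in> space M. k < \<kappa> w} = space M - {w \<in> space M. \<kappa> w \<le> k}" by auto
    then show ?thesis using F_Diff[OF t space_F[OF t] F\<kappa>] by simp
  qed
  have le_M: "{w \<in> space M. \<kappa> w \<le> k} \<in> sets M" for k using F(2)[OF t F\<kappa>] .
  have lt_M: "{w \<in> space M. \<kappa> w < k} \<in> sets M" for k
  proof (cases k)
    case (Suc j) then show ?thesis using le_M[of j] by (simp add: less_Suc_eq_le)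
  qed simp
  have gt_M: "{w \<in> space M. k < \<kappa> w} \<in> sets M" for k using F(2)[OF t gt] .
  have ge_M: "{w \<in> space M. k \<le> \<kappa> w} \<in> sets M" for k
  proof (cases k)
    case (Suc j) then show ?thesis using gt_M[of j] by (simp add: Suc_le_eq)
  qed simp
  have eq_M: "{w \<in> space M. \<kappa> w = k} \<in> sets M" for k
  proof -
    have "{w \<in> space M. \<kappa> w = k} = {w \<in> space M. \<kappa> w \<le> k} - {w \<in> space M. \<kappa> w < k}" by auto
    then show ?thesis using le_M lt_M by simp
  qed
  have sc: "stop (?t k) (\<lambda>_. ?t k)" for k by (rule stop_const[OF t order_refl])
  have iX: "integrable (Px x) (\<lambda>w. u (X (?t k) w))" if "bounded_by u e" for u e k
    by (rule X_integrable[OF that t])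
  have icum: "integrable (Px x) (cum f (?t k))" for k using cum_stop_integrable[OF sc f] .
  have iZ: "integrable (Px x) (Z k)" for k
    unfolding Z_def
    by (intro Bochner_Integration.integrable_add indicator_integrable cum_stop_integrable[OF stop_min[OF \<rho> t] f]
        comp_stop_integrable[OF \<rho> g] iX[OF b] lt_M ge_M)
  have i1: "integrable (Px x) (\<lambda>w. indicator {w \<in> space M. k < \<kappa> w} w * (cum f (?t (Suc k)) w - cum f (?t k) w))"
    by (rule indicator_integrable[OF Bochner_Integration.integrable_diff[OF icum icum] gt_M])
  have i2: "integrable (Px x) (\<lambda>w. indicator {w \<in> space M. k < \<kappa> w} w * ?b i (X (?t j) w))" for i j
    by (rule indicator_integrable[OF iX[OF b] gt_M])
  have i3: "integrable (Px x) (\<lambda>w. indicator {w \<in> space M. \<kappa> w = k} w * (g (X (?t k) w) - ?b (N - k) (X (?t k) w)))"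
    by (rule indicator_integrable[OF Bochner_Integration.integrable_diff[OF iX[OF g] iX[OF b]] eq_M])
  have i4: "integrable (Px x) (\<lambda>w. indicator {w \<in> space M. k < \<kappa> w} w * pot f \<eta> (X (?t k) w))"
    by (rule indicator_integrable[OF iX[OF pot_bounded_by[OF f less_imp_le[OF \<eta>]]] gt_M])
  have i5: "integrable (Px x) (\<lambda>w. indicator {w \<in> space M. k < \<kappa> w} w * P \<eta> (?b i) (X (?t k) w))" for i
    by (rule indicator_integrable[OF iX[OF P_bounded_by[OF b less_imp_le[OF \<eta>]]] gt_M])
  show iD: "integrable (Px x) (D k)"
    unfolding D_def distrib_left right_diff_distrib
    by (intro Bochner_Integration.integrable_add Bochner_Integration.integrable_diff i4 i5 i2
        indicator_integrable[OF iX[OF g] eq_M] indicator_integrable[OF iX[OF b] eq_M])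
  let ?B = "{w \<in> space M. k < \<kappa> w}"
  let ?u1 = "\<lambda>w. indicator ?B w * (cum f (?t (Suc k)) w - cum f (?t k) w)"
    and ?u2 = "\<lambda>w. indicator ?B w * ?b (N - Suc k) (X (?t (Suc k)) w)"
    and ?u3 = "\<lambda>w. indicator {w \<in> space M. \<kappa> w = k} w * (g (X (?t k) w) - ?b (N - k) (X (?t k) w))"
    and ?u4 = "\<lambda>w. indicator ?B w * ?b (N - k) (X (?t k) w)"
    and ?u5 = "\<lambda>w. indicator ?B w * pot f \<eta> (X (?t k) w)"
    and ?u6 = "\<lambda>w. indicator ?B w * P \<eta> (?b (N - Suc k)) (X (?t k) w)"
  have "E x (\<lambda>w. Z (Suc k) w) - E x (\<lambda>w. Z k w) = E x (\<lambda>w. Z (Suc k) w - Z k w)"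
    using iZ by simp
  also have "\<dots> = E x (\<lambda>w. ?u1 w
      + (?u2 w
      + (?u3 w
      - ?u4 w)))"
  proof (rule Bochner_Integration.integral_cong)
    fix w assume "w \<in> space (Px x)"
    then have w: "w \<in> space M" by (simp add: Px)
    consider "\<kappa> w < k" | "\<kappa> w = k" | "k < \<kappa> w" by linarith
    then show "Z (Suc k) w - Z k w = ?u1 w
      + (?u2 w
      + (?u3 w
      - ?u4 w))"
    proof cases
      case 1
      then have "min (\<kappa> w * \<eta>) (?t k) = \<kappa> w * \<eta>" "min (\<kappa> w * \<eta>) (?t (Suc k)) = \<kappa> w * \<eta>"
        using \<eta> by (auto simp: min_def)
      with 1 w show ?thesis unfolding Z_def by simp
    next
      case 2
      then have "min (\<kappa> w * \<eta>) (?t k) = \<kappa> w * \<eta>" "min (\<kappa> w * \<eta>) (?t (Suc k)) = \<kappa> w * \<eta>"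
        using \<eta> by (auto simp: min_def)
      with 2 w show ?thesis unfolding Z_def by simp
    next
      case 3
      then have "Suc k \<le> \<kappa> w" by simp
      then have "?t (Suc k) \<le> \<kappa> w * \<eta>" "?t k \<le> \<kappa> w * \<eta>" using \<eta> 3 by (auto intro!: mult_right_mono simp del: of_nat_Suc)
      then have "min (\<kappa> w * \<eta>) (?t k) = ?t k" "min (\<kappa> w * \<eta>) (?t (Suc k)) = ?t (Suc k)"
        by (auto simp: min_def)
      with 3 w show ?thesis unfolding Z_def by simp
    qed
  qed simp
  also have "\<dots> = E x ?u1
      + (E x ?u2
      + (E x ?u3
      - E x ?u4))"
    using i1 i2[of "N - Suc k" "Suc k"] i3 i2[of "N - k" k] by (simp del: of_nat_Suc)
  also have "E x ?u1 = E x ?u5"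
    using markov_cum_fixed[OF sc prior_const[OF t gt] f less_imp_le[OF \<eta>], of x k] by (simp add: algebra_simps)
  also have "E x ?u2 = E x ?u6"
    using markov_stop[OF sc prior_const[OF t gt] less_imp_le[OF \<eta>] b, of x k "N - Suc k"] by (simp add: algebra_simps)
  also have "E x ?u5
      + (E x ?u6
      + (E x ?u3
      - E x ?u4))
      = E x (\<lambda>w. ?u5 w
      + (?u6 w
      + (?u3 w
      - ?u4 w)))"
    using i4 i5[of "N - Suc k"] i3 i2[of "N - k" k] by simp
  also have "\<dots> = E x (\<lambda>w. D k w)"
    by (rule Bochner_Integration.integral_cong) (auto simp: D_def algebra_simps)
  finally show "E x (\<lambda>w. Z (Suc k) w) - E x (\<lambda>w. Z k w) = E x (\<lambda>w. D k w)" .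
qed

text \<open>The drift \<open>D k\<close> is never positive by the recursion, so \<open>Z\<close>
  decreases in mean from the recursive value to the payoff. It is zero when the rule continues only
  where the value differs from g, so that the maximum is the continuation term, and stops only where
  the value equals g.\<close>

lemma bermudan_telescope:
  fixes \<kappa> :: "'w \<Rightarrow> nat" and \<eta> :: real
  assumes f: "bounded_by f c" and g: "bounded_by g d" and \<eta>: "0 < \<eta>"
    and le: "\<And>w. w \<in> space M \<Longrightarrow> \<kappa> w \<le> N"
    and F\<kappa>: "\<And>k. {w \<in> space M. \<kappa> w \<le> k} \<in> sets (F (k * \<eta>))"
  shows "payoff f g (\<lambda>w. \<kappa> w * \<eta>) x \<le> bermudan f g \<eta> N x"
    and "(\<And>w k. w \<in> space M \<Longrightarrow> k < N \<Longrightarrow> k < \<kappa> w \<Longrightarrow> bermudan f g \<eta> (N - k) (X (k * \<eta>) w) \<noteq> g (X (k * \<eta>) w))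
      \<Longrightarrow> (\<And>w. w \<in> space M \<Longrightarrow> bermudan f g \<eta> (N - \<kappa> w) (X (\<kappa> w * \<eta>) w) = g (X (\<kappa> w * \<eta>) w))
      \<Longrightarrow> payoff f g (\<lambda>w. \<kappa> w * \<eta>) x = bermudan f g \<eta> N x"
proof -
  let ?b = "\<lambda>k. bermudan f g \<eta> k"
  define Z where "Z k w = cum f (min (\<kappa> w * \<eta>) (k * \<eta>)) w
       + (indicator {w \<in> space M. \<kappa> w < k} w * g (X (\<kappa> w * \<eta>) w)
       + indicator {w \<in> space M. k \<le> \<kappa> w} w * ?b (N - k) (X (k * \<eta>) w))" for k w
  define D where "D k w = indicator {w \<in> space M. k < \<kappa> w} w *
         (pot f \<eta> (X (k * \<eta>) w) + P \<eta> (?b (N - Suc k)) (X (k * \<eta>) w) - ?b (N - k) (X (k * \<eta>) w))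
       + indicator {w \<in> space M. \<kappa> w = k} w * (g (X (k * \<eta>) w) - ?b (N - k) (X (k * \<eta>) w))" for k w
  note step = bermudan_step[OF f g \<eta> le F\<kappa> Z_def D_def]
  note b = bermudan_bounded_by[OF f g less_imp_le[OF \<eta>]]
  have Z0: "E x (\<lambda>w. Z 0 w) = ?b N x"
  proof -
    have "E x (\<lambda>w. Z 0 w) = E x (\<lambda>w. ?b N (X 0 w))"
      by (rule Bochner_Integration.integral_cong) (use \<eta> in \<open>auto simp: Z_def Px cum_0 min_def mult_le_0_iff\<close>)
    then show ?thesis using P_0[OF b, of N x] by (simp add: semigroup_def)
  qed
  have ZN: "E x (\<lambda>w. Z N w) = payoff f g (\<lambda>w. \<kappa> w * \<eta>) x"
    unfolding payoff_def
  proof (rule Bochner_Integration.integral_cong)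
    fix w assume "w \<in> space (Px x)"
    then have w: "w \<in> space M" by (simp add: Px)
    then have "min (\<kappa> w * \<eta>) (N * \<eta>) = \<kappa> w * \<eta>" using le[OF w] \<eta> by (simp add: min_def)
    then show "Z N w = cum f (\<kappa> w * \<eta>) w + g (X (\<kappa> w * \<eta>) w)"
      unfolding Z_def using le[OF w] w by (cases "\<kappa> w < N") auto
  qed simp
  have unfold: "?b (N - k) y = max (g y) (pot f \<eta> y + P \<eta> (?b (N - Suc k)) y)" if "k < N" for k y
    using that by (simp add: Suc_diff_Suc[symmetric])
  have "E x (\<lambda>w. Z k w) \<le> ?b N x" if "k \<le> N" for k
    using that
  proof (induction k)
    case (Suc k)
    have "E x (\<lambda>w. D k w) \<le> E x (\<lambda>w. 0)"
    proof (rule integral_mono[OF step(2)])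
      show "D k w \<le> 0" for w
        using Suc.prems unfold[of k "X (k * \<eta>) w"] unfolding D_def by (auto simp: indicator_def)
      show "integrable (Px x) (\<lambda>w. 0 :: real)" by (rule bounded_integrable[of _ 0]) auto
    qed
    then show ?case using Suc step(1)[where k = k and x = x] by simp
  qed (simp add: Z0)
  from this[of N] show "payoff f g (\<lambda>w. \<kappa> w * \<eta>) x \<le> bermudan f g \<eta> N x" using ZN by simp
  assume before: "\<And>w k. w \<in> space M \<Longrightarrow> k < N \<Longrightarrow> k < \<kappa> w \<Longrightarrow> ?b (N - k) (X (k * \<eta>) w) \<noteq> g (X (k * \<eta>) w)"
    and at: "\<And>w. w \<in> space M \<Longrightarrow> ?b (N - \<kappa> w) (X (\<kappa> w * \<eta>) w) = g (X (\<kappa> w * \<eta>) w)"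
  have "E x (\<lambda>w. Z k w) = ?b N x" if "k \<le> N" for k
    using that
  proof (induction k)
    case (Suc k)
    have "E x (\<lambda>w. D k w) = E x (\<lambda>w. 0)"
    proof (rule Bochner_Integration.integral_cong)
      fix w assume "w \<in> space (Px x)"
      then have w: "w \<in> space M" by (simp add: Px)
      have kN: "k < N" using Suc.prems by simp
      consider "\<kappa> w < k" | "\<kappa> w = k" | "k < \<kappa> w" by linarith
      then show "D k w = 0"
      proof cases
        case 3
        with before[OF w kN] have "?b (N - k) (X (k * \<eta>) w) = pot f \<eta> (X (k * \<eta>) w) + P \<eta> (?b (N - Suc k)) (X (k * \<eta>) w)"
          unfolding unfold[OF kN] by (simp add: max_def split: if_splits)
        with 3 show ?thesis by (simp add: D_def)
      qed (use at[OF w] in \<open>simp_all add: D_def\<close>)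
    qed simp
    then show ?case using Suc step(1)[where k = k and x = x] by simp
  qed (simp add: Z0)
  from this[of N] show "payoff f g (\<lambda>w. \<kappa> w * \<eta>) x = bermudan f g \<eta> N x" using ZN by simp
qed

text \<open>Stop at the first grid time where the recursive value equals g. Such a time exists
  because the value with no steps left is g, and whether it has come is decided by the positions at
  the grid times so far.\<close>

lemma bermudan_attained:
  fixes \<eta> :: real
  assumes f: "bounded_by f c" and g: "bounded_by g d" and \<eta>: "0 < \<eta>"
  shows "\<exists>\<rho>. stop (N * \<eta>) \<rho> \<and> (\<forall>x. payoff f g \<rho> x = bermudan f g \<eta> N x)"
proof -
  let ?b = "\<lambda>k. bermudan f g \<eta> k"
  define S where "S w k \<longleftrightarrow> ?b (N - k) (X (k * \<eta>) w) = g (X (k * \<eta>) w)" for w k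
  define \<kappa> where "\<kappa> w = (LEAST k. S w k)" for w
  note b = bermudan_bounded_by[OF f g less_imp_le[OF \<eta>]]
  have SN: "S w N" for w by (simp add: S_def)
  have le: "\<kappa> w \<le> N" for w unfolding \<kappa>_def by (rule Least_le[of "S w", OF SN])
  have F\<kappa>: "{w \<in> space M. \<kappa> w \<le> k} \<in> sets (F (k * \<eta>))" for k
  proof -
    have "\<kappa> w \<le> k \<longleftrightarrow> (\<exists>j\<le>k. S w j)" for w
      unfolding \<kappa>_def by (meson LeastI Least_le SN order_trans)
    then have "{w \<in> space M. \<kappa> w \<le> k} = (\<Union>j\<le>k. {w \<in> space M. S w j})" by auto
    also have "\<dots> \<in> sets (F (k * \<eta>))"
    proof (intro sets.finite_UN)
      fix j assume "j \<in> {..k}"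
      then have jk: "j * \<eta> \<le> k * \<eta>" using \<eta> by simp
      have j0: "0 \<le> j * \<eta>" using \<eta> by simp
      have "{w \<in> space (F (j * \<eta>)). S w j} \<in> sets (F (j * \<eta>))"
        unfolding S_def
        by (rule borel_measurable_eq[OF measurable_compose[OF X_F[OF j0] bounded_byD(1)[OF b]] measurable_compose[OF X_F[OF j0] bounded_byD(1)[OF g]]])
      from F(3)[OF j0 jk this] show "{w \<in> space M. S w j} \<in> sets (F (k * \<eta>))"
        unfolding F(1)[OF j0] .
    qed simp
    finally show ?thesis .
  qed
  have "payoff f g (\<lambda>w. \<kappa> w * \<eta>) x = ?b N x" for x
  proof (rule bermudan_telescope(2)[OF f g \<eta> le F\<kappa>])
    fix w k assume "k < \<kappa> w"
    then have "\<not> S w k" unfolding \<kappa>_def by (rule not_less_Least)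
    then show "?b (N - k) (X (k * \<eta>) w) \<noteq> g (X (k * \<eta>) w)" by (simp add: S_def)
  next
    fix w show "?b (N - \<kappa> w) (X (\<kappa> w * \<eta>) w) = g (X (\<kappa> w * \<eta>) w)"
      using LeastI[of "S w", OF SN] unfolding \<kappa>_def[symmetric] by (simp add: S_def)
  qed
  with grid_stop[OF \<eta> le F\<kappa>] show ?thesis by blast
qed

end

context feller_process begin

lemma bermudan_cont:
  assumes f: "bounded_by f c" "continuous_on UNIV f" and g: "bounded_by g d" "continuous_on UNIV g" and \<eta>: "0 \<le> \<eta>"
  shows "continuous_on UNIV (bermudan f g \<eta> k)"
proof (induction k)
  case (Suc k)
  then show ?case
    using pot_cont[OF f \<eta>] P_cont[OF bermudan_bounded_by[OF f(1) g(1) \<eta>] Suc \<eta>] g(2)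
    by (auto intro!: continuous_intros)
qed (use g in simp)

text \<open>Rounding a rule up to the grid costs at most c times \<open>\<eta>\<close> in running
  reward and the stopped modulus of g in terminal reward. Only this comparison is local around
  \<open>x0\<close>; attainment of v and the bound from below by g hold everywhere.\<close>

lemma finite_horizon_approx:
  assumes f: "bounded_by f c" "continuous_on UNIV f" and g: "bounded_by g d" "continuous_on UNIV g"
    and e: "0 < e" and T: "0 < T"
  shows "\<exists>v. continuous_on UNIV v \<and> (\<exists>\<rho>. stop T \<rho> \<and> (\<forall>x. payoff f g \<rho> x = v x)) \<and> (\<forall>x. g x \<le> v x) \<and>
     (\<forall>\<^sub>F x in nhds x0. \<forall>\<rho>. stop T \<rho> \<longrightarrow> payoff f g \<rho> x \<le> v x + e)"
proof -
  have c: "0 \<le> c" using bounded_byD(5)[OF f(1)] .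
  obtain \<eta>0 where \<eta>0: "0 < \<eta>0" and modulus: "\<forall>\<^sub>F x in nhds x0. \<forall>\<rho> \<sigma>. stop T \<rho> \<longrightarrow> stop T \<sigma> \<longrightarrow>
     (\<forall>w\<in>space M. \<rho> w \<le> \<sigma> w \<and> \<sigma> w \<le> \<rho> w + \<eta>0) \<longrightarrow>
     \<bar>E x (\<lambda>w. g (X (\<rho> w) w)) - E x (\<lambda>w. g (X (\<sigma> w) w))\<bar> \<le> e / 2"
    using stopped_modulus[OF g, of "e / 2" T x0] e T by auto
  \<comment> \<open>The first bound invokes the modulus of g, the second keeps the running loss
    below e/2. The mesh itself has to divide T.\<close>
  define \<eta>1 where "\<eta>1 = min \<eta>0 (e / (2 * (c + 1)))"
  have \<eta>1: "0 < \<eta>1" using \<eta>0 e c by (simp add: \<eta>1_def)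
  obtain n where n: "T / \<eta>1 \<le> real n" using real_arch_simple by blast
  define N where "N = Suc n"
  have N: "0 < N" "T / \<eta>1 \<le> real N" using n by (auto simp: N_def)
  define \<eta> where "\<eta> = T / N"
  have \<eta>: "0 < \<eta>" "N * \<eta> = T" using T N by (auto simp: \<eta>_def)
  have "\<eta> \<le> \<eta>1" using N T \<eta>1 by (simp add: \<eta>_def field_simps)
  then have \<eta>le: "\<eta> \<le> \<eta>0" "\<eta> \<le> e / (2 * (c + 1))" by (auto simp: \<eta>1_def)
  have c\<eta>: "c * \<eta> \<le> e / 2"
  proof -
    have "\<eta> * (2 * (c + 1)) \<le> e" using \<eta>le(2) c by (simp add: pos_le_divide_eq)
    then show ?thesis using \<eta>(1) by (simp add: algebra_simps)
  qed
  let ?v = "bermudan f g \<eta> N"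
  have "\<forall>\<^sub>F x in nhds x0. \<forall>\<rho>. stop T \<rho> \<longrightarrow> payoff f g \<rho> x \<le> ?v x + e"
    using modulus
  proof (eventually_elim, intro allI impI)
    fix x \<rho>
    assume mod: "\<forall>\<rho> \<sigma>. stop T \<rho> \<longrightarrow> stop T \<sigma> \<longrightarrow>
       (\<forall>w\<in>space M. \<rho> w \<le> \<sigma> w \<and> \<sigma> w \<le> \<rho> w + \<eta>0) \<longrightarrow>
       \<bar>E x (\<lambda>w. g (X (\<rho> w) w)) - E x (\<lambda>w. g (X (\<sigma> w) w))\<bar> \<le> e / 2"
      and \<rho>: "stop T \<rho>"
    \<comment> \<open>Rounding must go up: then the index is at most k exactly when
      \<open>\<rho>\<close> is at most k times \<open>\<eta>\<close>, so the rounded time looks at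
      no future information.\<close>
    define \<kappa> where "\<kappa> w = nat \<lceil>\<rho> w / \<eta>\<rceil>" for w
    let ?\<sigma> = "\<lambda>w. \<kappa> w * \<eta>"
    have iff: "\<kappa> w \<le> k \<longleftrightarrow> \<rho> w \<le> k * \<eta>" for w k
      using \<eta>(1) by (simp add: \<kappa>_def nat_le_iff ceiling_le_iff pos_divide_le_eq)
    have le: "\<kappa> w \<le> N" if "w \<in> space M" for w using stopD(2)[OF \<rho> that] \<eta>(2) by (simp add: iff)
    have F\<kappa>: "{w \<in> space M. \<kappa> w \<le> k} \<in> sets (F (k * \<eta>))" for k
      unfolding iff using stopD(3)[OF \<rho>, of "k * \<eta>"] \<eta>(1) by simp
    have \<sigma>: "stop T ?\<sigma>" using grid_stop[OF \<eta>(1) le F\<kappa>] \<eta>(2) by simp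
    have close: "\<rho> w \<le> ?\<sigma> w \<and> ?\<sigma> w \<le> \<rho> w + \<eta>" if w: "w \<in> space M" for w
    proof
      show "\<rho> w \<le> ?\<sigma> w" using iff[of w "\<kappa> w"] by simp
      have "0 \<le> \<rho> w / \<eta>" using stopD(1)[OF \<rho> w] \<eta>(1) by simp
      then have "real (\<kappa> w) \<le> \<rho> w / \<eta> + 1" unfolding \<kappa>_def by linarith
      then have "\<kappa> w * \<eta> \<le> (\<rho> w / \<eta> + 1) * \<eta>" using \<eta>(1) by (intro mult_right_mono) auto
      then show "?\<sigma> w \<le> \<rho> w + \<eta>" using \<eta>(1) by (simp add: algebra_simps)
    qed
    have G: "E x (\<lambda>w. g (X (\<rho> w) w)) \<le> E x (\<lambda>w. g (X (?\<sigma> w) w)) + e / 2"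
    proof -
      have "\<forall>w\<in>space M. \<rho> w \<le> ?\<sigma> w \<and> ?\<sigma> w \<le> \<rho> w + \<eta>0" using close \<eta>le(1) by fastforce
      with mod \<rho> \<sigma> have "\<bar>E x (\<lambda>w. g (X (\<rho> w) w)) - E x (\<lambda>w. g (X (?\<sigma> w) w))\<bar> \<le> e / 2" by blast
      then show ?thesis by (simp only: abs_le_iff) linarith
    qed
    note i = cum_stop_integrable[OF \<rho> f(1), of x] cum_stop_integrable[OF \<sigma> f(1), of x]
      comp_stop_integrable[OF \<rho> g(1), of x] comp_stop_integrable[OF \<sigma> g(1), of x]
    have "\<bar>\<integral>w. cum f (?\<sigma> w) w - cum f (\<rho> w) w \<partial>Px x\<bar> \<le> c * \<eta>"
    proof (rule integral_bounded)
      show "(\<lambda>w. cum f (?\<sigma> w) w - cum f (\<rho> w) w) \<in> borel_measurable M"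
        using cum_measurable[OF f(1) stopD(4)[OF \<rho>]] cum_measurable[OF f(1) stopD(4)[OF \<sigma>]] by simp
      fix w assume w: "w \<in> space M"
      have "\<bar>cum f (?\<sigma> w) w - cum f (\<rho> w) w\<bar> \<le> c * (?\<sigma> w - \<rho> w)"
        by (rule cum_diff_bound[OF f(1) w stopD(1)[OF \<rho> w]]) (use close[OF w] in simp)
      also have "\<dots> \<le> c * \<eta>" using close[OF w] c by (intro mult_left_mono) auto
      finally show "\<bar>cum f (?\<sigma> w) w - cum f (\<rho> w) w\<bar> \<le> c * \<eta>" .
    qed
    then have "E x (\<lambda>w. cum f (\<rho> w) w) \<le> E x (\<lambda>w. cum f (?\<sigma> w) w) + e / 2"
      using i c\<eta> by (simp add: abs_le_iff)
    with G have "payoff f g \<rho> x \<le> payoff f g ?\<sigma> x + e"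
      unfolding payoff_def using i by simp
    then show "payoff f g \<rho> x \<le> ?v x + e"
      using bermudan_telescope(1)[OF f(1) g(1) \<eta>(1) le F\<kappa>, of x] by linarith
  qed
  moreover have "continuous_on UNIV ?v" by (rule bermudan_cont[OF f g less_imp_le[OF \<eta>(1)]])
  moreover have "\<exists>\<rho>. stop T \<rho> \<and> (\<forall>x. payoff f g \<rho> x = ?v x)"
    using bermudan_attained[OF f(1) g(1) \<eta>(1), of N] unfolding \<eta>(2) .
  moreover have "\<forall>x. g x \<le> ?v x" using bermudan_ge by blast
  ultimately show ?thesis by (intro exI[of _ ?v] conjI)
qed

end

section \<open>Ergodicity and potentials\<close>

locale ergodic_process = feller_process M F X Px
  for M :: "'w measure" and F :: "real \<Rightarrow> 'w measure"
    and X :: "real \<Rightarrow> 'w \<Rightarrow> 'e::{metric_space, second_countable_topology}"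
    and Px :: "'e \<Rightarrow> 'w measure" +
  fixes \<mu> :: "'e measure" and K :: "'e \<Rightarrow> real" and h :: "real \<Rightarrow> real"
  assumes ergodic: "ergodic_with Px X \<mu>"
    and K_pos: "0 < K x"
    and K_bdd: "compact C \<Longrightarrow> bounded (K ` C)"
    and h_meas: "h \<in> borel_measurable borel"
    and h_nonneg: "0 \<le> t \<Longrightarrow> 0 \<le> h t"
    and h_int: "(\<integral>\<^sup>+ t\<in>{0..}. ennreal (h t) \<partial>lborel) < \<infinity>"
    and D1: "0 \<le> t \<Longrightarrow> tv_dist (transition Px X t x) \<mu> < K x * h t"
begin

lemma mu: "prob_space \<mu>" "sets \<mu> = sets borel" "space \<mu> = UNIV"
  using ergodic sets_eq_imp_space_eq[of \<mu> borel] unfolding ergodic_with_def by auto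

lemma mu_measurable [simp]: "measurable \<mu> N = measurable borel N"
  by (rule measurable_cong_sets[OF mu(2) refl])

lemma mu_integrable: "bounded_by \<phi> c \<Longrightarrow> integrable \<mu> \<phi>"
  using prob_space.finite_measure[OF mu(1)] bounded_byD[of \<phi> c]
  by (intro finite_measure.integrable_const_bound[of _ _ c]) auto

lemma tv_P_abs:
  assumes \<phi>: "bounded_by \<phi> c" and t: "0 \<le> t"
  shows "\<bar>P t \<phi> x - (\<integral>y. \<phi> y \<partial>\<mu>)\<bar> \<le> 2 * c * tv_dist (transition Px X t x) \<mu>"
proof -
  have m: "X t \<in> measurable (Px x) borel" using X_M[OF t] by simp
  have ps: "prob_space (transition Px X t x)" unfolding transition_def
    by (rule prob_space.prob_space_distr[OF Px(1) m])
  have "(\<integral>y. \<phi> y \<partial>transition Px X t x) = P t \<phi> x"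
    unfolding transition_def semigroup_def by (rule integral_distr[OF m bounded_byD(1)[OF \<phi>]])
  moreover have "\<bar>(\<integral>y. \<phi> y \<partial>transition Px X t x) - (\<integral>y. \<phi> y \<partial>\<mu>)\<bar> \<le> 2 * c * tv_dist (transition Px X t x) \<mu>"
    by (rule tv_dist_integral[OF ps mu(1)]) (use bounded_byD[OF \<phi>] in \<open>auto simp: transition_def mu\<close>)
  ultimately show ?thesis by simp
qed

lemma tv_P:
  assumes \<phi>: "bounded_by \<phi> c" and t: "0 \<le> t"
  shows "\<bar>P t \<phi> x - (\<integral>y. \<phi> y \<partial>\<mu>)\<bar> \<le> 2 * c * (K x * h t)"
  using order_trans[OF tv_P_abs[OF assms] mult_left_mono[OF less_imp_le[OF D1[OF t]]]] bounded_byD(5)[OF \<phi>] by simp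

lemma P_tendsto_mu:
  assumes \<phi>: "bounded_by \<phi> c" shows "((\<lambda>t. P t \<phi> x) \<longlongrightarrow> (\<integral>y. \<phi> y \<partial>\<mu>)) at_top"
proof -
  have "((\<lambda>t. 2 * c * tv_dist (transition Px X t x) \<mu>) \<longlongrightarrow> 2 * c * 0) at_top"
    using ergodic unfolding ergodic_with_def by (intro tendsto_intros) blast
  then have lim: "((\<lambda>t. 2 * c * tv_dist (transition Px X t x) \<mu>) \<longlongrightarrow> 0) at_top" by simp
  have "\<forall>\<^sub>F t in at_top. norm (P t \<phi> x - (\<integral>y. \<phi> y \<partial>\<mu>)) \<le> 2 * c * tv_dist (transition Px X t x) \<mu>"
    using eventually_ge_at_top[of 0]
  proof eventually_elim
    case (elim t) then show ?case using tv_P_abs[OF \<phi>, of t x] by simp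
  qed
  from LIM_zero_cancel[OF Lim_null_comparison[OF this lim]] show ?thesis .
qed

text \<open>Letting t tend to infinity, \<open>P (t + u) \<phi>\<close> at a fixed point tends to
  the mean of \<open>\<phi>\<close>, while the same quantity, read as
  \<open>P t (P u \<phi>)\<close>, tends to the mean of \<open>P u \<phi>\<close>.\<close>

lemma invariant:
  assumes \<phi>: "bounded_by \<phi> c" and u: "0 \<le> u"
  shows "(\<integral>y. P u \<phi> y \<partial>\<mu>) = (\<integral>y. \<phi> y \<partial>\<mu>)"
proof (rule tendsto_unique)
  show "((\<lambda>t. P (t + u) \<phi> undefined) \<longlongrightarrow> (\<integral>y. \<phi> y \<partial>\<mu>)) at_top"
    by (rule filterlim_compose[OF P_tendsto_mu[OF \<phi>]])
       (rule filterlim_tendsto_add_at_top[OF tendsto_const filterlim_ident, of u, simplified add.commute])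
  show "((\<lambda>t. P (t + u) \<phi> undefined) \<longlongrightarrow> (\<integral>y. P u \<phi> y \<partial>\<mu>)) at_top"
  proof (rule Lim_transform_eventually[OF P_tendsto_mu[OF P_bounded_by[OF \<phi> u]]])
    show "\<forall>\<^sub>F t in at_top. P t (P u \<phi>) undefined = P (t + u) \<phi> undefined"
      using eventually_ge_at_top[of 0] by eventually_elim (rule P_semigroup[OF \<phi> u])
  qed
qed simp

section \<open>Integrability of the convergence rate\<close>

definition tail :: "real \<Rightarrow> real" where "tail a = (LINT s:{a..}|lborel. h s)"

lemma h_integrable: assumes a: "0 \<le> a" shows "set_integrable lborel {a..} h"
proof -
  have "set_integrable lborel {0..} h"
    unfolding set_integrable_def
  proof (rule integrableI_nonneg)
    show "AE x in lborel. 0 \<le> indicator {0..} x *\<^sub>R h x" using h_nonneg by (auto simp: indicator_def)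
    have "(\<integral>\<^sup>+ x. ennreal (indicator {0..} x *\<^sub>R h x) \<partial>lborel) = (\<integral>\<^sup>+ t\<in>{0..}. ennreal (h t) \<partial>lborel)"
      by (rule nn_integral_cong) (auto simp: indicator_def)
    then show "(\<integral>\<^sup>+ x. ennreal (indicator {0..} x *\<^sub>R h x) \<partial>lborel) < \<infinity>" using h_int by simp
  qed (use h_meas in simp)
  then show ?thesis by (rule set_integrable_subset) (use a in auto)
qed

lemma tail_nonneg: "0 \<le> a \<Longrightarrow> 0 \<le> tail a"
  unfolding tail_def set_lebesgue_integral_def
  by (rule Bochner_Integration.integral_nonneg) (use h_nonneg in \<open>auto simp: indicator_def\<close>)

lemma tail_tendsto: "(tail \<longlongrightarrow> 0) at_top"
proof -
  have eq: "tail a = tail 0 - (LINT s:{0..a}|lborel. h s)" if "0 \<le> a" for a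
  proof -
    have "(LINT s:{0..}|lborel. h s) = (LINT s:{0..a}|lborel. h s) + (LINT s:{a<..}|lborel. h s)"
    proof -
      have e: "{0..} = {0..a} \<union> {a<..}" using that by auto
      show ?thesis unfolding e
        by (rule set_integral_Un) (use that in \<open>auto intro!: set_integrable_subset[OF h_integrable[OF order_refl]]\<close>)
    qed
    moreover have "(LINT s:{a<..}|lborel. h s) = tail a"
      unfolding tail_def set_lebesgue_integral_def
    proof (rule integral_cong_AE)
      show "AE s in lborel. indicat_real {a<..} s *\<^sub>R h s = indicat_real {a..} s *\<^sub>R h s"
        using AE_lborel_singleton[of a] by eventually_elim (auto simp: indicator_def)
    qed (use h_meas in auto)
    ultimately show ?thesis by (simp add: tail_def)
  qed
  have "((\<lambda>a. LINT s:{0..a}|lborel. h s) \<longlongrightarrow> tail 0) at_top"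
    unfolding tail_def by (rule tendsto_set_lebesgue_integral_at_top) (use h_integrable[of 0] in auto)
  then have "((\<lambda>a. tail 0 - (LINT s:{0..a}|lborel. h s)) \<longlongrightarrow> tail 0 - tail 0) at_top"
    by (intro tendsto_intros)
  then have "((\<lambda>a. tail 0 - (LINT s:{0..a}|lborel. h s)) \<longlongrightarrow> 0) at_top" by simp
  then show ?thesis
  proof (rule Lim_transform_eventually)
    show "\<forall>\<^sub>F a in at_top. tail 0 - (LINT s:{0..a}|lborel. h s) = tail a"
      using eventually_ge_at_top[of 0] by eventually_elim (rule eq[symmetric])
  qed
qed

text \<open>An integrable rate need not tend to zero, but it cannot stay above a positive level from
  some time on. Hence suitable late times exist, though not every late time is suitable.\<close>

lemma h_small:
  assumes "0 < d" shows "\<exists>t\<ge>a. h t < d"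
proof (rule ccontr)
  assume "\<not> ?thesis"
  then have ge: "d \<le> h t" if "a \<le> t" for t using that by force
  define b where "b = max a 0"
  obtain r where r: "(\<integral>\<^sup>+ t\<in>{0..}. ennreal (h t) \<partial>lborel) = ennreal r" "0 \<le> r"
    using h_int by (cases "\<integral>\<^sup>+ t\<in>{0..}. ennreal (h t) \<partial>lborel") auto
  obtain n where n: "r / d < real n" using reals_Archimedean2 by blast
  have "(\<integral>\<^sup>+ t\<in>{b..b + n}. ennreal d \<partial>lborel) \<le> (\<integral>\<^sup>+ t\<in>{0..}. ennreal (h t) \<partial>lborel)"
    by (rule nn_integral_mono) (use ge in \<open>auto simp: b_def indicator_def intro: ennreal_leI\<close>)
  moreover have "(\<integral>\<^sup>+ t\<in>{b..b + n}. ennreal d \<partial>lborel) = ennreal (d * n)"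
    using assms by (simp add: nn_integral_cmult_indicator emeasure_lborel_Icc_eq ennreal_mult' ennreal_of_nat_eq_real_of_nat)
  ultimately have "d * n \<le> r" using r assms by (simp add: ennreal_le_iff)
  then show False using n assms by (simp add: field_simps)
qed

lemma P_set_integrable:
  assumes \<phi>: "bounded_by \<phi> c" and a: "0 \<le> a"
  shows "set_integrable lborel {a..b} (\<lambda>s. P s \<phi> y)"
proof -
  have "set_integrable lborel {a..b} (\<lambda>s. P (max 0 s) \<phi> y)"
    by (rule set_integral_bounded[OF P_measurable[OF \<phi>], where c = c])
       (use bounded_byD(2)[OF P_bounded_by[OF \<phi>]] in auto)
  also have "?this \<longleftrightarrow> ?thesis" using a by (intro set_integrable_cong) auto
  finally show ?thesis .
qed

lemma pot_affine:
  assumes \<phi>: "bounded_by \<phi> c" and S: "0 \<le> S"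
  shows "pot (\<lambda>y. a * \<phi> y + b) S x = a * pot \<phi> S x + b * S"
proof -
  have "P s (\<lambda>y. a * \<phi> y + b) x = a * P s \<phi> x + b" if "0 \<le> s" for s
  proof -
    have "bounded_by (\<lambda>y. a * \<phi> y) (\<bar>a\<bar> * c)" "bounded_by (\<lambda>y. b) \<bar>b\<bar>"
      using \<phi> by (auto simp: bounded_by_def abs_mult intro!: mult_left_mono)
    from P_add[OF this that, of x] show ?thesis by (simp add: P_cmult P_const)
  qed
  then have "pot (\<lambda>y. a * \<phi> y + b) S x = (LINT s:{0..S}|lborel. a * P s \<phi> x + b)"
    unfolding pot_def by (intro set_lebesgue_integral_cong) auto
  also have "\<dots> = (LINT s:{0..S}|lborel. a * P s \<phi> x) + (LINT s:{0..S}|lborel. b)"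
  proof (rule set_integral_add)
    show "set_integrable lborel {0..S} (\<lambda>s. a * P s \<phi> x)"
      using P_set_integrable[OF \<phi> order_refl] by (intro set_integrable_mult_right) auto
    show "set_integrable lborel {0..S} (\<lambda>s. b)" by (rule set_integral_bounded[of _ _ _ "\<bar>b\<bar>"]) auto
  qed
  also have "(LINT s:{0..S}|lborel. b) = b * S" using S by (simp add: set_lebesgue_integral_def)
  finally show ?thesis by (simp add: pot_def)
qed

lemma pot_mono:
  assumes "bounded_by \<phi> c" "bounded_by \<psi> d" "\<And>y. \<phi> y \<le> \<psi> y"
  shows "pot \<phi> S x \<le> pot \<psi> S x"
  unfolding pot_def
  by (rule set_integral_mono[OF P_set_integrable[OF assms(1)] P_set_integrable[OF assms(2)]])
     (use P_mono[OF assms(1,2) _ assms(3)] in auto)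

text \<open>The left-hand side is the integral of \<open>P s \<psi>\<close> over s from a to a + S,
  and \<open>\<psi>\<close> has mean zero, so the integrand is at most 2c K(x) h(s). It matters that
  the bound does not involve S.\<close>

lemma pot_increment_bound:
  assumes \<psi>: "bounded_by \<psi> c" "(\<integral>y. \<psi> y \<partial>\<mu>) = 0" and a: "0 \<le> a" and S: "0 \<le> S"
  shows "\<bar>P a (pot \<psi> S) x\<bar> \<le> 2 * c * K x * tail a"
proof -
  have c: "0 \<le> c" using bounded_byD(5)[OF \<psi>(1)] .
  note i = P_set_integrable[OF \<psi>(1) a, of "a + S" x]
  have ic: "set_integrable lborel {a..} (\<lambda>s. 2 * c * K x * h s)"
    using h_integrable[OF a] by (intro set_integrable_mult_right) auto
  have "P a (pot \<psi> S) x = pot \<psi> (a + S) x - pot \<psi> a x" using pot_diff[OF \<psi>(1) S a] by simp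
  also have "pot \<psi> (a + S) x = pot \<psi> a x + (LINT s:{a<..a+S}|lborel. P s \<psi> x)"
  proof -
    have e: "{0..a + S} = {0..a} \<union> {a<..a + S}" using a S by auto
    show ?thesis unfolding pot_def e
      by (rule set_integral_Un[OF _ P_set_integrable[OF \<psi>(1) order_refl] set_integrable_subset[OF i]]) auto
  qed
  also have "pot \<psi> a x + (LINT s:{a<..a+S}|lborel. P s \<psi> x) - pot \<psi> a x = (LINT s:{a<..a+S}|lborel. P s \<psi> x)" by simp
  also have "\<bar>\<dots>\<bar> \<le> (LINT s:{a..}|lborel. 2 * c * K x * h s)"
  proof -
    have i': "set_integrable lborel {a<..a+S} (\<lambda>s. P s \<psi> x)" by (rule set_integrable_subset[OF i]) auto
    have "\<bar>LINT s:{a<..a+S}|lborel. P s \<psi> x\<bar> \<le> (LINT s:{a<..a+S}|lborel. \<bar>P s \<psi> x\<bar>)"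
      using set_integral_norm_bound[OF i'] by simp
    also have "\<dots> \<le> (LINT s:{a..}|lborel. 2 * c * K x * h s)"
      unfolding set_lebesgue_integral_def
    proof (rule integral_mono)
      show "integrable lborel (\<lambda>s. indicat_real {a<..a + S} s *\<^sub>R \<bar>P s \<psi> x\<bar>)"
        using set_integrable_abs[OF i'] unfolding set_integrable_def .
      show "integrable lborel (\<lambda>s. indicat_real {a..} s *\<^sub>R (2 * c * K x * h s))"
        using ic unfolding set_integrable_def .
      show "indicat_real {a<..a + S} s *\<^sub>R \<bar>P s \<psi> x\<bar> \<le> indicat_real {a..} s *\<^sub>R (2 * c * K x * h s)" for s
        using tv_P[OF \<psi>(1), of s x] \<psi>(2) a h_nonneg[of s] c K_pos[of x]
        by (auto simp: indicator_def mult.assoc)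
    qed
    finally show ?thesis .
  qed
  also have "\<dots> = 2 * c * K x * tail a" by (simp add: tail_def)
  finally show ?thesis .
qed

lemma pot_bound:
  assumes "bounded_by \<psi> c" "(\<integral>y. \<psi> y \<partial>\<mu>) = 0" "0 \<le> S"
  shows "\<bar>pot \<psi> S x\<bar> \<le> 2 * c * K x * tail 0"
  using pot_increment_bound[OF assms(1,2) order_refl assms(3), of x] P_0[OF pot_bounded_by[OF assms(1,3)]] by simp

definition total_pot :: "('e \<Rightarrow> real) \<Rightarrow> 'e \<Rightarrow> real" where
  "total_pot \<psi> y = (LINT s:{0..}|lborel. P s \<psi> y)"

lemma pot_tendsto_total:
  assumes \<psi>: "bounded_by \<psi> c" "(\<integral>y. \<psi> y \<partial>\<mu>) = 0" and t: "filterlim t at_top sequentially"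
  shows "(\<lambda>n. pot \<psi> (t n) y) \<longlonglongrightarrow> total_pot \<psi> y"
  unfolding pot_def total_pot_def set_lebesgue_integral_def
proof (rule integral_dominated_convergence[where w = "\<lambda>s. indicator {0..} s *\<^sub>R (2 * c * K y * h s)"])
  have c: "0 \<le> c" using bounded_byD(5)[OF \<psi>(1)] .
  have m: "(\<lambda>s. P (max 0 s) \<psi> y) \<in> borel_measurable borel" by (rule P_measurable[OF \<psi>(1)]) auto
  have "(\<lambda>s. indicator A s *\<^sub>R P s \<psi> y) \<in> borel_measurable borel" if "A \<subseteq> {0..}" "A \<in> sets borel" for A
  proof -
    have "(\<lambda>s. indicator A s *\<^sub>R P (max 0 s) \<psi> y) = (\<lambda>s. indicator A s *\<^sub>R P s \<psi> y)"
      using that by (force simp: indicator_def)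
    moreover have "(\<lambda>s. indicator A s *\<^sub>R P (max 0 s) \<psi> y) \<in> borel_measurable borel"
      using m that by simp
    ultimately show ?thesis by simp
  qed
  then show "(\<lambda>s. indicator {0..} s *\<^sub>R P s \<psi> y) \<in> borel_measurable lborel"
    "(\<lambda>s. indicator {0..t n} s *\<^sub>R P s \<psi> y) \<in> borel_measurable lborel" for n by auto
  show "integrable lborel (\<lambda>s. indicator {0..} s *\<^sub>R (2 * c * K y * h s))"
    using set_integrable_mult_right[of "2 * c * K y" lborel "{0..}" h] h_integrable[of 0]
    unfolding set_integrable_def by (simp add: mult_ac)
  show "AE s in lborel. norm (indicator {0..t n} s *\<^sub>R P s \<psi> y) \<le> indicator {0..} s *\<^sub>R (2 * c * K y * h s)" for n
    using tv_P[OF \<psi>(1), of _ y] \<psi>(2) h_nonneg c K_pos[of y] by (auto simp: indicator_def mult.assoc)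
  show "AE s in lborel. (\<lambda>n. indicator {0..t n} s *\<^sub>R P s \<psi> y) \<longlonglongrightarrow> indicator {0..} s *\<^sub>R P s \<psi> y"
  proof (rule AE_I2)
    fix s
    have "\<forall>\<^sub>F n in sequentially. s \<le> t n" using t by (simp add: filterlim_at_top)
    then have "\<forall>\<^sub>F n in sequentially. indicator {0..t n} s *\<^sub>R P s \<psi> y = indicator {0..} s *\<^sub>R P s \<psi> y"
      by eventually_elim (auto simp: indicator_def)
    then show "(\<lambda>n. indicator {0..t n} s *\<^sub>R P s \<psi> y) \<longlonglongrightarrow> indicator {0..} s *\<^sub>R P s \<psi> y"
      by (rule tendsto_eventually)
  qed
qed

lemma pot_mu:
  assumes \<psi>: "bounded_by \<psi> c" "(\<integral>y. \<psi> y \<partial>\<mu>) = 0"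
  shows "(\<integral>y. pot \<psi> S y \<partial>\<mu>) = 0"
proof -
  have m: "(\<lambda>p. P (max 0 (fst p)) \<psi> (snd p)) \<in> borel_measurable (lborel \<Otimes>\<^sub>M \<mu>)"
    by (rule P_measurable[OF \<psi>(1)]) (auto simp: measurable_cong_sets[OF sets_pair_measure_cong[OF refl mu(2)] refl])
  have "(\<integral>y. (LINT s:{0..S}|lborel. P (max 0 s) \<psi> y) \<partial>\<mu>) = (LINT s:{0..S}|lborel. \<integral>y. P (max 0 s) \<psi> y \<partial>\<mu>)"
    using fubini_bounded(1)[OF mu(1) m, of c] bounded_byD(2)[OF P_bounded_by[OF \<psi>(1)]] by simp
  also have "\<dots> = 0" using invariant[OF \<psi>(1)] \<psi>(2) by simp
  also have "(\<integral>y. (LINT s:{0..S}|lborel. P (max 0 s) \<psi> y) \<partial>\<mu>) = (\<integral>y. pot \<psi> S y \<partial>\<mu>)"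
    unfolding pot_def by (intro Bochner_Integration.integral_cong refl set_lebesgue_integral_cong) auto
  finally show ?thesis .
qed

end

section \<open>Uniform integrability of the potential\<close>

context ergodic_process begin

text \<open>The potential of a centred function that is bounded below is uniformly integrable along the process:
  its mean converges to its \<open>\<mu>\<close>-mean, and so do the means of its truncations.\<close>

context
  fixes \<psi> :: "'e \<Rightarrow> real" and c c1 :: real
  assumes \<psi>: "bounded_by \<psi> c" "(\<integral>y. \<psi> y \<partial>\<mu>) = 0"
    and c1: "0 \<le> c1"
    and low: "0 \<le> s \<Longrightarrow> - c1 \<le> pot \<psi> s y"
begin

text \<open>Shifting by the lower bound gives a nonnegative function, ready for Fatou's lemma and
  for truncation from above.\<close>

definition shifted_pot :: "'e \<Rightarrow> real" where "shifted_pot y = total_pot \<psi> y + c1"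

lemma pot_nat_tendsto: "(\<lambda>n. pot \<psi> (real n) y) \<longlonglongrightarrow> total_pot \<psi> y"
  by (rule pot_tendsto_total[OF \<psi> filterlim_real_sequentially])

lemma shifted_pot_measurable: "shifted_pot \<in> borel_measurable borel"
proof -
  have "total_pot \<psi> \<in> borel_measurable borel"
    by (rule borel_measurable_LIMSEQ_real[OF pot_nat_tendsto]) (rule bounded_byD(1)[OF pot_bounded_by[OF \<psi>(1)]], simp)
  then show ?thesis unfolding shifted_pot_def by simp
qed

lemma shifted_pot_nonneg: "0 \<le> shifted_pot y"
  using LIMSEQ_le_const[OF pot_nat_tendsto, of "- c1" y] low unfolding shifted_pot_def by fastforce

text \<open>Extending the time range from S to S + n adds \<open>P S (pot \<psi> (real n))\<close>,
  which is at least -c1. Hence every finite-time potential exceeds the total one by at most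
  c1.\<close>

lemma pot_le_shifted_pot: assumes S: "0 \<le> S" shows "pot \<psi> S y \<le> shifted_pot y"
proof -
  have "filterlim (\<lambda>n. S + real n) at_top sequentially"
    by (rule filterlim_tendsto_add_at_top[OF tendsto_const filterlim_real_sequentially])
  from pot_tendsto_total[OF \<psi> this, of y]
  have "pot \<psi> S y - c1 \<le> total_pot \<psi> y"
  proof (rule LIMSEQ_le_const, intro exI allI impI)
    fix n :: nat
    have "bounded_by (\<lambda>_::'e. - c1) c1" using c1 by (auto simp: bounded_by_def)
    from P_mono[OF this pot_bounded_by[OF \<psi>(1)] S low, of "real n" y]
    show "pot \<psi> S y - c1 \<le> pot \<psi> (S + real n) y"
      using pot_diff[OF \<psi>(1) _ S, of "real n" y] by (simp add: P_const)
  qed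
  then show ?thesis by (simp add: shifted_pot_def)
qed

text \<open>Fatou's lemma in n, using that the mean of \<open>pot \<psi> (real n)\<close> at time t
  is an integral of the semigroup from t on. The excess over c1 is governed by \<open>tail t\<close>
  and so vanishes as t grows.\<close>

lemma shifted_pot_mean:
  assumes t: "0 \<le> t"
  shows "(\<integral>\<^sup>+w. ennreal (shifted_pot (X t w)) \<partial>Px x) \<le> ennreal (c1 + 2 * c * K x * tail t)"
proof -
  interpret prob_space "Px x" by (rule Px)
  have m: "(\<lambda>w. ennreal (pot \<psi> (real n) (X t w) + c1)) \<in> borel_measurable (Px x)" for n
    using measurable_compose[OF X_M[OF t] bounded_byD(1)[OF pot_bounded_by[OF \<psi>(1), of "real n"]]] by simp
  have lim: "(\<lambda>n. ennreal (pot \<psi> (real n) y + c1)) \<longlonglongrightarrow> ennreal (shifted_pot y)" for y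
    unfolding shifted_pot_def by (intro tendsto_ennrealI tendsto_intros pot_nat_tendsto)
  have "(\<integral>\<^sup>+w. ennreal (shifted_pot (X t w)) \<partial>Px x) = (\<integral>\<^sup>+w. liminf (\<lambda>n. ennreal (pot \<psi> (real n) (X t w) + c1)) \<partial>Px x)"
    using lim_imp_Liminf[OF sequentially_bot lim] by simp
  also have "\<dots> \<le> liminf (\<lambda>n. \<integral>\<^sup>+w. ennreal (pot \<psi> (real n) (X t w) + c1) \<partial>Px x)"
    by (rule nn_integral_liminf[OF m])
  also have "\<dots> \<le> liminf (\<lambda>n. ennreal (c1 + 2 * c * K x * tail t))"
  proof (rule Liminf_mono, rule always_eventually, rule allI)
    fix n
    have i: "integrable (Px x) (\<lambda>w. pot \<psi> (real n) (X t w))" by (rule X_integrable[OF pot_bounded_by[OF \<psi>(1)] t]) simp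
    have "(\<integral>\<^sup>+w. ennreal (pot \<psi> (real n) (X t w) + c1) \<partial>Px x) = ennreal (E x (\<lambda>w. pot \<psi> (real n) (X t w) + c1))"
    proof (rule nn_integral_eq_integral)
      show "AE w in Px x. 0 \<le> pot \<psi> (real n) (X t w) + c1"
      proof (rule AE_I2)
        fix w show "0 \<le> pot \<psi> (real n) (X t w) + c1" using low[of "real n" "X t w"] by simp
      qed
    qed (use i in simp)
    also have "E x (\<lambda>w. pot \<psi> (real n) (X t w) + c1) = P t (pot \<psi> (real n)) x + c1"
      using i by (simp add: semigroup_def prob_space)
    also have "P t (pot \<psi> (real n)) x \<le> 2 * c * K x * tail t"
      using pot_increment_bound[OF \<psi> t, of "real n" x] by simp
    finally show "(\<integral>\<^sup>+w. ennreal (pot \<psi> (real n) (X t w) + c1) \<partial>Px x) \<le> ennreal (c1 + 2 * c * K x * tail t)"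
      by (simp add: ennreal_leI add.commute)
  qed
  also have "\<dots> = ennreal (c1 + 2 * c * K x * tail t)" by (simp add: Liminf_const)
  finally show ?thesis .
qed

lemma shifted_pot_integrable:
  assumes t: "0 \<le> t" shows "integrable (Px x) (\<lambda>w. shifted_pot (X t w))"
  by (rule integrableI_nonneg)
     (use shifted_pot_mean[OF t, of x] measurable_compose[OF X_M[OF t] shifted_pot_measurable] shifted_pot_nonneg
       in \<open>auto intro: order_le_less_trans\<close>)

lemma shifted_pot_integral_le:
  assumes t: "0 \<le> t" shows "E x (\<lambda>w. shifted_pot (X t w)) \<le> c1 + 2 * c * K x * tail t"
proof -
  have "0 \<le> c1 + 2 * c * K x * tail t"
    using c1 bounded_byD(5)[OF \<psi>(1)] K_pos[of x] tail_nonneg[OF t] by simp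
  moreover have "ennreal (E x (\<lambda>w. shifted_pot (X t w))) \<le> ennreal (c1 + 2 * c * K x * tail t)"
    using shifted_pot_mean[OF t, of x] nn_integral_eq_integral[OF shifted_pot_integrable[OF t, of x]] shifted_pot_nonneg by simp
  ultimately show ?thesis by (simp add: ennreal_le_iff)
qed

lemma truncated_bounded_by: "0 \<le> R \<Longrightarrow> bounded_by (\<lambda>y. min (shifted_pot y) R) R"
  by (rule bounded_byI) (use shifted_pot_measurable shifted_pot_nonneg in \<open>auto simp: abs_of_nonneg\<close>)

text \<open>The truncation is bounded, so its mean under the process converges to its mean under the
  invariant law, while it stays below a bound tending to c1.\<close>

lemma truncated_mu_le: assumes R: "0 \<le> R" shows "(\<integral>y. min (shifted_pot y) R \<partial>\<mu>) \<le> c1"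
proof (rule tendsto_le[OF trivial_limit_at_top_linorder _ P_tendsto_mu[OF truncated_bounded_by[OF R]]])
  fix x :: 'e
  have "((\<lambda>t. c1 + 2 * c * K x * tail t) \<longlongrightarrow> c1 + 2 * c * K x * 0) at_top"
    by (intro tendsto_intros tail_tendsto)
  then show "((\<lambda>t. c1 + 2 * c * K x * tail t) \<longlongrightarrow> c1) at_top" by simp
  show "\<forall>\<^sub>F t in at_top. P t (\<lambda>y. min (shifted_pot y) R) x \<le> c1 + 2 * c * K x * tail t"
    using eventually_ge_at_top[of 0]
  proof eventually_elim
    case (elim t)
    have "P t (\<lambda>y. min (shifted_pot y) R) x \<le> E x (\<lambda>w. shifted_pot (X t w))"
      unfolding semigroup_def
      by (rule integral_mono[OF X_integrable[OF truncated_bounded_by[OF R] elim] shifted_pot_integrable[OF elim]]) simp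
    also note shifted_pot_integral_le[OF elim]
    finally show ?case .
  qed
qed

text \<open>Integrability follows from the truncations by Fatou's lemma. The exact mean is decisive:
  it equals the limiting upper bound c1 for the means along the process, so in the limit nothing is
  left for mass at high values of the potential.\<close>

lemma shifted_pot_mu: "integrable \<mu> shifted_pot" "(\<integral>y. shifted_pot y \<partial>\<mu>) = c1"
proof -
  interpret prob_space \<mu> by (rule mu)
  have lim: "(\<lambda>n. min (shifted_pot y) (real n)) \<longlonglongrightarrow> shifted_pot y" for y
  proof (rule tendsto_eventually)
    obtain N where "shifted_pot y \<le> real N" using real_arch_simple by blast
    then show "\<forall>\<^sub>F n in sequentially. min (shifted_pot y) (real n) = shifted_pot y"
      by (auto simp: eventually_sequentially intro!: exI[of _ N])
  qed
  show int: "integrable \<mu> shifted_pot"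
  proof (rule integrableI_nonneg)
    have "(\<integral>\<^sup>+y. ennreal (shifted_pot y) \<partial>\<mu>) = (\<integral>\<^sup>+y. liminf (\<lambda>n. ennreal (min (shifted_pot y) (real n))) \<partial>\<mu>)"
      using lim_imp_Liminf[OF sequentially_bot tendsto_ennrealI[OF lim]] by simp
    also have "\<dots> \<le> liminf (\<lambda>n. \<integral>\<^sup>+y. ennreal (min (shifted_pot y) (real n)) \<partial>\<mu>)"
      by (rule nn_integral_liminf) (use shifted_pot_measurable in simp)
    also have "\<dots> \<le> liminf (\<lambda>n::nat. ennreal c1)"
    proof (rule Liminf_mono, rule always_eventually, rule allI)
      fix n :: nat
      have "(\<integral>\<^sup>+y. ennreal (min (shifted_pot y) (real n)) \<partial>\<mu>) = ennreal (\<integral>y. min (shifted_pot y) (real n) \<partial>\<mu>)"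
        by (rule nn_integral_eq_integral[OF mu_integrable[OF truncated_bounded_by]]) (use shifted_pot_nonneg in auto)
      then show "(\<integral>\<^sup>+y. ennreal (min (shifted_pot y) (real n)) \<partial>\<mu>) \<le> ennreal c1"
        using truncated_mu_le[of "real n"] by (simp add: ennreal_leI)
    qed
    also have "\<dots> = ennreal c1" by (simp add: Liminf_const)
    finally show "(\<integral>\<^sup>+y. ennreal (shifted_pot y) \<partial>\<mu>) < \<infinity>" by (rule order_le_less_trans) simp
  qed (use shifted_pot_measurable shifted_pot_nonneg in auto)
  have "(\<lambda>n. \<integral>y. pot \<psi> (real n) y \<partial>\<mu>) \<longlonglongrightarrow> (\<integral>y. total_pot \<psi> y \<partial>\<mu>)"
  \<comment> \<open>All finite-time potentials lie between -c1 and the shifted potential, so this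
    sum dominates them. Their means under the invariant law vanish because \<open>\<psi>\<close> is
    centred.\<close>
  proof (rule integral_dominated_convergence[where w = "\<lambda>y. shifted_pot y + c1"])
    show "total_pot \<psi> \<in> borel_measurable \<mu>" "pot \<psi> (real n) \<in> borel_measurable \<mu>" for n
      using borel_measurable_diff[OF shifted_pot_measurable borel_measurable_const[of c1]]
        bounded_byD(1)[OF pot_bounded_by[OF \<psi>(1), of "real n"]] by (auto simp: shifted_pot_def)
    show "AE y in \<mu>. norm (pot \<psi> (real n) y) \<le> shifted_pot y + c1" for n
    proof (rule AE_I2)
      fix y show "norm (pot \<psi> (real n) y) \<le> shifted_pot y + c1"
        using pot_le_shifted_pot[of "real n" y] low[of "real n" y] shifted_pot_nonneg[of y] c1 by (simp add: abs_le_iff)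
    qed
  qed (use int pot_nat_tendsto in auto)
  then have "(\<integral>y. total_pot \<psi> y \<partial>\<mu>) = 0" by (simp add: pot_mu[OF \<psi>] LIMSEQ_const_iff)
  moreover have "integrable \<mu> (total_pot \<psi>)"
    using Bochner_Integration.integrable_diff[OF int, of "\<lambda>_. c1"] by (simp add: shifted_pot_def)
  ultimately show "(\<integral>y. shifted_pot y \<partial>\<mu>) = c1" by (simp add: shifted_pot_def prob_space)
qed

lemma truncated_mu_tendsto: "(\<lambda>n. \<integral>y. min (shifted_pot y) (real n) \<partial>\<mu>) \<longlonglongrightarrow> c1"
proof -
  have "(\<lambda>n. \<integral>y. min (shifted_pot y) (real n) \<partial>\<mu>) \<longlonglongrightarrow> (\<integral>y. shifted_pot y \<partial>\<mu>)"
  proof (rule integral_dominated_convergence[OF _ _ shifted_pot_mu(1)])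
    show "AE y in \<mu>. (\<lambda>n. min (shifted_pot y) (real n)) \<longlonglongrightarrow> shifted_pot y"
    proof (rule AE_I2, rule tendsto_eventually)
      fix y
      obtain N where "shifted_pot y \<le> real N" using real_arch_simple by blast
      then show "\<forall>\<^sub>F n in sequentially. min (shifted_pot y) (real n) = shifted_pot y"
        by (auto simp: eventually_sequentially intro!: exI[of _ N])
    qed
    show "AE y in \<mu>. norm (min (shifted_pot y) (real n)) \<le> shifted_pot y" for n
    proof (rule AE_I2)
      fix y show "norm (min (shifted_pot y) (real n)) \<le> shifted_pot y"
        using shifted_pot_nonneg[of y] by simp
    qed
  qed (use shifted_pot_measurable in auto)
  then show ?thesis unfolding shifted_pot_mu(2) .
qed

text \<open>The potential is split at a level R. Its excess over R has mean equal to the full mean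
  minus the truncated mean; the former is at most c1 + e/4 and the latter at least c1 - e/2, so the
  excess contributes at most 3e/4. The part below R is bounded and contributes at most e/4 on an
  event as rare as B.\<close>

lemma late_pot_small:
  assumes L: "\<And>x. x \<in> L \<Longrightarrow> K x \<le> k" and C: "0 \<le> C" and c2: "0 \<le> c2" and e: "0 < e"
  shows "\<exists>T>0. \<forall>x\<in>L. \<forall>B\<in>sets M. \<forall>S\<ge>0. measure (Px x) B \<le> C / T \<longrightarrow>
      E x (\<lambda>w. indicator B w * (pot \<psi> S (X T w) + c2)) \<le> e"
proof -
  have c: "0 \<le> c" using bounded_byD(5)[OF \<psi>(1)] .
  have "\<forall>\<^sub>F n in sequentially. c1 - e / 4 < (\<integral>y. min (shifted_pot y) (real n) \<partial>\<mu>)"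
    by (rule order_tendstoD(1)[OF truncated_mu_tendsto]) (use e in simp)
  then obtain n where n: "c1 - e / 4 < (\<integral>y. min (shifted_pot y) (real n) \<partial>\<mu>)"
    using eventually_happens'[OF sequentially_bot] by blast
  \<comment> \<open>The level is fixed before the time: it is determined by the invariant law alone
    and then enters the requirements on T.\<close>
  define R where "R = real n"
  have R: "0 \<le> R" "c1 - e / 4 < (\<integral>y. min (shifted_pot y) R \<partial>\<mu>)" using n by (auto simp: R_def)
  define k' where "k' = \<bar>k\<bar>"
  have k': "0 \<le> k'" "\<And>x. x \<in> L \<Longrightarrow> K x \<le> k'" using L by (force simp: k'_def)+
  have "((\<lambda>t. 2 * c * k' * tail t) \<longlongrightarrow> 2 * c * k' * 0) at_top" by (intro tendsto_intros tail_tendsto)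
  then have ev1: "\<forall>\<^sub>F t in at_top. 2 * c * k' * tail t < e / 4" by (rule order_tendstoD(2)) (use e in simp)
  have "((\<lambda>t. (R + c2) * (C / t)) \<longlongrightarrow> (R + c2) * 0) at_top"
    by (intro tendsto_intros tendsto_divide_0[OF tendsto_const] filterlim_at_top_imp_at_infinity filterlim_ident)
  then have ev2: "\<forall>\<^sub>F t in at_top. (R + c2) * (C / t) < e / 4" by (rule order_tendstoD(2)) (use e in simp)
  from eventually_conj[OF ev1 ev2] obtain a where
    a: "\<And>t. a \<le> t \<Longrightarrow> 2 * c * k' * tail t < e / 4 \<and> (R + c2) * (C / t) < e / 4"
    unfolding eventually_at_top_linorder by blast
  have "0 < 2 * R * k' + 1" using R(1) k'(1) by (intro add_nonneg_pos mult_nonneg_nonneg) auto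
  then have "0 < e / (4 * (2 * R * k' + 1))" using e by simp
  \<comment> \<open>Two of the requirements hold for every t from a on. The third, on
    \<open>h T\<close>, holds only at selected times, so T is picked last.\<close>
  from h_small[OF this, of "max a 1"] obtain T where T: "max a 1 \<le> T" "h T < e / (4 * (2 * R * k' + 1))" by blast
  have T0: "0 < T" "0 \<le> T" "a \<le> T" using T(1) by auto
  have "h T * (4 * (2 * R * k' + 1)) < e" using T(2) \<open>0 < 2 * R * k' + 1\<close> by (subst (asm) pos_less_divide_eq) auto
  then have hT: "2 * R * (k' * h T) \<le> e / 4" using h_nonneg[OF T0(2)] by (simp add: algebra_simps)
  show ?thesis
  proof (intro exI conjI ballI allI impI)
    show "0 < T" by (rule T0)
    fix x B S assume x: "x \<in> L" and B: "B \<in> sets M" and S: "(0::real) \<le> S" and small: "measure (Px x) B \<le> C / T"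
    interpret prob_space "Px x" by (rule Px)
    note ip = shifted_pot_integrable[OF T0(2), of x]
    note it = X_integrable[OF truncated_bounded_by[OF R(1)] T0(2), of x]
    have iB: "integrable (Px x) (indicator B :: 'w \<Rightarrow> real)"
      by (rule bounded_integrable[of _ 1]) (use B in \<open>auto simp: indicator_def\<close>)
    have "E x (\<lambda>w. indicator B w * (pot \<psi> S (X T w) + c2))
        \<le> E x (\<lambda>w. (shifted_pot (X T w) - min (shifted_pot (X T w)) R) + indicator B w * (R + c2))"
    proof (rule integral_mono)
      show "integrable (Px x) (\<lambda>w. indicator B w * (pot \<psi> S (X T w) + c2))"
        using X_integrable[OF pot_bounded_by[OF \<psi>(1) S] T0(2), of x] B by (intro indicator_integrable) auto
      show "integrable (Px x) (\<lambda>w. (shifted_pot (X T w) - min (shifted_pot (X T w)) R) + indicator B w * (R + c2))"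
        using ip it iB by auto
      fix w
      show "indicator B w * (pot \<psi> S (X T w) + c2) \<le> (shifted_pot (X T w) - min (shifted_pot (X T w)) R) + indicator B w * (R + c2)"
        using pot_le_shifted_pot[OF S, of "X T w"] by (auto simp: indicator_def min_def)
    qed
    also have "\<dots> = E x (\<lambda>w. shifted_pot (X T w)) - E x (\<lambda>w. min (shifted_pot (X T w)) R) + measure (Px x) B * (R + c2)"
      using ip it iB B by (simp add: Px Int_absorb1 sets.sets_into_space)
    finally have 1: "E x (\<lambda>w. indicator B w * (pot \<psi> S (X T w) + c2)) \<le>
        E x (\<lambda>w. shifted_pot (X T w)) - E x (\<lambda>w. min (shifted_pot (X T w)) R) + measure (Px x) B * (R + c2)" .
    have 2: "E x (\<lambda>w. shifted_pot (X T w)) \<le> c1 + e / 4"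
    proof -
      have "2 * c * K x * tail T \<le> 2 * c * k' * tail T"
        using k'(2)[OF x] c tail_nonneg[OF T0(2)] by (intro mult_right_mono mult_left_mono) auto
      with shifted_pot_integral_le[OF T0(2), of x] a[OF T0(3)] show ?thesis by linarith
    qed
    have 3: "E x (\<lambda>w. min (shifted_pot (X T w)) R) \<ge> c1 - e / 4 - e / 4"
    proof -
      have "2 * R * (K x * h T) \<le> 2 * R * (k' * h T)"
        using k'(2)[OF x] R(1) h_nonneg[OF T0(2)] by (intro mult_left_mono mult_right_mono) auto
      with tv_P[OF truncated_bounded_by[OF R(1)] T0(2), of x] R(2) hT
      show ?thesis unfolding semigroup_def by (simp only: abs_le_iff) linarith
    qed
    have 4: "measure (Px x) B * (R + c2) \<le> e / 4"
    proof -
      have "measure (Px x) B * (R + c2) \<le> C / T * (R + c2)" using small R(1) c2 by (intro mult_right_mono) auto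
      then show ?thesis using a[OF T0(3)] by (simp add: mult.commute)
    qed
    from 1 2 3 4 show "E x (\<lambda>w. indicator B w * (pot \<psi> S (X T w) + c2)) \<le> e" by linarith
  qed
qed

text \<open>The integral from a to \<open>\<rho>\<close> is the integral from a to T minus that from
  \<open>\<rho>\<close> to T. The Markov property at a turns the first into a potential at
  \<open>X a\<close>; the strong Markov property at \<open>\<rho>\<close> turns the second into a
  potential at the stopped position, which is at least -c1 wherever that position is.\<close>

lemma drift_bound:
  assumes \<rho>: "stop T \<rho>" and a: "0 \<le> a" "a \<le> T"
  shows "E x (\<lambda>w. indicator {w \<in> space M. a < \<rho> w} w * (cum \<psi> (\<rho> w) w - cum \<psi> a w))
      \<le> E x (\<lambda>w. indicator {w \<in> space M. a < \<rho> w} w * (pot \<psi> (T - a) (X a w) + c1))"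
proof -
  let ?B = "{w \<in> space M. a < \<rho> w}"
  have BM: "?B \<in> sets M" using F(2)[OF a(1) gt_F[OF \<rho> a(1)]] .
  have T: "0 \<le> T" using a by simp
  note i\<rho> = cum_stop_integrable[OF \<rho> \<psi>(1), of x] and ia = cum_stop_integrable[OF stop_const[OF a(1) order_refl] \<psi>(1), of x]
    and iT = cum_stop_integrable[OF stop_const[OF T order_refl] \<psi>(1), of x]
  note j1 = indicator_integrable[OF Bochner_Integration.integrable_diff[OF iT ia] BM]
    and j2 = indicator_integrable[OF Bochner_Integration.integrable_diff[OF iT i\<rho>] BM]
  have b: "bounded_by (pot \<psi> (T - a)) (c * (T - a))" by (rule pot_bounded_by[OF \<psi>(1)]) (use a in simp)
  note ip = indicator_integrable[OF X_integrable[OF b a(1)] BM, of x]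
  have iB: "integrable (Px x) (\<lambda>w. indicator ?B w * c1)" using BM by (intro indicator_integrable) (auto intro: bounded_integrable[of _ "\<bar>c1\<bar>"])
  have "E x (\<lambda>w. indicator ?B w * (cum \<psi> (\<rho> w) w - cum \<psi> a w))
     = E x (\<lambda>w. indicator ?B w * (cum \<psi> T w - cum \<psi> a w) - indicator ?B w * (cum \<psi> T w - cum \<psi> (\<rho> w) w))"
    by (rule Bochner_Integration.integral_cong) (auto simp: algebra_simps)
  also have "\<dots> = E x (\<lambda>w. indicator ?B w * (cum \<psi> T w - cum \<psi> a w)) - E x (\<lambda>w. indicator ?B w * (cum \<psi> T w - cum \<psi> (\<rho> w) w))"
    using j1 j2 by simp
  finally have split: "E x (\<lambda>w. indicator ?B w * (cum \<psi> (\<rho> w) w - cum \<psi> a w))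
     = E x (\<lambda>w. indicator ?B w * (cum \<psi> T w - cum \<psi> a w)) - E x (\<lambda>w. indicator ?B w * (cum \<psi> T w - cum \<psi> (\<rho> w) w))" .
  have fixed: "E x (\<lambda>w. indicator ?B w * (cum \<psi> T w - cum \<psi> a w)) = E x (\<lambda>w. indicator ?B w * pot \<psi> (T - a) (X a w))"
    using markov_cum_fixed[OF stop_const[OF a(1) order_refl] prior_const[OF a(1) gt_F[OF \<rho> a(1)]] \<psi>(1), of "T - a" x] a by simp
  have lower: "E x (\<lambda>w. indicator ?B w * (cum \<psi> T w - cum \<psi> (\<rho> w) w)) \<ge> E x (\<lambda>w. - (indicator ?B w * c1))"
    unfolding markov_cum_until[OF \<rho> prior_gt[OF \<rho> a(1)] \<psi>(1)]
  proof (rule integral_mono)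
    show "integrable (Px x) (\<lambda>w. - (indicator ?B w * c1))" using iB by simp
    show "integrable (Px x) (\<lambda>w. indicator ?B w * pot \<psi> (T - \<rho> w) (X (\<rho> w) w))"
    proof (rule bounded_integrable)
      show "(\<lambda>w. indicator ?B w * pot \<psi> (T - \<rho> w) (X (\<rho> w) w)) \<in> borel_measurable M"
        using BM pot_measurable[OF \<psi>(1) _ X_stop_measurable0[OF \<rho>], of "\<lambda>w. T - \<rho> w"] stopD(4)[OF \<rho>] by simp
      fix w assume w: "w \<in> space M"
      have "\<bar>pot \<psi> (T - \<rho> w) (X (\<rho> w) w)\<bar> \<le> c * (T - \<rho> w)"
        using bounded_byD(2)[OF pot_bounded_by[OF \<psi>(1)]] stopD(2)[OF \<rho> w] by simp
      also have "\<dots> \<le> c * T" using stopD(1)[OF \<rho> w] bounded_byD(5)[OF \<psi>(1)] by (intro mult_left_mono) auto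
      finally have "\<bar>pot \<psi> (T - \<rho> w) (X (\<rho> w) w)\<bar> \<le> c * T" .
      then show "\<bar>indicator ?B w * pot \<psi> (T - \<rho> w) (X (\<rho> w) w)\<bar> \<le> c * T"
        by (simp add: indicator_def) (use abs_ge_zero order_trans in blast)
    qed
    fix w assume "w \<in> space (Px x)"
    then have "0 \<le> T - \<rho> w" using stopD(2)[OF \<rho>] by (simp add: Px)
    from low[OF this, of "X (\<rho> w) w"]
    show "- (indicator ?B w * c1) \<le> indicator ?B w * pot \<psi> (T - \<rho> w) (X (\<rho> w) w)"
      by (auto simp: indicator_def)
  qed
  have "E x (\<lambda>w. indicator ?B w * pot \<psi> (T - a) (X a w)) - E x (\<lambda>w. - (indicator ?B w * c1))
      = E x (\<lambda>w. indicator ?B w * (pot \<psi> (T - a) (X a w) + c1))"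
    using ip iB by (simp add: distrib_left)
  with split fixed lower show ?thesis by linarith
qed

lemma drift_bound_0:
  assumes \<rho>: "stop T \<rho>" and T: "0 \<le> T"
  shows "E x (\<lambda>w. cum \<psi> (\<rho> w) w) \<le> 2 * c * K x * tail 0 + c1"
proof -
  interpret prob_space "Px x" by (rule Px)
  let ?B = "{w \<in> space M. 0 < \<rho> w}"
  have BM: "?B \<in> sets M" using F(2)[OF order_refl gt_F[OF \<rho> order_refl]] .
  note ip = X_integrable[OF pot_bounded_by[OF \<psi>(1) T] order_refl, of x]
  have "E x (\<lambda>w. cum \<psi> (\<rho> w) w) = E x (\<lambda>w. indicator ?B w * (cum \<psi> (\<rho> w) w - cum \<psi> 0 w))"
  proof (rule Bochner_Integration.integral_cong)
    fix w assume "w \<in> space (Px x)"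
    then have w: "w \<in> space M" by (simp add: Px)
    show "cum \<psi> (\<rho> w) w = indicator ?B w * (cum \<psi> (\<rho> w) w - cum \<psi> 0 w)"
      using stopD(1)[OF \<rho> w] w by (cases "\<rho> w = 0") (auto simp: cum_0)
  qed simp
  also have "\<dots> \<le> E x (\<lambda>w. indicator ?B w * (pot \<psi> T (X 0 w) + c1))"
    using drift_bound[OF \<rho> order_refl T, of x] by simp
  also have "\<dots> \<le> E x (\<lambda>w. pot \<psi> T (X 0 w) + c1)"
  proof (rule integral_mono)
    show "integrable (Px x) (\<lambda>w. indicator ?B w * (pot \<psi> T (X 0 w) + c1))" using ip BM by (intro indicator_integrable) auto
    show "indicator ?B w * (pot \<psi> T (X 0 w) + c1) \<le> pot \<psi> T (X 0 w) + c1" for w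
      using low[OF T, of "X 0 w"] by (auto simp: indicator_def)
  qed (use ip in simp)
  also have "\<dots> = pot \<psi> T x + c1"
    using ip P_0[OF pot_bounded_by[OF \<psi>(1) T], of x] by (simp add: semigroup_def prob_space)
  also have "\<dots> \<le> 2 * c * K x * tail 0 + c1" using pot_bound[OF \<psi> T, of x] by simp
  finally show ?thesis .
qed

end

end

section \<open>Infinite horizon\<close>

context ergodic_process begin

lemma K_locally_bounded:
  obtains k where "0 \<le> k" "\<And>y. dist z y \<le> r \<Longrightarrow> K y \<le> k"
proof -
  obtain k where k: "\<And>y. y \<in> cball z r \<Longrightarrow> norm (K y) \<le> k"
    using K_bdd[OF proper[of z r]] unfolding bounded_iff by blast
  have "K y \<le> max k 0" if "dist z y \<le> r" for y using k[of y] that by auto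
  then show ?thesis using that[of "max k 0"] by auto
qed

lemma mu_cutoff_tendsto: "(\<lambda>n. \<integral>y. cutoff n y \<partial>\<mu>) \<longlonglongrightarrow> 1"
proof -
  interpret prob_space \<mu> by (rule mu)
  have "(\<lambda>n. \<integral>y. cutoff n y \<partial>\<mu>) \<longlonglongrightarrow> (\<integral>y. 1 \<partial>\<mu>)"
    by (rule integral_dominated_convergence[where w = "\<lambda>_. 1"])
       (use bounded_byD(1)[OF cutoff_bounded_by] cutoff_tendsto cutoff_range in auto)
  then show ?thesis by (simp add: prob_space)
qed

text \<open>Enlarging \<open>f\<close> far away keeps its \<open>\<mu>\<close>-mean negative but makes it positive off a compact set; there
  \<open>K\<close> may be unbounded, yet the potential of the enlarged function can only go up.\<close>

lemma majorant:
  assumes f: "bounded_by f c" and neg: "(\<integral>y. f y \<partial>\<mu>) < 0"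
  shows "\<exists>m \<psi> d c1. m < 0 \<and> bounded_by \<psi> d \<and> (\<integral>y. \<psi> y \<partial>\<mu>) = 0 \<and> 0 \<le> c1 \<and>
     (\<forall>y. f y - m \<le> \<psi> y) \<and> (\<forall>s\<ge>0. \<forall>y. - c1 \<le> pot \<psi> s y)"
proof -
  interpret prob_space \<mu> by (rule mu)
  have c: "0 \<le> c" using bounded_byD(5)[OF f] .
  \<comment> \<open>A third of the gap: the mean of f is -3 xi, the modification adds xi plus at
    most another xi, and the new mean m stays below -xi.\<close>
  define xi where "xi = - (\<integral>y. f y \<partial>\<mu>) / 3"
  have xi: "0 < xi" "(\<integral>y. f y \<partial>\<mu>) = - 3 * xi" using neg by (auto simp: xi_def)
  have "(\<lambda>n. c * (1 - (\<integral>y. cutoff n y \<partial>\<mu>))) \<longlonglongrightarrow> c * (1 - 1)" by (intro tendsto_intros mu_cutoff_tendsto)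
  then have "\<forall>\<^sub>F n in sequentially. c * (1 - (\<integral>y. cutoff n y \<partial>\<mu>)) < xi"
    by (rule order_tendstoD(2)) (use xi in simp)
  then obtain n where n: "c * (1 - (\<integral>y. cutoff n y \<partial>\<mu>)) < xi"
    using eventually_happens'[OF sequentially_bot] by blast
  \<comment> \<open>Where the cutoff vanishes, the added c compensates the worst value of f.
    Everywhere u is at least xi minus c times the cutoff.\<close>
  define u where "u y = xi + f y + c * (1 - cutoff n y)" for y
  have pt: "0 \<le> c * (1 - cutoff n y) \<and> c * (1 - cutoff n y) \<le> c" for y
    using c cutoff_range[of n y] by (auto simp: mult_left_le)
  have u: "bounded_by u (xi + 2 * c)"
  proof (rule bounded_byI)
    show "u \<in> borel_measurable borel" unfolding u_def
      using bounded_byD(1)[OF f] bounded_byD(1)[OF cutoff_bounded_by] by simp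
    show "\<bar>u y\<bar> \<le> xi + 2 * c" for y
      using pt[of y] bounded_byD(3,4)[OF f, of y] xi(1) unfolding u_def by (simp only: abs_le_iff) linarith
  qed
  define m where "m = (\<integral>y. u y \<partial>\<mu>)"
  have "m = xi + (\<integral>y. f y \<partial>\<mu>) + c * (1 - (\<integral>y. cutoff n y \<partial>\<mu>))"
    unfolding m_def u_def using mu_integrable[OF f] mu_integrable[OF cutoff_bounded_by] by (simp add: prob_space)
  then have m: "m < 0" using n xi by linarith
  define \<psi> where "\<psi> y = 1 * u y + (- m)" for y
  have \<psi>: "bounded_by \<psi> (xi + 2 * c + \<bar>m\<bar>)"
  proof (rule bounded_byI)
    show "\<psi> \<in> borel_measurable borel" unfolding \<psi>_def using bounded_byD(1)[OF u] by simp
    show "\<bar>\<psi> y\<bar> \<le> xi + 2 * c + \<bar>m\<bar>" for y using bounded_byD(2)[OF u, of y] unfolding \<psi>_def by linarith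
  qed
  have \<psi>0: "(\<integral>y. \<psi> y \<partial>\<mu>) = 0"
    unfolding \<psi>_def using mu_integrable[OF u] by (simp add: m_def prob_space)
  have "f y - m \<le> \<psi> y" for y using pt[of y, THEN conjunct1] xi(1) unfolding \<psi>_def u_def by simp
  \<comment> \<open>The cutoff's potential over one unit of time vanishes at infinity, so from
    points further out than r the gain of u during that unit is nonnegative; subtracting the
    negative m only helps.\<close>
  moreover obtain r where r: "\<And>y. r < dist origin y \<Longrightarrow> \<bar>pot (cutoff n) 1 y\<bar> < xi / (c + 1)"
    using C0_vanish[OF pot_C0[OF cutoff_C0, of 1], of "xi / (c + 1)"] xi(1) c by auto
  have far: "0 \<le> pot \<psi> 1 y" if "r < dist origin y" for y
  proof -
    have "c * pot (cutoff n) 1 y \<le> c * (xi / (c + 1))" using r[OF that] c by (intro mult_left_mono) auto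
    also have "\<dots> \<le> xi" using c xi(1) by (simp add: field_simps)
    finally have "0 \<le> (- c) * pot (cutoff n) 1 y + xi * 1" by simp
    also have "\<dots> = pot (\<lambda>y. (- c) * cutoff n y + xi) 1 y" by (rule pot_affine[OF cutoff_bounded_by, symmetric]) simp
    also have "\<dots> \<le> pot u 1 y"
    proof (rule pot_mono[OF _ u])
      have "\<bar>- c * cutoff n y + xi\<bar> \<le> c + xi" for y
      proof -
        have "0 \<le> c * cutoff n y \<and> c * cutoff n y \<le> c" using c cutoff_range[of n y] by (simp add: mult_left_le)
        then show ?thesis using xi(1) by (simp add: abs_le_iff)
      qed
      then show "bounded_by (\<lambda>y. - c * cutoff n y + xi) (c + xi)"
        using bounded_byD(1)[OF cutoff_bounded_by] by (intro bounded_byI) auto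
      show "- c * cutoff n y + xi \<le> u y" for y
        using bounded_byD(4)[OF f, of y] unfolding u_def by (simp add: algebra_simps)
    qed
    also have "\<dots> \<le> pot \<psi> 1 y" unfolding \<psi>_def pot_affine[OF u zero_le_one] using m by simp
    finally show ?thesis .
  qed
  obtain k where k: "\<And>y. dist origin y \<le> r \<Longrightarrow> K y \<le> k" using K_locally_bounded by blast
  define d where "d = xi + 2 * c + \<bar>m\<bar>"
  have d: "0 \<le> d" using xi(1) c by (simp add: d_def)
  \<comment> \<open>The first bound covers times up to 1, the second the starting points within
    distance r, where \<open>K\<close> is at most k.\<close>
  define c1 where "c1 = max d (2 * d * k * tail 0)"
  have c1: "0 \<le> c1" "d \<le> c1" "2 * d * k * tail 0 \<le> c1" using d by (auto simp: c1_def)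
  have near: "- c1 \<le> pot \<psi> s y" if s: "0 \<le> s" and y: "dist origin y \<le> r" for s y
  proof -
    have "2 * d * K y * tail 0 \<le> 2 * d * k * tail 0"
      using k(1)[OF y] d tail_nonneg[of 0] by (intro mult_right_mono mult_left_mono) auto
    then show ?thesis using pot_bound[OF \<psi> \<psi>0 s, of y] c1 unfolding d_def[symmetric] by linarith
  qed
  \<comment> \<open>Induction on an integer bound for the time. From a far point the first unit of
    time contributes nonnegatively, and the rest is a semigroup average of a potential over a
    shorter time.\<close>
  have low: "- c1 \<le> pot \<psi> s y" if "0 \<le> s" "s \<le> real N" for N s y
    using that
  proof (induction N arbitrary: s y)
    case 0
    then have "s = 0" by simp
    then show ?case using c1(1) bounded_byD(2)[OF pot_bounded_by[OF \<psi>, of 0], of y] by simp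
  next
    case (Suc N)
    consider "dist origin y \<le> r" | "s \<le> 1" | "r < dist origin y" "1 < s" by linarith
    then show ?case
    proof cases
      case 1 then show ?thesis using near Suc.prems by blast
    next
      case 2
      have "\<bar>pot \<psi> s y\<bar> \<le> d * s" using bounded_byD(2)[OF pot_bounded_by[OF \<psi> Suc.prems(1)]] by (simp add: d_def)
      also have "\<dots> \<le> d" using 2 d Suc.prems(1) by (simp add: mult_left_le)
      finally show ?thesis using c1(2) by linarith
    next
      case 3
      have s1: "0 \<le> s - 1" "s - 1 \<le> real N" using 3 Suc.prems by auto
      have "bounded_by (\<lambda>_::'e. - c1) c1" using c1 by (auto simp: bounded_by_def)
      from P_mono[OF this pot_bounded_by[OF \<psi> s1(1)] zero_le_one Suc.IH[OF s1], of y]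
      have "- c1 \<le> P 1 (pot \<psi> (s - 1)) y" by (simp add: P_const)
      also have "\<dots> = pot \<psi> s y - pot \<psi> 1 y" using pot_diff[OF \<psi> s1(1) zero_le_one, of y] by simp
      also have "\<dots> \<le> pot \<psi> s y" using far[OF 3(1)] by simp
      finally show ?thesis .
    qed
  qed
  have "- c1 \<le> pot \<psi> s y" if "0 \<le> s" for s y
    by (rule low[OF that real_nat_ceiling_ge])
  ultimately show ?thesis using m \<psi> \<psi>0 c1(1) by blast
qed

text \<open>A rule is compared with its truncation at a. The truncated rule is covered by the finite
  horizon; the reward collected later is bounded by a potential at the fixed time a, on the rare
  event that the rule is still running then.\<close>

lemma infinite_horizon_approx:
  assumes f: "bounded_by f cf" "continuous_on UNIV f" and g: "bounded_by g cg" "continuous_on UNIV g"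
    and neg: "(\<integral>y. f y \<partial>\<mu>) < 0" and e: "0 < e"
  shows "\<exists>v a. continuous_on UNIV v \<and> (\<exists>\<rho>. stop a \<rho> \<and> (\<forall>x. payoff f g \<rho> x = v x)) \<and>
     (\<forall>\<^sub>F x in nhds x0. \<forall>T\<ge>a. \<forall>\<rho>. stop T \<rho> \<longrightarrow> payoff f g \<rho> x \<le> v x + e)"
proof -
  obtain m \<psi> d c1 where m: "m < 0" and \<psi>: "bounded_by \<psi> d" "(\<integral>y. \<psi> y \<partial>\<mu>) = 0" and c1: "0 \<le> c1"
    and le: "\<And>y. f y - m \<le> \<psi> y" and low: "\<And>s y. 0 \<le> s \<Longrightarrow> - c1 \<le> pot \<psi> s y"
    using majorant[OF f(1) neg] by blast
  have d: "0 \<le> d" using bounded_byD(5)[OF \<psi>(1)] .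
  have cg: "0 \<le> cg" using bounded_byD(5)[OF g(1)] .
  obtain k where k0: "0 \<le> k" and k: "\<And>x. x \<in> cball x0 1 \<Longrightarrow> K x \<le> k"
    using K_locally_bounded[of x0 1] by auto
  \<comment> \<open>The payoff is at most 2dk \<open>tail 0\<close> + c1 + cg + m times the mean of
    \<open>\<rho>\<close>. If it is also at least -cg, then -m times that mean is at most A.
    Dividing by -m gives the bound C on the mean stopping time.\<close>
  define A where "A = 2 * d * k * tail 0 + c1 + 2 * cg"
  have A: "0 \<le> A" using d k0 tail_nonneg[of 0] c1 cg by (simp add: A_def)
  define C where "C = A / (- m)"
  have C: "0 \<le> C" using A m unfolding C_def by (intro divide_nonneg_nonneg) auto
  \<comment> \<open>The loss c1 comes from \<open>drift_bound\<close>, and 2cg from exchanging g at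
    the late stopping position for g at \<open>X a\<close>.\<close>
  have "0 \<le> c1 + 2 * cg" "0 < e / 2" using c1 cg e by auto
  from late_pot_small[OF \<psi> c1 low k C this] obtain a where a: "0 < a" and late: "\<forall>x\<in>cball x0 1. \<forall>B\<in>sets M. \<forall>S\<ge>0. measure (Px x) B \<le> C / a \<longrightarrow>
      E x (\<lambda>w. indicator B w * (pot \<psi> S (X a w) + (c1 + 2 * cg))) \<le> e / 2"
    by blast
  obtain v where v: "continuous_on UNIV v" "\<exists>\<rho>. stop a \<rho> \<and> (\<forall>x. payoff f g \<rho> x = v x)" "\<And>x. g x \<le> v x"
    and fin: "\<forall>\<^sub>F x in nhds x0. \<forall>\<rho>. stop a \<rho> \<longrightarrow> payoff f g \<rho> x \<le> v x + e / 2"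
    using finite_horizon_approx[OF f g, of "e / 2" a x0] e a by auto
  have "\<forall>\<^sub>F x in nhds x0. x \<in> ball x0 1"
    by (rule eventually_nhds_in_open) auto
  with fin have "\<forall>\<^sub>F x in nhds x0. \<forall>T\<ge>a. \<forall>\<rho>. stop T \<rho> \<longrightarrow> payoff f g \<rho> x \<le> v x + e"
  proof (eventually_elim, intro allI impI)
    fix x T \<rho>
    assume fin: "\<forall>\<rho>. stop a \<rho> \<longrightarrow> payoff f g \<rho> x \<le> v x + e / 2" and x: "x \<in> ball x0 1"
      and T: "a \<le> T" and \<rho>: "stop T \<rho>"
    interpret prob_space "Px x" by (rule Px)
    have T0: "0 \<le> T" using a T by simp
    have xc: "x \<in> cball x0 1" using x by simp
    note icf = cum_stop_integrable[OF \<rho> f(1), of x] and ig = comp_stop_integrable[OF \<rho> g(1), of x]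
      and ic\<psi> = cum_stop_integrable[OF \<rho> \<psi>(1), of x]
    have i\<rho>: "integrable (Px x) \<rho>"
      by (rule bounded_integrable[OF stopD(4)[OF \<rho>], of T]) (use stopD(1,2)[OF \<rho>] in auto)
    have cum_le: "cum f b w - cum f b' w \<le> cum \<psi> b w - cum \<psi> b' w + m * (b - b')"
      if w: "w \<in> space M" and b: "0 \<le> b'" "b' \<le> b" for b b' w
    proof -
      have m': "bounded_by (\<lambda>_::'e. m) \<bar>m\<bar>" by (simp add: bounded_by_def)
      have \<psi>m: "bounded_by (\<lambda>y. \<psi> y + m) (d + \<bar>m\<bar>)"
        using \<psi>(1) unfolding bounded_by_def by (auto intro: order_trans[OF abs_triangle_ineq])
      have "cum f b w - cum f b' w \<le> cum (\<lambda>y. \<psi> y + m) b w - cum (\<lambda>y. \<psi> y + m) b' w"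
      proof (rule cum_mono_le[OF f(1) \<psi>m _ w b])
        show "f y \<le> \<psi> y + m" for y using le[of y] by simp
      qed
      also have "\<dots> = (LINT s:{b'..b}|lborel. \<psi> (X s w) + m)" by (rule cum_diff[OF \<psi>m w b])
      also have "\<dots> = (LINT s:{b'..b}|lborel. \<psi> (X s w)) + (LINT s:{b'..b}|lborel. m)"
        by (rule set_integral_add[OF path_integrable[OF \<psi>(1) w b(1)]]) (rule path_integrable[OF m' w b(1)])
      also have "\<dots> = cum \<psi> b w - cum \<psi> b' w + m * (b - b')"
        using cum_diff[OF \<psi>(1) w b] b by (simp add: set_lebesgue_integral_def)
      finally show ?thesis .
    qed
    show "payoff f g \<rho> x \<le> v x + e"
    \<comment> \<open>A rule worse than -cg is beaten by stopping at once, since v is at least g.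
      Only the other rules have a controlled mean stopping time, and Markov's inequality then makes
      the event of outliving a rare.\<close>
    proof (cases "payoff f g \<rho> x < - cg")
      case True
      then show ?thesis using v(3)[of x] bounded_byD(4)[OF g(1), of x] e by linarith
    next
      case False
      have "E x (\<lambda>w. cum f (\<rho> w) w) \<le> E x (\<lambda>w. cum \<psi> (\<rho> w) w + m * \<rho> w)"
      proof (rule integral_mono[OF icf])
        fix w assume "w \<in> space (Px x)"
        then have w: "w \<in> space M" by (simp add: Px)
        show "cum f (\<rho> w) w \<le> cum \<psi> (\<rho> w) w + m * \<rho> w"
          using cum_le[OF w order_refl stopD(1)[OF \<rho> w]] by (simp add: cum_0)
      qed (use ic\<psi> i\<rho> in simp)
      also have "\<dots> = E x (\<lambda>w. cum \<psi> (\<rho> w) w) + m * E x (\<lambda>w. \<rho> w)" using ic\<psi> i\<rho> by simp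
      finally have 1: "E x (\<lambda>w. cum f (\<rho> w) w) \<le> E x (\<lambda>w. cum \<psi> (\<rho> w) w) + m * E x (\<lambda>w. \<rho> w)" .
      have 2: "E x (\<lambda>w. cum \<psi> (\<rho> w) w) \<le> 2 * d * K x * tail 0 + c1" by (rule drift_bound_0[OF \<psi> c1 low \<rho> T0])
      have 3: "2 * d * K x * tail 0 \<le> 2 * d * k * tail 0"
        using k[OF xc] d tail_nonneg[of 0] by (intro mult_right_mono mult_left_mono) auto
      have 4: "E x (\<lambda>w. g (X (\<rho> w) w)) \<le> cg"
        using integral_bounded[OF comp_stop_measurable[OF \<rho> g(1)] bounded_byD(2)[OF g(1)], of x] by (simp add: abs_le_iff)
      have 5: "payoff f g \<rho> x = E x (\<lambda>w. cum f (\<rho> w) w) + E x (\<lambda>w. g (X (\<rho> w) w))"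
        unfolding payoff_def using icf ig by simp
      have "- m * E x (\<lambda>w. \<rho> w) \<le> A" using 1 2 3 4 5 False unfolding A_def by linarith
      then have E: "E x (\<lambda>w. \<rho> w) \<le> C" using m unfolding C_def by (simp add: field_simps)
      let ?B = "{w \<in> space M. a < \<rho> w}"
      have BM: "?B \<in> sets M" using F(2)[OF _ gt_F[OF \<rho>]] a by simp
      have "measure (Px x) ?B \<le> C / a"
      proof -
        have iB: "integrable (Px x) (indicator ?B :: 'w \<Rightarrow> real)"
          by (rule bounded_integrable[of _ 1]) (use BM in \<open>auto simp: indicator_def\<close>)
        have "E x (\<lambda>w. a * indicator ?B w) \<le> E x (\<lambda>w. \<rho> w)"
        proof (rule integral_mono[OF _ i\<rho>])
          show "integrable (Px x) (\<lambda>w. a * indicator ?B w)" using iB by simp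
          fix w assume "w \<in> space (Px x)"
          then show "a * indicator ?B w \<le> \<rho> w" using stopD(1)[OF \<rho>, of w] by (auto simp: indicator_def Px)
        qed
        moreover have "E x (\<lambda>w. a * indicator ?B w) = a * measure (Px x) ?B"
          using BM by (simp add: Px Int_absorb1 sets.sets_into_space)
        ultimately show ?thesis using E a by (simp add: field_simps)
      qed
      with late xc BM T have small: "E x (\<lambda>w. indicator ?B w * (pot \<psi> (T - a) (X a w) + (c1 + 2 * cg))) \<le> e / 2" by simp
      let ?\<sigma> = "\<lambda>w. min (\<rho> w) a"
      have \<sigma>: "stop a ?\<sigma>" using stop_min[OF \<rho>, of a] a by simp
      note ja = cum_stop_integrable[OF stop_const[OF less_imp_le[OF a] order_refl] \<psi>(1), of x]
      note jp = X_integrable[OF pot_bounded_by[OF \<psi>(1), of "T - a"] less_imp_le[OF a], of x]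
      let ?u1 = "\<lambda>w. indicator ?B w * (cum \<psi> (\<rho> w) w - cum \<psi> a w)"
        and ?u2 = "\<lambda>w. indicator ?B w * (2 * cg)"
        and ?u3 = "\<lambda>w. indicator ?B w * (pot \<psi> (T - a) (X a w) + c1)"
        and ?u4 = "\<lambda>w. cum f (?\<sigma> w) w + g (X (?\<sigma> w) w)"
      have iB2: "integrable (Px x) ?u2"
        by (rule indicator_integrable[OF _ BM]) simp
      have iB1: "integrable (Px x) ?u1"
        by (rule indicator_integrable[OF Bochner_Integration.integrable_diff[OF ic\<psi> ja] BM])
      have iB3: "integrable (Px x) ?u3"
        by (rule indicator_integrable[OF _ BM]) (use jp T in simp)
      have iZ: "integrable (Px x) ?u4"
        using cum_stop_integrable[OF \<sigma> f(1), of x] comp_stop_integrable[OF \<sigma> g(1), of x] by simp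
      have "payoff f g \<rho> x \<le> E x (\<lambda>w. ?u4 w +
          (?u1 w + ?u2 w))"
        unfolding payoff_def
      proof (rule integral_mono)
        show "integrable (Px x) (\<lambda>w. cum f (\<rho> w) w + g (X (\<rho> w) w))" using icf ig by simp
        show "integrable (Px x) (\<lambda>w. ?u4 w +
          (?u1 w + ?u2 w))"
          by (intro Bochner_Integration.integrable_add iZ[simplified] iB1 iB2 cum_stop_integrable[OF \<sigma> f(1)] comp_stop_integrable[OF \<sigma> g(1)])
        fix w assume "w \<in> space (Px x)"
        then have w: "w \<in> space M" by (simp add: Px)
        show "cum f (\<rho> w) w + g (X (\<rho> w) w) \<le> ?u4 w +
          (?u1 w + ?u2 w)"
        proof (cases "a < \<rho> w")
          case True
          then have s: "?\<sigma> w = a" by simp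
          have "m * (\<rho> w - a) \<le> 0" using True m by (simp add: mult_le_0_iff)
          then have "cum f (\<rho> w) w - cum f a w \<le> cum \<psi> (\<rho> w) w - cum \<psi> a w"
            using cum_le[OF w less_imp_le[OF a], of "\<rho> w"] True by linarith
          moreover have "g (X (\<rho> w) w) \<le> g (X a w) + 2 * cg"
            using bounded_byD(3)[OF g(1), of "X (\<rho> w) w"] bounded_byD(4)[OF g(1), of "X a w"] by linarith
          moreover have "indicator ?B w = (1 :: real)" using True w by simp
          ultimately show ?thesis unfolding s by simp
        next
          case False
          then have "?\<sigma> w = \<rho> w" "indicator ?B w = (0 :: real)" by auto
          then show ?thesis by simp
        qed
      qed
      also have "\<dots> = payoff f g ?\<sigma> x + (E x ?u1 + E x ?u2)"
        unfolding payoff_def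
        by (subst Bochner_Integration.integral_add[OF iZ Bochner_Integration.integrable_add[OF iB1 iB2]])
           (subst Bochner_Integration.integral_add[OF iB1 iB2], rule refl)
      finally have p: "payoff f g \<rho> x \<le> payoff f g ?\<sigma> x + (E x ?u1 + E x ?u2)" .
      have q: "E x ?u1 \<le> E x ?u3"
        by (rule drift_bound[OF \<psi> c1 low \<rho> less_imp_le[OF a] T])
      have r: "E x ?u3 + E x ?u2
          = E x (\<lambda>w. indicator ?B w * (pot \<psi> (T - a) (X a w) + (c1 + 2 * cg)))"
        unfolding Bochner_Integration.integral_add[OF iB3 iB2, symmetric]
        by (rule Bochner_Integration.integral_cong) (auto simp: algebra_simps)
      have "payoff f g ?\<sigma> x \<le> v x + e / 2" using fin \<sigma> by blast
      with p q r small show ?thesis by linarith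
    qed
  qed
  with v show ?thesis by blast
qed

section \<open>Passage from bounded rules to extended stopping times and the value function\<close>

lemma stopping_time_truncated:
  assumes \<tau>: "stopping_time_of M F \<tau>" and T: "0 \<le> T"
  shows "stop T (\<lambda>w. enn2real (min (\<tau> w) (ennreal T)))"
  unfolding stop_def
proof (intro conjI ballI allI impI)
  fix w
  show "0 \<le> enn2real (min (\<tau> w) (ennreal T))" by simp
  have "enn2real (min (\<tau> w) (ennreal T)) \<le> enn2real (ennreal T)" by (rule enn2real_mono) auto
  then show "enn2real (min (\<tau> w) (ennreal T)) \<le> T" using T by simp
next
  fix t :: real assume t: "0 \<le> t"
  have "enn2real (min (\<tau> w) (ennreal T)) \<le> t \<longleftrightarrow> min (\<tau> w) (ennreal T) \<le> ennreal t" for w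
  proof -
    have "min (\<tau> w) (ennreal T) < top" by (simp add: min_less_iff_disj)
    then show ?thesis using t by (metis enn2real_leI enn2real_nonneg ennreal_enn2real ennreal_leI)
  qed
  then have "{w \<in> space M. enn2real (min (\<tau> w) (ennreal T)) \<le> t} = (if T \<le> t then space M else {w \<in> space M. \<tau> w \<le> ennreal t})"
    using T t by (auto simp: min_le_iff_disj ennreal_le_iff)
  then show "{w \<in> space M. enn2real (min (\<tau> w) (ennreal T)) \<le> t} \<in> sets (F t)"
    using \<tau> t space_F[OF t] by (auto simp: stopping_time_of_def)
qed

lemma value_fun_payoff:
  "value_fun M F X Px f g x = (SUP \<tau> \<in> {\<tau>. stopping_time_of M F \<tau>}.
     Limsup at_top (\<lambda>T. ereal (payoff f g (\<lambda>w. enn2real (min (\<tau> w) (ennreal T))) x)))"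
  unfolding value_fun_def payoff_def cum_def ..

text \<open>Truncating a rule bounded by a at any horizon beyond a does not change it, so the upper
  limit is the payoff itself.\<close>

lemma value_fun_ge:
  assumes \<rho>: "stop a \<rho>"
  shows "ereal (payoff f g \<rho> x) \<le> value_fun M F X Px f g x"
proof -
  let ?\<tau> = "\<lambda>w. ennreal (\<rho> w)"
  have "stopping_time_of M F ?\<tau>" unfolding stopping_time_of_def
  proof (intro allI impI)
    fix t :: real assume t: "0 \<le> t"
    then have "{w \<in> space M. ?\<tau> w \<le> ennreal t} = {w \<in> space M. \<rho> w \<le> t}" by auto
    then show "{w \<in> space M. ?\<tau> w \<le> ennreal t} \<in> sets (F t)" using stopD(3)[OF \<rho> t] by simp
  qed
  moreover have "Limsup at_top (\<lambda>T. ereal (payoff f g (\<lambda>w. enn2real (min (?\<tau> w) (ennreal T))) x)) = ereal (payoff f g \<rho> x)"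
  proof (rule lim_imp_Limsup[OF trivial_limit_at_top_linorder], rule tendsto_eventually)
    show "\<forall>\<^sub>F T in at_top. ereal (payoff f g (\<lambda>w. enn2real (min (?\<tau> w) (ennreal T))) x) = ereal (payoff f g \<rho> x)"
      using eventually_ge_at_top[of "max a 0"]
    proof eventually_elim
      case (elim T)
      have "enn2real (min (?\<tau> w) (ennreal T)) = \<rho> w" if w: "w \<in> space M" for w
      proof -
        have "\<rho> w \<le> T" "0 \<le> \<rho> w" using stopD(1,2)[OF \<rho> w] elim by auto
        then show ?thesis by (simp add: min_absorb1 ennreal_leI)
      qed
      then have "payoff f g (\<lambda>w. enn2real (min (?\<tau> w) (ennreal T))) x = payoff f g \<rho> x"
        unfolding payoff_def by (intro Bochner_Integration.integral_cong) (auto simp: Px)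
      then show ?case by simp
    qed
  qed
  ultimately show ?thesis unfolding value_fun_payoff by (intro SUP_upper2[of ?\<tau>]) auto
qed

lemma value_fun_le:
  assumes "\<And>T \<rho>. a \<le> T \<Longrightarrow> stop T \<rho> \<Longrightarrow> payoff f g \<rho> x \<le> b"
  shows "value_fun M F X Px f g x \<le> ereal b"
  unfolding value_fun_payoff
proof (rule SUP_least)
  fix \<tau> assume "\<tau> \<in> {\<tau>. stopping_time_of M F \<tau>}"
  then have \<tau>: "stopping_time_of M F \<tau>" by simp
  show "Limsup at_top (\<lambda>T. ereal (payoff f g (\<lambda>w. enn2real (min (\<tau> w) (ennreal T))) x)) \<le> ereal b"
  proof (rule Limsup_bounded)
    show "\<forall>\<^sub>F T in at_top. ereal (payoff f g (\<lambda>w. enn2real (min (\<tau> w) (ennreal T))) x) \<le> ereal b"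
      using eventually_ge_at_top[of "max a 0"]
    proof eventually_elim
      case (elim T)
      then show ?case using assms[of T, OF _ stopping_time_truncated[OF \<tau>]] by simp
    qed
  qed
qed

text \<open>Near each point the value lies between a continuous finite v and v + e. This gives
  finiteness, and with arbitrary e continuity by \<open>isCont_approx\<close>.\<close>

lemma value_fun_continuous:
  assumes f: "bounded_by f cf" "continuous_on UNIV f" and g: "bounded_by g cg" "continuous_on UNIV g"
    and neg: "(\<integral>y. f y \<partial>\<mu>) < 0"
  shows "(\<forall>x. \<bar>value_fun M F X Px f g x\<bar> \<noteq> \<infinity>) \<and>
         continuous_on UNIV (\<lambda>x. real_of_ereal (value_fun M F X Px f g x))"
proof -
  let ?w = "value_fun M F X Px f g"
  have approx: "\<exists>v. continuous_on UNIV v \<and> (\<forall>\<^sub>F x in nhds x0. ereal (v x) \<le> ?w x \<and> ?w x \<le> ereal (v x + e))"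
    if e: "0 < e" for x0 e
  proof -
    obtain v a \<rho> where v: "continuous_on UNIV v" and \<rho>: "stop a \<rho>" "\<And>x. payoff f g \<rho> x = v x"
      and ev: "\<forall>\<^sub>F x in nhds x0. \<forall>T\<ge>a. \<forall>\<rho>. stop T \<rho> \<longrightarrow> payoff f g \<rho> x \<le> v x + e"
      using infinite_horizon_approx[OF f g neg e, of x0] by blast
    from ev have "\<forall>\<^sub>F x in nhds x0. ereal (v x) \<le> ?w x \<and> ?w x \<le> ereal (v x + e)"
    proof eventually_elim
      case (elim x)
      then show ?case using value_fun_ge[OF \<rho>(1), of f g x] value_fun_le[of a f g x "v x + e"] \<rho>(2) by auto
    qed
    with v show ?thesis by blast
  qed
  have fin: "\<bar>?w x\<bar> \<noteq> \<infinity>" for x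
  proof -
    obtain v where "\<forall>\<^sub>F y in nhds x. ereal (v y) \<le> ?w y \<and> ?w y \<le> ereal (v y + 1)"
      using approx[of 1 x] by auto
    then have "ereal (v x) \<le> ?w x \<and> ?w x \<le> ereal (v x + 1)" by (rule eventually_nhds_x_imp_x)
    then show ?thesis by (cases "?w x") auto
  qed
  moreover have "isCont (\<lambda>x. real_of_ereal (?w x)) x0" for x0
  proof (rule isCont_approx)
    fix e :: real assume "0 < e"
    then obtain v where v: "continuous_on UNIV v"
      and ev: "\<forall>\<^sub>F x in nhds x0. ereal (v x) \<le> ?w x \<and> ?w x \<le> ereal (v x + e)" using approx by blast
    from ev have "\<forall>\<^sub>F y in nhds x0. \<bar>real_of_ereal (?w y) - v y\<bar> \<le> e"
    proof eventually_elim
      case (elim y)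
      with fin[of y] show ?case by (cases "?w y") auto
    qed
    with v show "\<exists>v. isCont v x0 \<and> (\<forall>\<^sub>F y in nhds x0. \<bar>real_of_ereal (?w y) - v y\<bar> \<le> e)"
      by (auto simp: continuous_on_eq_continuous_at)
  qed
  ultimately show ?thesis by (simp add: continuous_on_eq_continuous_at)
qed

end

lemma bounded_continuous_bounded_by:
  assumes "continuous_on UNIV f" "bounded (range f)"
  obtains c where "bounded_by f c"
  using assms that unfolding bounded_iff bounded_by_def by (auto intro: borel_measurable_continuous_onI)

theorem theorem2p29:
  fixes M :: "'w measure" and F :: "real \<Rightarrow> 'w measure"
    and X :: "real \<Rightarrow> 'w \<Rightarrow> 'e::{metric_space, second_countable_topology}"
    and Px :: "'e \<Rightarrow> 'w measure" and \<mu> :: "'e measure"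
    and f g K :: "'e \<Rightarrow> real" and h :: "real \<Rightarrow> real"
  assumes proper: "\<forall>(x::'e) r. compact (cball x r)"
    and markov: "markov_process M F X Px"
    and feller: "weak_feller Px X"
    and ergodic: "ergodic_with Px X \<mu>"
    and f_cont: "continuous_on UNIV f" and f_bdd: "bounded (range f)"
    and g_cont: "continuous_on UNIV g" and g_bdd: "bounded (range g)"
    and mu_f: "(\<integral>x. f x \<partial>\<mu>) < 0"
    and K_meas: "K \<in> borel_measurable borel"
    and K_pos: "\<forall>x. K x > 0"
    and K_bdd: "\<forall>C. compact C \<longrightarrow> bounded (K ` C)"
    and h_meas: "h \<in> borel_measurable borel"
    and h_nonneg: "\<forall>t\<ge>0. h t \<ge> 0"
    and h_int: "(\<integral>\<^sup>+ t\<in>{0..}. ennreal (h t) \<partial>lborel) < \<infinity>"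
    and D1: "\<forall>x. \<forall>t\<ge>0. tv_dist (transition Px X t x) \<mu> < K x * h t"
    and D2: "\<forall>x. \<forall>T\<ge>0. (\<integral>\<^sup>+ \<omega>. ennreal (K (X T \<omega>)) \<partial>Px x) < \<infinity>"
    and a_or_b: "strong_feller Px X \<or>
       (\<forall>L. compact L \<longrightarrow> (\<exists>\<alpha>>0. \<exists>B::real. \<forall>x\<in>L. \<forall>T\<ge>0.
           (\<integral>\<^sup>+ \<omega>. ennreal (K (X T \<omega>) powr (1 + \<alpha>)) \<partial>Px x) \<le> ennreal B))"
  shows "(\<forall>x. \<bar>value_fun M F X Px f g x\<bar> \<noteq> \<infinity>) \<and>
         continuous_on UNIV (\<lambda>x. real_of_ereal (value_fun M F X Px f g x))"
proof -
  interpret ergodic_process M F X Px \<mu> K h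
  proof unfold_locales
    show "markov_process M F X Px" by (rule markov)
    show "weak_feller Px X" by (rule feller)
    show "ergodic_with Px X \<mu>" by (rule ergodic)
    show "h \<in> borel_measurable borel" by (rule h_meas)
    show "(\<integral>\<^sup>+ t\<in>{0..}. ennreal (h t) \<partial>lborel) < \<infinity>" by (rule h_int)
    show "compact (cball x r)" for x :: 'e and r using proper by blast
    show "0 < K x" for x using K_pos by blast
    show "bounded (K ` C)" if "compact C" for C using K_bdd that by blast
    show "0 \<le> h t" if "0 \<le> t" for t using h_nonneg that by blast
    show "tv_dist (transition Px X t x) \<mu> < K x * h t" if "0 \<le> t" for t x using D1 that by blast
  qed
  obtain c where c: "bounded_by f c" using bounded_continuous_bounded_by[OF f_cont f_bdd] .
  obtain d where d: "bounded_by g d" using bounded_continuous_bounded_by[OF g_cont g_bdd] .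
  show ?thesis by (rule value_fun_continuous[OF c f_cont d g_cont mu_f])
qed

end
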